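(* Let $A$ be an expanding $2\times 2$ integer matrix and $f=f_A:\mathbb{T}^2\to\mathbb{T}^2$ the induced expanding toral endomorphism. Then $f$ admits a smooth, in fact linear, Markov partition if and only if for some positive integer $k$ the matrix $A^k$ is diagonalizable with integer eigenvalues. (That is, the following are equivalent: $f$ admits a smooth Markov partition; $f$ admits a linear Markov partition; some power $A^k$, $k\ge1$, is diagonalizable with integer eigenvalues.)
   Context: A $d\times d$ integer matrix $A$ is expanding if all its (complex) eigenvalues have modulus strictly greater than $1$. It induces the expanding toral endomorphism $f_A:\mathbb{T}^d\to\mathbb{T}^d$, $\mathbb{T}^d=\mathbb{R}^d/\mathbb{Z}^d$, $f_A(x+\mathbb{Z}^d)=Ax+\mathbb{Z}^d$. The torus carries the standard quotient metric induced by the Euclidean metric. A set $R$ in a compact metric space $X$ is proper if $R=\overline{\operatorname{int}(R)}\neq\emptyset$. A Markov partition for a positively expansive system $(X,f)$ is a finite cover $\mathcal{M}=\{R_i\}_{i=1}^n$ of $X$ by proper sets with pairwise disjoint interiors such that: (1) (metrically generating) for all $(x_k)_{k\ge 0}\in\{1,\dots,n\}^{\mathbb{N}}$, the set $\bigcap_{k=0}^\infty f^{-k}(\operatorname{int}(R_{x_k}))$ consists of at most one point; (2) (Markov property) for all $R,R'\in\mathcal{M}$, if $f(\operatorname{int}(R))\cap\operatorname{int}(R')\neq\emptyset$, then each $y\in\operatorname{int}(R')$ has a unique preimage under $f$ in $R$. (Every expanding toral endomorphism is positively expansive.) The boundary of $\mathcal{M}$ is $\partial\mathcal{M}:=\bigcup_{R\in\mathcal{M}}\partial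 R$. For a Markov partition $\mathcal{M}$ of an expanding toral endomorphism on $\mathbb{T}^2$: $\mathcal{M}$ is linear if $\partial\mathcal{M}$ is piecewise linear (a finite union of projections to $\mathbb{T}^2$ of line segments in $\mathbb{R}^2$); $\mathcal{M}$ is smooth if $\partial\mathcal{M}$ is piecewise $C^1$ (a finite union of $C^1$ arcs, a $C^1$ arc being the image of an injective $C^1$ map $[0,1]\to\mathbb{T}^2$ with nowhere vanishing derivative). *)

theory Defs
  imports "HOL-Analysis.Analysis"
begin

section \<open>The torus\<close>

definition lattice_equiv :: "real^'n \<Rightarrow> real^'n \<Rightarrow> bool" where
  "lattice_equiv x y \<longleftrightarrow> (\<forall>i. x $ i - y $ i \<in> \<int>)"

lemma equivp_lattice_equiv: "equivp (lattice_equiv :: real^'n \<Rightarrow> real^'n \<Rightarrow> bool)"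
proof (intro equivpI reflpI sympI transpI)
  fix x y z :: "real^'n"
  show "lattice_equiv x x"
    by (simp add: lattice_equiv_def)
  show "lattice_equiv y x" if "lattice_equiv x y"
    using that by (metis lattice_equiv_def minus_diff_eq minus_in_Ints_iff)
  show "lattice_equiv x z" if "lattice_equiv x y" "lattice_equiv y z"
    unfolding lattice_equiv_def
  proof
    fix i
    have "(x $ i - y $ i) + (y $ i - z $ i) \<in> \<int>"
      using that by (intro Ints_add) (auto simp: lattice_equiv_def)
    then show "x $ i - z $ i \<in> \<int>" by simp
  qed
qed

quotient_type 'n torus = "real^'n" / lattice_equiv
  morphisms rep_torus torus_proj
  by (rule equivp_lattice_equiv)

lemma torus_proj_eq_iff:
  "torus_proj x = torus_proj y \<longleftrightarrow> (\<forall>i. x $ i - y $ i \<in> \<int>)"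
  using torus.abs_eq_iff[of x y] by (simp add: lattice_equiv_def)

lemma torus_proj_cases [cases type: torus]:
  obtains x where "p = torus_proj x"
  by (metis Quotient3_abs_rep Quotient3_torus)

definition torus_fibre :: "('n::finite) torus \<Rightarrow> (real^'n) set" where
  "torus_fibre p = {x. torus_proj x = p}"

lemma torus_fibre_nonempty: "torus_fibre p \<noteq> {}"
  by (cases p) (auto simp: torus_fibre_def)

lemma torus_fibre_shift:
  assumes "x \<in> torus_fibre p" "x' \<in> torus_fibre p" "y \<in> torus_fibre q"
  shows "y + (x' - x) \<in> torus_fibre q"
  using assms unfolding torus_fibre_def
  by (auto simp: torus_proj_eq_iff)

lemma closed_torus_fibre: "closed (torus_fibre (p :: ('n::finite) torus))"
proof (cases p)
  case (1 y)
  have "torus_fibre p = (\<Inter>i. {x. x $ i - y $ i \<in> \<int>})"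
    by (auto simp: torus_fibre_def 1 torus_proj_eq_iff)
  moreover have "closed {x::real^'n. x $ i - y $ i \<in> \<int>}" for i
  proof -
    have "closed ((\<lambda>x::real^'n. x $ i - y $ i) -` \<int>)"
      by (intro closed_vimage closed_Ints continuous_intros)
    then show ?thesis by (simp add: vimage_def)
  qed
  ultimately show ?thesis by (simp add: closed_INT)
qed

lemma setdist_torus_fibre:
  assumes "x \<in> torus_fibre p"
  shows "setdist (torus_fibre p) (torus_fibre q) = infdist x (torus_fibre q)"
proof (rule antisym)
  show "setdist (torus_fibre p) (torus_fibre q) \<le> infdist x (torus_fibre q)"
    using assms by (simp add: infdist_eq_setdist setdist_le_sing)
  show "infdist x (torus_fibre q) \<le> setdist (torus_fibre p) (torus_fibre q)"
  proof (rule le_setdistI)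
    fix u v assume uv: "u \<in> torus_fibre p" "v \<in> torus_fibre q"
    have "infdist x (torus_fibre q) \<le> dist x (v + (x - u))"
      by (rule infdist_le) (rule torus_fibre_shift[OF uv(1) assms uv(2)])
    also have "\<dots> = dist u v"
      by (simp add: dist_norm norm_minus_commute algebra_simps)
    finally show "infdist x (torus_fibre q) \<le> dist u v" .
  qed (simp_all add: torus_fibre_nonempty)
qed

instantiation torus :: (finite) metric_space
begin

definition dist_torus :: "'a torus \<Rightarrow> 'a torus \<Rightarrow> real" where
  "dist_torus p q = setdist (torus_fibre p) (torus_fibre q)"

definition uniformity_torus :: "('a torus \<times> 'a torus) filter" where
  "uniformity_torus = (INF e\<in>{0<..}. principal {(x, y). dist x y < e})"

definition open_torus :: "'a torus set \<Rightarrow> bool" where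
  "open_torus U \<longleftrightarrow> (\<forall>x\<in>U. \<forall>\<^sub>F (x', y) in uniformity. x' = x \<longrightarrow> y \<in> U)"

instance
proof
  fix p q r :: "'a torus"
  obtain x where x: "x \<in> torus_fibre p"
    using torus_fibre_nonempty by blast
  show "dist p q = 0 \<longleftrightarrow> p = q"
  proof -
    have "dist p q = 0 \<longleftrightarrow> x \<in> torus_fibre q"
      unfolding dist_torus_def setdist_torus_fibre[OF x]
      using in_closed_iff_infdist_zero[OF closed_torus_fibre torus_fibre_nonempty] by blast
    then show ?thesis
      using x by (auto simp: torus_fibre_def)
  qed
  show "dist p q \<le> dist p r + dist q r"
  proof -
    obtain z where z: "z \<in> torus_fibre r"
      using torus_fibre_nonempty by blast
    have "setdist (torus_fibre p) (torus_fibre q)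
        \<le> setdist (torus_fibre p) {z} + setdist {z} (torus_fibre q)"
      by (rule setdist_triangle)
    also have "\<dots> = setdist (torus_fibre p) (torus_fibre r) + setdist (torus_fibre q) (torus_fibre r)"
      using setdist_torus_fibre[OF z, of p] setdist_torus_fibre[OF z, of q]
      by (simp add: infdist_eq_setdist setdist_sym)
    finally show ?thesis by (simp add: dist_torus_def)
  qed
qed (simp_all add: uniformity_torus_def open_torus_def)

end


section \<open>Expanding toral endomorphisms\<close>

definition mat_eigenvalue :: "'a::field^'n^'n \<Rightarrow> 'a \<Rightarrow> bool" where
  "mat_eigenvalue M c \<longleftrightarrow> (\<exists>v. v \<noteq> 0 \<and> M *v v = c *s v)"

definition diagonalizable :: "'a::field^'n^'n \<Rightarrow> bool" where
  "diagonalizable M \<longleftrightarrow>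
    (\<exists>P D :: 'a^'n^'n. invertible P \<and> (\<forall>i j. i \<noteq> j \<longrightarrow> D $ i $ j = 0) \<and> M = P ** D ** matrix_inv P)"

text \<open>The library's \<open>(^)\<close> on vectors and matrices is componentwise, hence a separate definition.\<close>

primrec mat_power :: "'a::semiring_1^'n^'n \<Rightarrow> nat \<Rightarrow> 'a^'n^'n" where
  "mat_power M 0 = mat 1"
| "mat_power M (Suc k) = M ** mat_power M k"

definition expanding :: "int^'n^'n \<Rightarrow> bool" where
  "expanding A \<longleftrightarrow> (\<forall>c::complex. mat_eigenvalue (map_matrix of_int A) c \<longrightarrow> cmod c > 1)"

definition diagonalizable_integer_eigenvalues :: "int^'n^'n \<Rightarrow> bool" where
  "diagonalizable_integer_eigenvalues A \<longleftrightarrow>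
    diagonalizable (map_matrix of_int A :: complex^'n^'n) \<and>
    (\<forall>c::complex. mat_eigenvalue (map_matrix of_int A) c \<longrightarrow> c \<in> \<int>)"

lift_definition toral_endo :: "int^'n^'n \<Rightarrow> ('n::finite) torus \<Rightarrow> 'n torus" is
  "\<lambda>A x. map_matrix real_of_int A *v x"
proof -
  fix A :: "int^'n^'n" and x y :: "real^'n"
  assume *: "lattice_equiv x y"
  show "lattice_equiv (map_matrix real_of_int A *v x) (map_matrix real_of_int A *v y)"
    unfolding lattice_equiv_def
  proof
    fix i
    have "(map_matrix real_of_int A *v x) $ i - (map_matrix real_of_int A *v y) $ i
        = (\<Sum>j\<in>UNIV. real_of_int (A $ i $ j) * (x $ j - y $ j))"
      by (simp add: matrix_vector_mult_def sum_subtractf right_diff_distrib)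
    also have "\<dots> \<in> \<int>"
      using * by (intro Ints_sum Ints_mult) (auto simp: lattice_equiv_def)
    finally show "(map_matrix real_of_int A *v x) $ i - (map_matrix real_of_int A *v y) $ i \<in> \<int>" .
  qed
qed


section \<open>Markov partitions\<close>

definition proper_set :: "'a::metric_space set \<Rightarrow> bool" where
  "proper_set R \<longleftrightarrow> R = closure (interior R) \<and> R \<noteq> {}"

definition metrically_generating :: "('a::metric_space \<Rightarrow> 'a) \<Rightarrow> 'a set set \<Rightarrow> bool" where
  "metrically_generating f \<M> \<longleftrightarrow>
    (\<forall>x::nat \<Rightarrow> 'a set. (\<forall>k. x k \<in> \<M>) \<longrightarrow>
      (\<exists>p. (\<Inter>k. (f ^^ k) -` interior (x k)) \<subseteq> {p}))"

definition markov_property :: "('a::metric_space \<Rightarrow> 'a) \<Rightarrow> 'a set set \<Rightarrow> bool" where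
  "markov_property f \<M> \<longleftrightarrow>
    (\<forall>R\<in>\<M>. \<forall>R'\<in>\<M>. f ` interior R \<inter> interior R' \<noteq> {} \<longrightarrow>
      (\<forall>y\<in>interior R'. \<exists>!x. x \<in> R \<and> f x = y))"

text \<open>A partition is given as the set of its members rather than as an indexed family; an indexing
  is necessarily injective, since the members have nonempty and pairwise disjoint interiors.\<close>

definition markov_partition :: "('a::metric_space \<Rightarrow> 'a) \<Rightarrow> 'a set set \<Rightarrow> bool" where
  "markov_partition f \<M> \<longleftrightarrow>
    finite \<M> \<and> \<Union>\<M> = UNIV \<and> (\<forall>R\<in>\<M>. proper_set R) \<and>
    pairwise (\<lambda>R R'. interior R \<inter> interior R' = {}) \<M> \<and>
    metrically_generating f \<M> \<and> markov_property f \<M>"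

definition partition_boundary :: "'a::metric_space set set \<Rightarrow> 'a set" where
  "partition_boundary \<M> = (\<Union>R\<in>\<M>. frontier R)"

definition linear_partition :: "('n::finite) torus set set \<Rightarrow> bool" where
  "linear_partition \<M> \<longleftrightarrow>
    (\<exists>S. finite S \<and> (\<forall>(a, b)\<in>S. a \<noteq> b) \<and>
      partition_boundary \<M> = (\<Union>(a, b)\<in>S. torus_proj ` closed_segment a b))"

text \<open>Tangent vectors of the torus are identified with vectors of the covering space: the derivative
  of a curve \<open>\<gamma>\<close> at \<open>t\<close> is that of any lift \<open>g\<close> of \<open>\<gamma>\<close> near \<open>t\<close>. It does not depend
  on the lift, since a lift differentiable at \<open>t\<close> is continuous there, so any two such lifts differ by
  a constant lattice vector near \<open>t\<close>.\<close>

definition has_torus_derivative ::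
    "(real \<Rightarrow> ('n::finite) torus) \<Rightarrow> real^'n \<Rightarrow> real \<Rightarrow> real set \<Rightarrow> bool" where
  "has_torus_derivative \<gamma> v t T \<longleftrightarrow>
    (\<exists>g. torus_proj (g t) = \<gamma> t \<and> (\<forall>\<^sub>F s in at t within T. torus_proj (g s) = \<gamma> s) \<and>
      (g has_vector_derivative v) (at t within T))"

definition C1_arc :: "('n::finite) torus set \<Rightarrow> bool" where
  "C1_arc C \<longleftrightarrow>
    (\<exists>\<gamma> \<gamma>'. C = \<gamma> ` {0..1} \<and> inj_on \<gamma> {0..1} \<and> continuous_on {0..1} \<gamma>' \<and>
      (\<forall>t\<in>{0..1}. has_torus_derivative \<gamma> (\<gamma>' t) t {0..1} \<and> \<gamma>' t \<noteq> 0))"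

definition smooth_partition :: "('n::finite) torus set set \<Rightarrow> bool" where
  "smooth_partition \<M> \<longleftrightarrow>
    (\<exists>\<C>. finite \<C> \<and> (\<forall>C\<in>\<C>. C1_arc C) \<and> partition_boundary \<M> = \<Union>\<C>)"

end

theory Submission
  imports Defs
begin

text \<open>
  Write \<open>T\<close> for the linear map of \<open>A\<close> on the plane and \<open>K\<close> for the preimage in the plane of the
  boundary of a Markov partition of the torus. The set \<open>K\<close> is closed, invariant under integer
  translations, not the whole plane, and \<open>T\<close> maps it into itself
  (\<open>partition_boundary_forward_invariant\<close>).

  Why a smooth partition forces integer eigenvalues. Let a curve in \<open>K\<close> have tangent vector \<open>v\<close> at
  \<open>p\<close>, where \<open>T\<close> stretches \<open>v\<close> at the fastest available rate. Then \<open>T ^^ n\<close> turns a tiny piece of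
  the curve around \<open>p\<close> into a long and almost straight piece, and a limit of these pieces is a whole
  straight line inside \<open>K\<close> (\<open>blow_up\<close>). A line projects to the torus as a dense set or as a closed
  geodesic, and long closed geodesics come close to every point; as \<open>K\<close> misses a disc, only finitely
  many directions of lines occur in \<open>K\<close>, all of them rational
  (\<open>line_direction_bounded_integer\<close>). They are permuted by \<open>T\<close>, so some power \<open>A ^ n\<close> has an integer
  eigenvector \<open>w\<close> (\<open>rational_periodic_direction\<close>). Both eigenvalues of \<open>A ^ n\<close> are then integers, and
  a second independent eigenvector of a power of \<open>A\<close> makes some power diagonalizable.

  Otherwise \<open>w\<close> spans the only direction that is periodic under \<open>T\<close>; this is the case of a Jordan
  block. There \<open>T\<close> maps the line with offset \<open>y\<close> parallel to \<open>w\<close> to the line with offset \<open>a * y\<close>, where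
  \<open>a\<close> is the eigenvalue, and every line obtained from a blow-up is parallel to \<open>w\<close>. A curve in \<open>K\<close>
  transversal to \<open>w\<close> meets lines of all offsets in some interval. Among these are offsets that
  multiplication by \<open>a\<close> carries infinitely often, modulo integer translations, to any prescribed
  offset of a dense set; blowing up at the corresponding points of the curve puts the lines of these
  offsets into \<open>K\<close>, contrary to \<open>K\<close> missing a disc (\<open>no_transversal_curve\<close>). Transversal curves exist
  because the partition is metrically generating: if all tangents of \<open>K\<close> were parallel to one vector
  \<open>e\<close>, then \<open>K\<close> would lie on countably many lines parallel to \<open>e\<close>, and all points of a line that avoids
  \<open>K\<close> forever would have the same itinerary (\<open>two_independent_tangents\<close>).

  Why integer eigenvalues give a linear partition. If \<open>A ^ k\<close> is diagonalizable with integer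
  eigenvalues, it has two independent integer left eigenvectors. Together with their images under the
  transposed matrix they form a finite set \<open>L\<close> of integer covectors such that \<open>T\<close> maps the union of the
  lines \<open>l \<bullet> x = n\<close>, where \<open>l \<in> L\<close> and \<open>n\<close> is an integer, into itself. Multiplying \<open>L\<close> by a large integer
  makes the cells of this arrangement small, and the projections of the closed cells form a Markov
  partition (\<open>markov_partition_cell_partition\<close>): by the invariance of the lines, a branch of the inverse
  of \<open>T\<close> maps a cell into a cell (\<open>preimage_in_open_cell\<close>). A linear partition is smooth because a short
  segment projects injectively to the torus.
\<close>

section \<open>The torus as a quotient of the plane\<close>

definition int_lattice :: "(real^'n) set" where
  "int_lattice = {z. \<forall>i. z $ i \<in> \<int>}"

lemma int_lattice_add: "x \<in> int_lattice \<Longrightarrow> y \<in> int_lattice \<Longrightarrow> x + y \<in> int_lattice"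
  and int_lattice_diff: "x \<in> int_lattice \<Longrightarrow> y \<in> int_lattice \<Longrightarrow> x - y \<in> int_lattice"
  and int_lattice_minus: "x \<in> int_lattice \<Longrightarrow> - x \<in> int_lattice"
  and int_lattice_scale: "x \<in> int_lattice \<Longrightarrow> c \<in> \<int> \<Longrightarrow> c *\<^sub>R x \<in> int_lattice"
  by (auto simp: int_lattice_def)

lemma int_lattice_norm_less_1:
  fixes z :: "real^'n::finite"
  assumes "z \<in> int_lattice" "norm z < 1"
  shows "z = 0"
proof -
  have "z $ i = 0" for i
  proof -
    have "\<bar>z $ i\<bar> < 1"
      using assms(2) component_le_norm_cart[of z i] by simp
    moreover have "z $ i \<in> \<int>" using assms(1) by (simp add: int_lattice_def)
    ultimately show ?thesis by (metis Ints_nonzero_abs_less1)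
  qed
  then show ?thesis by (simp add: vec_eq_iff)
qed

lemma torus_proj_eq_lattice: "torus_proj x = torus_proj y \<longleftrightarrow> x - y \<in> int_lattice"
  by (simp add: torus_proj_eq_iff int_lattice_def)

lemma torus_proj_add_lattice [simp]: "z \<in> int_lattice \<Longrightarrow> torus_proj (x + z) = torus_proj x"
  by (simp add: torus_proj_eq_lattice)

lemma dist_torus_proj_le: "dist (torus_proj x) (torus_proj y) \<le> dist x (y :: real^'n::finite)"
proof -
  have "x \<in> torus_fibre (torus_proj x)" "y \<in> torus_fibre (torus_proj y)"
    by (auto simp: torus_fibre_def)
  then show ?thesis
    unfolding dist_torus_def by (rule setdist_le_dist)
qed

lemma torus_proj_lift_near:
  fixes x :: "real^'n::finite"
  assumes "dist (torus_proj x) q < r"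
  obtains y where "torus_proj y = q" "dist x y < r"
proof -
  have x: "x \<in> torus_fibre (torus_proj x)" by (simp add: torus_fibre_def)
  have "infdist x (torus_fibre q) < r"
    using assms by (simp add: dist_torus_def setdist_torus_fibre[OF x])
  then have "\<exists>y\<in>torus_fibre q. dist x y < r"
    using torus_fibre_nonempty[of q] by (simp add: infdist_def cInf_less_iff)
  then show ?thesis using that by (auto simp: torus_fibre_def)
qed

lemma continuous_on_torus_proj: "continuous_on S (torus_proj :: real^'n::finite \<Rightarrow> _)"
  by (rule continuous_on_iff[THEN iffD2]) (meson dist_torus_proj_le le_less_trans)

lemma open_torus_proj_image:
  fixes U :: "(real^'n::finite) set"
  assumes "open U" shows "open (torus_proj ` U)"
  unfolding open_dist
proof
  fix p assume "p \<in> torus_proj ` U"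
  then obtain x where x: "x \<in> U" "p = torus_proj x" by auto
  obtain e where e: "e > 0" "\<And>y. dist y x < e \<Longrightarrow> y \<in> U"
    using assms x by (auto simp: open_dist)
  have "q \<in> torus_proj ` U" if "dist q p < e" for q
  proof -
    have "dist (torus_proj x) q < e" using that x by (simp add: dist_commute)
    then obtain y where "torus_proj y = q" "dist x y < e"
      by (rule torus_proj_lift_near)
    then show ?thesis using e by (auto simp: dist_commute)
  qed
  then show "\<exists>e>0. \<forall>y. dist y p < e \<longrightarrow> y \<in> torus_proj ` U" using e by auto
qed

lemma lattice_reduce:
  fixes x :: "real^'n::finite"
  obtains z where "z \<in> int_lattice" "x + z \<in> cbox 0 1"
proof
  let ?z = "(\<chi> i. - of_int \<lfloor>x $ i\<rfloor>) :: real^'n"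
  show "?z \<in> int_lattice" by (simp add: int_lattice_def)
  show "x + ?z \<in> cbox 0 1"
    by (auto simp: mem_box_cart) linarith+
qed

definition lattice_periodic :: "(real^'n) set \<Rightarrow> bool" where
  "lattice_periodic K \<longleftrightarrow> (\<forall>x\<in>K. \<forall>z\<in>int_lattice. x + z \<in> K)"

lemma lattice_periodicD: "lattice_periodic K \<Longrightarrow> x \<in> K \<Longrightarrow> z \<in> int_lattice \<Longrightarrow> x + z \<in> K"
  by (simp add: lattice_periodic_def)

lemma compact_torus: "compact (UNIV :: 'n::finite torus set)"
proof -
  have "p \<in> torus_proj ` cbox 0 1" for p :: "'n torus"
  proof (cases p)
    case (1 x)
    then show ?thesis using lattice_reduce[of x] by (metis imageI torus_proj_add_lattice)
  qed
  then have "UNIV = torus_proj ` (cbox 0 1 :: (real^'n) set)" by auto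
  then show ?thesis
    by (metis compact_cbox compact_continuous_image continuous_on_torus_proj)
qed

lemma toral_endo_proj: "toral_endo A (torus_proj x) = torus_proj (map_matrix real_of_int A *v x)"
  by (rule toral_endo.abs_eq)

lemma toral_endo_funpow_proj:
  "(toral_endo A ^^ n) (torus_proj x) = torus_proj ((((*v) (map_matrix real_of_int A)) ^^ n) x)"
  by (induction n) (simp_all add: toral_endo_proj)

lemma int_matrix_lattice:
  assumes "z \<in> int_lattice" shows "map_matrix real_of_int A *v z \<in> int_lattice"
  using assms by (auto simp: int_lattice_def matrix_vector_mult_def intro!: Ints_sum Ints_mult)

lemma continuous_on_toral_endo: "continuous_on S (toral_endo (A :: int^'n^'n::finite))"
proof -
  let ?M = "map_matrix real_of_int A"
  have "open (toral_endo A -` U)" if "open U" for U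
  proof -
    have "toral_endo A -` U = torus_proj ` ((*v) ?M -` (torus_proj -` U))"
    proof (intro set_eqI iffI)
      fix p assume "p \<in> toral_endo A -` U"
      then show "p \<in> torus_proj ` ((*v) ?M -` (torus_proj -` U))"
        by (cases p) (simp add: toral_endo_proj image_iff, blast)
    qed (auto simp: toral_endo_proj)
    moreover have "open ((*v) ?M -` (torus_proj -` U))"
      by (intro open_vimage that continuous_on_torus_proj linear_continuous_on
          linear_conv_bounded_linear[THEN iffD1] matrix_vector_mul_linear)
    ultimately show ?thesis by (simp add: open_torus_proj_image)
  qed
  then have "continuous_on UNIV (toral_endo A)"
    by (simp add: continuous_on_open_vimage)
  then show ?thesis using continuous_on_subset by blast
qed

section \<open>Linear algebra in the plane\<close>

abbreviation real_matrix :: "int^'n^'n \<Rightarrow> real^'n^'n" where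
  "real_matrix \<equiv> map_matrix real_of_int"

definition cross2 :: "real^2 \<Rightarrow> real^2 \<Rightarrow> real" where
  "cross2 x y = x $ 1 * y $ 2 - x $ 2 * y $ 1"

lemma cross2_linear [simp]:
  "cross2 x (y + z) = cross2 x y + cross2 x z" "cross2 (x + y) z = cross2 x z + cross2 y z"
  "cross2 x (y - z) = cross2 x y - cross2 x z" "cross2 (x - y) z = cross2 x z - cross2 y z"
  "cross2 x (c *\<^sub>R y) = c * cross2 x y" "cross2 (c *\<^sub>R x) y = c * cross2 x y"
  "cross2 x x = 0" "cross2 0 x = 0" "cross2 x 0 = 0"
  by (auto simp: cross2_def algebra_simps)

lemma cross2_commute: "cross2 y x = - cross2 x y"
  by (simp add: cross2_def)

lemma linear_cross2: "linear (cross2 x)"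
  by (rule linearI) auto

lemma bounded_linear_cross2: "bounded_linear (cross2 x)"
  by (simp add: linear_cross2 linear_conv_bounded_linear[symmetric])

lemma abs_cross2_le: "\<bar>cross2 x y\<bar> \<le> 2 * norm x * norm y"
proof -
  have "\<bar>x $ 1 * y $ 2\<bar> \<le> norm x * norm y" "\<bar>x $ 2 * y $ 1\<bar> \<le> norm x * norm y"
    unfolding abs_mult by (auto intro!: mult_mono component_le_norm_cart)
  then show ?thesis unfolding cross2_def by linarith
qed

text \<open>Cramer's rule, in a form without division.\<close>

lemma cross2_decomp:
  "cross2 v w *\<^sub>R x = cross2 x w *\<^sub>R v + cross2 v x *\<^sub>R w"
  by (simp add: vec_eq_iff forall_2 cross2_def algebra_simps)

lemma cross2_basis:
  assumes "cross2 v w \<noteq> 0"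
  shows "x = (cross2 x w / cross2 v w) *\<^sub>R v + (cross2 v x / cross2 v w) *\<^sub>R w"
proof -
  have "x = (1 / cross2 v w) *\<^sub>R (cross2 v w *\<^sub>R x)" using assms by simp
  also have "\<dots> = (1 / cross2 v w) *\<^sub>R (cross2 x w *\<^sub>R v + cross2 v x *\<^sub>R w)"
    by (subst cross2_decomp) (rule refl)
  finally show ?thesis by (simp add: scaleR_add_right)
qed

lemma cross2_eq_0_imp:
  assumes "cross2 w x = 0" "w \<noteq> 0"
  obtains c where "x = c *\<^sub>R w"
proof (cases "w $ 1 = 0")
  case True
  then have "w $ 2 \<noteq> 0" using assms(2) by (auto simp: vec_eq_iff forall_2)
  with True show ?thesis using assms(1)
    by (intro that[of "x $ 2 / w $ 2"]) (auto simp: vec_eq_iff forall_2 cross2_def)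
next
  case False
  with assms(1) show ?thesis
    by (intro that[of "x $ 1 / w $ 1"]) (auto simp: vec_eq_iff forall_2 cross2_def field_simps)
qed

lemma cross2_zero_trans:
  assumes "cross2 u v = 0" "cross2 u w = 0" "u \<noteq> 0"
  shows "cross2 v w = 0"
proof -
  obtain a b where "v = a *\<^sub>R u" "w = b *\<^sub>R u"
    using assms cross2_eq_0_imp by metis
  then show ?thesis by simp
qed

lemma cross2_matrix: "cross2 (M *v x) (M *v y) = det M * cross2 x y"
  by (simp add: cross2_def matrix_vector_mult_def sum_2 det_2 algebra_simps)

lemma cross2_int: "x \<in> int_lattice \<Longrightarrow> y \<in> int_lattice \<Longrightarrow> cross2 x y \<in> \<int>"
  by (auto simp: cross2_def int_lattice_def)

definition perp :: "real^2 \<Rightarrow> real^2" where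
  "perp l = vector [- l $ 2, l $ 1]"

lemma inner_perp [simp]: "l \<bullet> perp l = 0"
  by (simp add: perp_def inner_vec_def sum_2)

lemma cross2_perp: "cross2 l (perp l) = l \<bullet> l"
  by (simp add: perp_def cross2_def inner_vec_def sum_2)

lemma norm_perp: "norm (perp l) = norm l"
  by (simp add: norm_eq_sqrt_inner perp_def inner_vec_def sum_2)

lemma perp_int_lattice: "l \<in> int_lattice \<Longrightarrow> perp l \<in> int_lattice"
  by (auto simp: int_lattice_def perp_def forall_2)

lemma linear_funpow:
  fixes T :: "'a::real_vector \<Rightarrow> 'a"
  assumes "linear T" shows "linear (T ^^ n)"
proof (induction n)
  case 0 then show ?case by (simp add: linear_id[unfolded id_def] id_def)
next
  case (Suc n) then show ?case using linear_compose[OF Suc assms] by (simp add: o_def)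
qed

text \<open>A linear map is controlled by its values on a basis. What matters is that \<open>C'\<close> depends on
  \<open>v\<close>, \<open>w\<close> and \<open>C\<close> only, so that one constant serves all powers of a linear map.\<close>

lemma linear_dominated_by_basis_vector:
  assumes "cross2 v w \<noteq> 0"
  obtains C' where
    "\<And>f x. linear f \<Longrightarrow> norm (f w) \<le> C * norm (f v) \<Longrightarrow> norm (f x :: real^2) \<le> C' * norm (f v) * norm x"
proof -
  let ?D = "\<bar>cross2 v w\<bar>"
  let ?C = "(2 * norm w + 2 * norm v * \<bar>C\<bar>) / ?D"
  have "norm (f x) \<le> ?C * norm (f v) * norm x"
    if f: "linear f" "norm (f w) \<le> C * norm (f v)" for f :: "real^2 \<Rightarrow> real^2" and x
  proof -
    have fw: "norm (f w) \<le> \<bar>C\<bar> * norm (f v)"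
      using f(2) by (meson abs_ge_self mult_right_mono norm_ge_zero order_trans)
    have "f x = (cross2 x w / cross2 v w) *\<^sub>R f v + (cross2 v x / cross2 v w) *\<^sub>R f w"
      by (subst cross2_basis[OF assms, of x]) (simp add: linear_add[OF f(1)] linear_scale[OF f(1)])
    then have "norm (f x) \<le> \<bar>cross2 x w\<bar> / ?D * norm (f v) + \<bar>cross2 v x\<bar> / ?D * norm (f w)"
      by (metis norm_triangle_ineq norm_scaleR abs_divide)
    also have "\<dots> \<le> 2 * norm x * norm w / ?D * norm (f v) + 2 * norm v * norm x / ?D * (\<bar>C\<bar> * norm (f v))"
      by (intro add_mono mult_mono divide_right_mono abs_cross2_le) (use fw in auto)
    also have "\<dots> = ?C * norm (f v) * norm x"
      using assms by (simp add: field_simps)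
    finally show ?thesis .
  qed
  then show ?thesis by (rule that)
qed

section \<open>Orbits of an expanding map\<close>

lemma mat_eigenvalue_2I:
  fixes M :: "complex^2^2"
  assumes "(M$1$1 - c) * (M$2$2 - c) = M$1$2 * M$2$1"
  shows "mat_eigenvalue M c"
proof -
  have E: "mat_eigenvalue M c" if "M$1$1 * a + M$1$2 * b = c * a" "M$2$1 * a + M$2$2 * b = c * b"
    "a \<noteq> 0 \<or> b \<noteq> 0" for a b
  proof -
    have "M *v vector [a, b] = c *s vector [a, b]"
      using that(1,2) by (simp add: vec_eq_iff forall_2 matrix_vector_mult_def sum_2)
    moreover have "vector [a, b] \<noteq> (0 :: complex^2)"
      using that(3) by (auto simp: vec_eq_iff forall_2)
    ultimately show ?thesis unfolding mat_eigenvalue_def by blast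
  qed
  have q: "M$1$1 * M$2$2 + c * c = c * M$1$1 + c * M$2$2 + M$1$2 * M$2$1"
    using assms by (simp add: algebra_simps)
  consider "M$1$2 \<noteq> 0 \<or> M$1$1 \<noteq> c" | "M$2$1 \<noteq> 0 \<or> M$2$2 \<noteq> c"
    | "M$1$2 = 0" "M$1$1 = c" "M$2$1 = 0" "M$2$2 = c" by metis
  then show ?thesis
  proof cases
    case 1
    show ?thesis
    proof (rule E)
      show "M$2$1 * M$1$2 + M$2$2 * (c - M$1$1) = c * (c - M$1$1)"
        using q by (simp add: algebra_simps)
    qed (use 1 in \<open>auto simp: algebra_simps\<close>)
  next
    case 2
    show ?thesis
    proof (rule E)
      show "M$1$1 * (c - M$2$2) + M$1$2 * M$2$1 = c * (c - M$2$2)"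
        using q by (simp add: algebra_simps)
    qed (use 2 in \<open>auto simp: algebra_simps\<close>)
  next
    case 3
    then show ?thesis by (intro E[of 1 0]) auto
  qed
qed

text \<open>Let \<open>l\<close> and \<open>m\<close> be the complex eigenvalues and \<open>x\<close> the orbit of \<open>v\<close>. By Cayley--Hamilton the
  differences \<open>x (n + 1) - l * x n\<close> are multiplied by \<open>m\<close> in each step. If they do not vanish, \<open>x\<close> grows
  at least like the powers of \<open>m\<close>; if they vanish, \<open>x\<close> grows like the powers of \<open>l\<close>.
  This covers complex, repeated and distinct real eigenvalues at once.\<close>

lemma orbit_tendsto_at_top:
  fixes A :: "int^2^2" and v :: "real^2"
  assumes "expanding A" "v \<noteq> 0"
  shows "filterlim (\<lambda>n. norm (((*v) (real_matrix A) ^^ n) v)) at_top sequentially"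
proof -
  let ?M = "real_matrix A"
  define x where "x n = ((*v) ?M ^^ n) v" for n
  have x0: "x 0 = v" and xS: "\<And>n. x (Suc n) = ?M *v x n" by (auto simp: x_def)
  define t d where "t = complex_of_int (A$1$1 + A$2$2)" and "d = complex_of_int (A$1$1 * A$2$2 - A$1$2 * A$2$1)"
  define l m where "l = (t + csqrt (t\<^sup>2 - 4 * d)) / 2" and "m = (t - csqrt (t\<^sup>2 - 4 * d)) / 2"
  have lm: "l + m = t" "l * m = d"
    by (auto simp: l_def m_def field_simps power2_eq_square[symmetric])
  have root: "(of_int (A$1$1) - c) * (of_int (A$2$2) - c) - of_int (A$1$2) * of_int (A$2$1) = (c - l) * (c - m)" for c
  proof -
    have "(c - l) * (c - m) = c * c - (l + m) * c + l * m" by (simp add: algebra_simps)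
    then show ?thesis unfolding lm by (simp add: t_def d_def algebra_simps)
  qed
  have big: "cmod l > 1" "cmod m > 1"
    using assms(1) root[of l] root[of m] unfolding expanding_def by (auto intro!: mat_eigenvalue_2I)
  have CH: "complex_of_real (x (Suc (Suc n)) $ i) = t * x (Suc n) $ i - d * x n $ i" for n i
    using exhaust_2[of i]
    by (auto simp: xS matrix_vector_mult_def sum_2 t_def d_def algebra_simps)
  define w where "w n i = complex_of_real (x (Suc n) $ i) - l * x n $ i" for n i
  have wS: "w (Suc n) i = m * w n i" for n i
    unfolding w_def CH lm[symmetric] by (simp add: algebra_simps)
  have wn: "w n i = m ^ n * w 0 i" for n i
    by (induction n) (auto simp: wS)
  have pow: "filterlim (\<lambda>n. b ^ n * a :: real) at_top sequentially" if "b > 1" "a > 0" for a b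
  proof (rule filterlim_at_top_mult_tendsto_pos[OF tendsto_const that(2)])
    have "filterlim (\<lambda>n. b ^ n) at_infinity sequentially"
      using that(1) by (intro filterlim_realpow_sequentially_gt1) auto
    then show "filterlim (\<lambda>n. b ^ n) at_top sequentially"
      using that(1) by (intro filterlim_at_infinity_imp_filterlim_at_top always_eventually) auto
  qed
  have "filterlim (\<lambda>n. norm (x n)) at_top sequentially"
  proof (cases "\<exists>i. w 0 i \<noteq> 0")
    case True
    then obtain i where i: "w 0 i \<noteq> 0" by auto
    define K where "K = onorm ((*v) ?M) + cmod l"
    have K: "K > 0" unfolding K_def using big(1)
      by (intro add_nonneg_pos onorm_pos_le matrix_vector_mul_bounded_linear) auto
    have le: "cmod m ^ n * (cmod (w 0 i) / K) \<le> norm (x n)" for n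
    proof -
      have "cmod m ^ n * cmod (w 0 i) = cmod (w n i)" by (simp add: wn[of n] norm_mult norm_power)
      also have "\<dots> \<le> \<bar>x (Suc n) $ i\<bar> + cmod l * \<bar>x n $ i\<bar>"
        unfolding w_def by (rule order_trans[OF norm_triangle_ineq4]) (simp add: norm_mult)
      also have "\<dots> \<le> norm (x (Suc n)) + cmod l * norm (x n)"
        by (intro add_mono mult_left_mono component_le_norm_cart) auto
      also have "norm (x (Suc n)) \<le> onorm ((*v) ?M) * norm (x n)"
        unfolding xS by (intro onorm matrix_vector_mul_bounded_linear)
      finally show ?thesis using K by (simp add: K_def field_simps)
    qed
    have "filterlim (\<lambda>n. cmod m ^ n * (cmod (w 0 i) / K)) at_top sequentially"
      using i K by (intro pow big) auto
    then show ?thesis by (rule filterlim_at_top_mono) (intro always_eventually allI le)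
  next
    case False
    have "\<exists>i. v $ i \<noteq> 0" using assms(2) unfolding vec_eq_iff by simp
    then obtain i where i: "v $ i \<noteq> 0" by blast
    have "w 0 i = 0" using False by auto
    then have "w n i = 0" for n by (subst wn) simp
    then have "complex_of_real (x (Suc n) $ i) = l * x n $ i" for n by (simp add: w_def)
    then have "complex_of_real (x n $ i) = l ^ n * v $ i" for n
      by (induction n) (simp_all add: x0)
    then have "cmod (complex_of_real (x n $ i)) = cmod (l ^ n * v $ i)" for n by presburger
    then have "\<bar>x n $ i\<bar> = cmod l ^ n * \<bar>v $ i\<bar>" for n
      unfolding norm_mult norm_power norm_of_real .
    then have le: "cmod l ^ n * \<bar>v $ i\<bar> \<le> norm (x n)" for n
      using component_le_norm_cart[of "x n" i] by metis
    have "filterlim (\<lambda>n. cmod l ^ n * \<bar>v $ i\<bar>) at_top sequentially"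
      using i by (intro pow big) auto
    then show ?thesis by (rule filterlim_at_top_mono) (intro always_eventually allI le)
  qed
  then show ?thesis by (simp add: x_def)
qed

text \<open>A vector in the kernel would have a bounded orbit.\<close>

lemma expanding_inj:
  assumes "expanding A" "real_matrix A *v x = real_matrix A *v (y::real^2)"
  shows "x = y"
proof (rule ccontr)
  assume "x \<noteq> y"
  then have lim: "filterlim (\<lambda>n. norm (((*v) (real_matrix A) ^^ n) (x - y))) at_top sequentially"
    using orbit_tendsto_at_top[OF assms(1), of "x - y"] by simp
  have "((*v) (real_matrix A) ^^ Suc n) (x - y) = 0" for n
    by (induction n) (use assms(2) in \<open>simp_all add: matrix_vector_mult_diff_distrib\<close>)
  then have "eventually (\<lambda>n. norm (((*v) (real_matrix A) ^^ n) (x - y)) = 0) sequentially"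
    by (metis (mono_tags, lifting) Suc_le_D eventually_sequentially norm_zero)
  moreover have "eventually (\<lambda>n. norm (((*v) (real_matrix A) ^^ n) (x - y)) \<ge> 1) sequentially"
    using lim by (simp add: filterlim_at_top)
  ultimately have "eventually (\<lambda>n::nat. False) sequentially" by eventually_elim simp
  then show False by simp
qed

lemma expanding_det: assumes "expanding (A::int^2^2)" shows "det (real_matrix A) \<noteq> 0"
proof -
  have "inj ((*v) (real_matrix A))" using expanding_inj[OF assms] by (auto intro: injI)
  then show ?thesis by (metis det_nz_iff_inj matrix_of_matrix_vector_mul matrix_vector_mul_linear)
qed

lemma expanding_surj:
  assumes "expanding (A::int^2^2)" obtains x where "real_matrix A *v x = y"
proof -
  have "inj ((*v) (real_matrix A))" using expanding_inj[OF assms] by (auto intro: injI)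
  then have "surj ((*v) (real_matrix A))"
    using linear_injective_imp_surjective[OF matrix_vector_mul_linear, of "real_matrix A"] by simp
  then show ?thesis using that by (metis surjD)
qed

section \<open>Integer eigenvectors\<close>

lemma matrix_inv_both:
  assumes "invertible P"
  shows "P ** matrix_inv P = mat 1" "matrix_inv P ** P = mat 1"
  using assms unfolding invertible_def matrix_inv_def by (metis (mono_tags, lifting) someI_ex)+

lemma diagonalizableI:
  fixes M P D :: "'a::field^'n^'n"
  assumes inv: "invertible P" and "\<And>i j. i \<noteq> j \<Longrightarrow> D $ i $ j = 0" and MP: "M ** P = P ** D"
  shows "diagonalizable M"
proof -
  have "M = P ** D ** matrix_inv P"
    by (metis MP inv matrix_inv_both(1) matrix_mul_assoc matrix_mul_rid)
  then show ?thesis unfolding diagonalizable_def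
    by (intro exI[of _ P] exI[of _ D] conjI allI impI assms)
qed

lemma map_matrix_mult_of_int:
  "map_matrix of_int (A ** B) = (map_matrix of_int A ** map_matrix of_int B :: 'a::comm_ring_1^'n^'n)"
  by (simp add: vec_eq_iff matrix_matrix_mult_def)

lemma map_matrix_mat_1: "map_matrix of_int (mat 1) = (mat 1 :: 'a::comm_ring_1^'n^'n)"
  by (simp add: vec_eq_iff mat_def)

lemma real_matrix_power: "real_matrix (mat_power A k) *v x = ((*v) (real_matrix A) ^^ k) x"
  by (induction k) (simp_all add: map_matrix_mat_1 map_matrix_mult_of_int matrix_vector_mul_assoc[symmetric] del: map_matrix_def)

lemma mat_eigenvalue_2D:
  fixes M :: "'a::field^2^2"
  assumes "mat_eigenvalue M l"
  shows "(M$1$1 - l) * (M$2$2 - l) - M$1$2 * M$2$1 = 0"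
proof -
  obtain v where v: "v \<noteq> 0" "M *v v = l *s v" using assms unfolding mat_eigenvalue_def by blast
  have vi: "(M *v v) $ i = (l *s v) $ i" for i by (simp only: v(2))
  have e: "M$1$1 * v$1 + M$1$2 * v$2 = l * v$1" "M$2$1 * v$1 + M$2$2 * v$2 = l * v$2"
    using vi[of 1] vi[of 2] by (simp_all add: matrix_vector_mult_def sum_2)
  let ?p = "(M$1$1 - l) * (M$2$2 - l) - M$1$2 * M$2$1"
  have "?p * v$1 = 0" "?p * v$2 = 0" using e by algebra+
  moreover have "v$1 \<noteq> 0 \<or> v$2 \<noteq> 0" using v(1) by (auto simp: vec_eq_iff forall_2)
  ultimately show ?thesis by auto
qed

text \<open>Divide \<open>w\<close> by the greatest common divisor of its entries. By Bezout some integer combination of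
  the entries is then \<open>1\<close>, and the same combination of the entries of the image is \<open>c\<close>.\<close>

lemma integer_eigenvector_eigenvalue:
  fixes B :: "int^2^2"
  assumes "w \<in> int_lattice" "w \<noteq> 0" "real_matrix B *v w = c *\<^sub>R w"
  shows "c \<in> \<int>"
proof -
  obtain p q where pq: "w $ 1 = of_int p" "w $ 2 = of_int q"
    using assms(1) unfolding int_lattice_def by (metis (mono_tags) Ints_cases mem_Collect_eq)
  have "p \<noteq> 0 \<or> q \<noteq> 0" using assms(2) pq by (auto simp: vec_eq_iff forall_2)
  then have g: "gcd p q \<noteq> 0" by auto
  obtain p' q' where pq': "p = gcd p q * p'" "q = gcd p q * q'"
    by (meson dvdE gcd_dvd1 gcd_dvd2)
  obtain a b where ab: "a * p + b * q = gcd p q" by (metis bezout_int)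
  have e: "B$1$1 * real_of_int p + B$1$2 * real_of_int q = c * p"
       "B$2$1 * real_of_int p + B$2$2 * real_of_int q = c * q"
    using assms(3) pq by (auto simp: vec_eq_iff forall_2 matrix_vector_mult_def sum_2)
  let ?n = "a * (B$1$1 * p' + B$1$2 * q') + b * (B$2$1 * p' + B$2$2 * q')"
  have "c * gcd p q = real_of_int a * (c * p) + real_of_int b * (c * q)"
    by (subst ab[symmetric]) (simp add: algebra_simps)
  also have "\<dots> = real_of_int (a * (B$1$1 * p + B$1$2 * q) + b * (B$2$1 * p + B$2$2 * q))"
    by (simp add: e[symmetric])
  also have "a * (B$1$1 * p + B$1$2 * q) + b * (B$2$1 * p + B$2$2 * q) = gcd p q * ?n"
  proof -
    have "a * (B$1$1 * (g * p') + B$1$2 * (g * q')) + b * (B$2$1 * (g * p') + B$2$2 * (g * q')) = g * ?n" for g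
      by (simp add: algebra_simps)
    from this[of "gcd p q"] show ?thesis by (simp only: pq'[symmetric])
  qed
  finally have "c * real_of_int (gcd p q) = real_of_int ?n * real_of_int (gcd p q)" by simp
  then have "c = real_of_int ?n" using g by (metis mult_cancel_right of_int_eq_0_iff)
  then show ?thesis by (metis Ints_of_int)
qed

text \<open>The second eigenvalue is the trace minus \<open>c\<close>, hence an integer although \<open>u\<close> need not be
  rational.\<close>

lemma diagonalizable_if_eigenbasis:
  fixes B :: "int^2^2"
  assumes w: "w \<in> int_lattice" "real_matrix B *v w = c *\<^sub>R w"
    and u: "real_matrix B *v u = c' *\<^sub>R u" and wu: "cross2 w u \<noteq> 0"
  shows "diagonalizable_integer_eigenvalues B"
proof -
  let ?C = "map_matrix of_int B :: complex^2^2"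
  have "w \<noteq> 0" using wu by auto
  then have c: "c \<in> \<int>" using integer_eigenvector_eigenvalue w by blast
  have "cross2 (real_matrix B *v w) u + cross2 w (real_matrix B *v u) = real_of_int (B$1$1 + B$2$2) * cross2 w u"
    by (simp add: cross2_def matrix_vector_mult_def sum_2 algebra_simps)
  then have "(c + c') * cross2 w u = real_of_int (B$1$1 + B$2$2) * cross2 w u"
    by (simp add: w u algebra_simps)
  then have tr: "c + c' = real_of_int (B$1$1 + B$2$2)" using wu by simp
  have c': "c' \<in> \<int>"
  proof -
    have "c' = real_of_int (B$1$1 + B$2$2) - c" using tr by simp
    then show ?thesis using c by (metis Ints_diff Ints_of_int)
  qed
  have "c * c' * cross2 w u = det (real_matrix B) * cross2 w u"
    using cross2_matrix[of "real_matrix B" w u] by (simp add: w u mult.assoc mult.left_commute)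
  then have dt: "c * c' = det (real_matrix B)" using wu by simp
  let ?P = "(\<chi> i j. complex_of_real (if j = 1 then w $ i else u $ i)) :: complex^2^2"
  let ?D = "(\<chi> i j. complex_of_real (if i = j then if j = 1 then c else c' else 0)) :: complex^2^2"
  have "det ?P = complex_of_real (cross2 w u)"
    by (simp add: det_2 cross2_def)
  then have inv: "invertible ?P" using wu by (simp add: invertible_det_nz)
  have "?C ** ?P = ?P ** ?D"
  proof -
    have "real_of_int (B$i$1) * w$1 + real_of_int (B$i$2) * w$2 = w $ i * c"
         "real_of_int (B$i$1) * u$1 + real_of_int (B$i$2) * u$2 = u $ i * c'" for i
      using w(2) u by (auto simp: vec_eq_iff matrix_vector_mult_def sum_2 mult.commute)
    then have "complex_of_real (real_of_int (B$i$1) * w$1 + real_of_int (B$i$2) * w$2) = complex_of_real (w $ i * c)"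
         "complex_of_real (real_of_int (B$i$1) * u$1 + real_of_int (B$i$2) * u$2) = complex_of_real (u $ i * c')" for i
      by presburger+
    then show ?thesis
      by (simp add: vec_eq_iff matrix_matrix_mult_def sum_2 forall_2)
  qed
  then have "diagonalizable ?C"
    by (rule diagonalizableI[OF inv, rotated]) simp
  moreover have "l \<in> \<int>" if "mat_eigenvalue ?C l" for l
  proof -
    let ?p = "(B$1$1 - l) * (B$2$2 - l) - of_int (B$1$2) * of_int (B$2$1)"
    have "?p = 0" using mat_eigenvalue_2D[OF that] by simp
    moreover have "?p = (l - complex_of_real c) * (l - complex_of_real c')"
    proof -
      have "complex_of_real (c + c') = of_int (B$1$1 + B$2$2)" unfolding tr by simp
      moreover have "complex_of_real (c * c') = of_int (B$1$1 * B$2$2 - B$1$2 * B$2$1)"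
        unfolding dt by (simp add: det_2)
      moreover have "(l - complex_of_real c) * (l - complex_of_real c') = l * l - complex_of_real (c + c') * l + complex_of_real (c * c')"
        by (simp add: algebra_simps)
      ultimately show ?thesis by (simp add: algebra_simps)
    qed
    ultimately have "l = complex_of_real c \<or> l = complex_of_real c'" by auto
    then show ?thesis using c c' by (auto elim!: Ints_cases)
  qed
  ultimately show ?thesis by (simp add: diagonalizable_integer_eigenvalues_def del: map_matrix_def)
qed

text \<open>For eigenvalues \<open>m \<noteq> m'\<close> the rows of \<open>B - m'\<close> are left eigenvectors for \<open>m\<close>, because
  \<open>(B - m') (B - m) = 0\<close>; a diagonalizable matrix with a double eigenvalue is scalar.\<close>

lemma integer_left_eigenbasis:
  fixes B :: "int^2^2"
  assumes "diagonalizable_integer_eigenvalues B"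
  obtains r r' m m' where "r \<in> int_lattice" "r' \<in> int_lattice" "cross2 r r' \<noteq> 0" "m \<in> \<int>" "m' \<in> \<int>"
    "transpose (real_matrix B) *v r = m *\<^sub>R r" "transpose (real_matrix B) *v r' = m' *\<^sub>R r'"
proof -
  let ?C = "map_matrix of_int B :: complex^2^2"
  obtain P D :: "complex^2^2" where inv: "invertible P" and D: "\<And>i j. i \<noteq> j \<Longrightarrow> D $ i $ j = 0"
    and C: "?C = P ** D ** matrix_inv P"
    using assms by (auto simp: diagonalizable_integer_eigenvalues_def diagonalizable_def)
  have CP: "?C ** P = P ** D"
    unfolding C by (metis inv matrix_inv_both(2) matrix_mul_assoc matrix_mul_rid)
  have ev: "D $ j $ j \<in> \<int>" for j
  proof -
    have "?C *v column j P = D $ j $ j *s column j P"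
    proof -
      have "(?C ** P) $ i $ j = (P ** D) $ i $ j" for i using CP by simp
      then show ?thesis using exhaust_2[of j]
        by (auto simp: vec_eq_iff matrix_vector_mult_def matrix_matrix_mult_def column_def sum_2 D forall_2 mult.commute)
    qed
    moreover have "column j P \<noteq> 0"
      using inv by (metis det_transpose det_zero_row(1) invertible_det_nz row_transpose row_def vec_lambda_eta transpose_def column_def det_zero_column(1))
    ultimately have "mat_eigenvalue ?C (D$j$j)" by (auto simp: mat_eigenvalue_def)
    then show ?thesis using assms by (auto simp: diagonalizable_integer_eigenvalues_def)
  qed
  obtain m1 where m1: "D$1$1 = of_int m1" using ev[of 1] by (auto elim: Ints_cases)
  obtain m2 where m2: "D$2$2 = of_int m2" using ev[of 2] by (auto elim: Ints_cases)
  have "det ?C * det P = det P * det D" using CP by (metis det_mul)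
  then have "det ?C = det D" using inv by (simp add: invertible_det_nz)
  then have "complex_of_int (B$1$1 * B$2$2 - B$1$2 * B$2$1) = of_int (m1 * m2)"
    by (simp add: det_2 D m1 m2)
  then have dt: "B$1$1 * B$2$2 - B$1$2 * B$2$1 = m1 * m2" using of_int_eq_iff by blast
  have "trace ?C = trace D"
    unfolding C by (metis inv matrix_inv_both(2) matrix_mul_assoc matrix_mul_lid trace_mul_sym)
  then have "complex_of_int (B$1$1 + B$2$2) = of_int (m1 + m2)"
    by (simp add: trace_def sum_2 m1 m2)
  then have tr: "B$1$1 + B$2$2 = m1 + m2" using of_int_eq_iff by blast
  show ?thesis
  proof (cases "m1 = m2")
    case True
    have "?C *v x = of_int m1 *s x" for x
    proof -
      have "D *v y = of_int m1 *s y" for y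
        using True m1 m2 by (simp add: vec_eq_iff forall_2 matrix_vector_mult_def sum_2 D)
      then show ?thesis
        unfolding C by (simp add: matrix_vector_mul_assoc[symmetric] vector_scalar_commute)
          (metis inv matrix_inv_both(1) matrix_vector_mul_assoc matrix_vector_mul_lid)
    qed
    from this[of "axis 1 1"] this[of "axis 2 1"]
    have "B$1$1 = m1" "B$1$2 = 0" "B$2$1 = 0" "B$2$2 = m1"
      by (auto simp: vec_eq_iff forall_2 matrix_vector_mult_def sum_2 axis_def)
    then show ?thesis
      by (intro that[of "axis 1 1" "axis 2 1" "of_int m1" "of_int m1"])
        (auto simp: int_lattice_def axis_def cross2_def vec_eq_iff forall_2 matrix_vector_mult_def sum_2 transpose_def)
  next
    case False
    have row: "\<exists>r. r \<in> int_lattice \<and> r \<noteq> 0 \<and> transpose (real_matrix B) *v r = real_of_int m *\<^sub>R r"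
      if m: "m + m' = m1 + m2" "m * m' = m1 * m2" "m \<noteq> m'" for m m'
    proof -
      have char: "(B$1$1 - m) * (B$1$1 - m') + B$1$2 * B$2$1 = 0" "(B$2$2 - m) * (B$2$2 - m') + B$1$2 * B$2$1 = 0"
        using m tr dt by algebra+
      have s: "B$2$2 - m' = m - B$1$1" "B$1$1 - m' = m - B$2$2" using m tr by auto
      have fin: ?thesis if "(B$1$1 - m) * a + B$2$1 * b = 0" "B$1$2 * a + (B$2$2 - m) * b = 0" "a \<noteq> 0 \<or> b \<noteq> 0" for a b
      proof -
        have "real_of_int ((B$1$1 - m) * a + B$2$1 * b) = 0" "real_of_int (B$1$2 * a + (B$2$2 - m) * b) = 0"
          using that by simp_all
        then show ?thesis using that(3)
          by (intro exI[of _ "vector [of_int a, of_int b]"])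
            (auto simp: int_lattice_def vec_eq_iff forall_2 matrix_vector_mult_def sum_2 transpose_def algebra_simps)
      qed
      show ?thesis
      proof (cases "B$1$1 - m' = 0 \<and> B$1$2 = 0")
        case False
        show ?thesis
        proof (rule fin)
          show "(B$1$1 - m) * (B$1$1 - m') + B$2$1 * B$1$2 = 0" "B$1$2 * (B$1$1 - m') + (B$2$2 - m) * B$1$2 = 0"
            using char m tr by algebra+
        qed (use False in blast)
      next
        case True
        show ?thesis
        proof (rule fin)
          show "(B$1$1 - m) * B$2$1 + B$2$1 * (B$2$2 - m') = 0" "B$1$2 * B$2$1 + (B$2$2 - m) * (B$2$2 - m') = 0"
            using char m tr by algebra+
        qed (use True s m(3) in simp)
      qed
    qed
    obtain r where r: "r \<in> int_lattice" "r \<noteq> 0" "transpose (real_matrix B) *v r = real_of_int m1 *\<^sub>R r"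
      using row[of m1 m2] False by auto
    obtain r' where r': "r' \<in> int_lattice" "r' \<noteq> 0" "transpose (real_matrix B) *v r' = real_of_int m2 *\<^sub>R r'"
      using row[of m2 m1] False by (auto simp: algebra_simps)
    have "cross2 r r' \<noteq> 0"
    proof
      assume "cross2 r r' = 0"
      then obtain c where c: "r' = c *\<^sub>R r" using r(2) cross2_eq_0_imp by metis
      then have "real_of_int m2 *\<^sub>R r' = real_of_int m1 *\<^sub>R r'"
        using r(3) r'(3) by (auto simp: linear_scale[OF matrix_vector_mul_linear] scaleR_left_commute mult.commute)
      then show False using r'(2) False by simp
    qed
    then show ?thesis using that[of r r' "of_int m1" "of_int m2"] r r' by auto
  qed
qed

section \<open>The boundary of a Markov partition\<close>

text \<open>A boundary point of \<open>R\<close> cannot be interior to another member \<open>R'\<close>: as \<open>R\<close> is the closure of its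
  interior, the interiors of \<open>R\<close> and \<open>R'\<close> would meet.\<close>

lemma partition_boundary_eq:
  assumes "\<Union>\<M> = UNIV" "\<forall>R\<in>\<M>. proper_set R" "pairwise (\<lambda>R R'. interior R \<inter> interior R' = {}) \<M>"
  shows "partition_boundary \<M> = - (\<Union>R\<in>\<M>. interior R)"
proof -
  have cl: "closure R = R" if "R \<in> \<M>" for R
  proof -
    have "R = closure (interior R)" using assms(2) that by (simp add: proper_set_def)
    then show ?thesis using closed_closure closure_closed by metis
  qed
  have "p \<in> partition_boundary \<M>" if "p \<notin> (\<Union>R\<in>\<M>. interior R)" for p
  proof -
    have "p \<in> \<Union>\<M>" unfolding assms(1) by simp
    then obtain R where R: "R \<in> \<M>" "p \<in> R" by (rule UnionE)
    then have "p \<in> frontier R" using that by (simp add: frontier_def cl[OF R(1)])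
    with R show ?thesis unfolding partition_boundary_def by blast
  qed
  moreover have False if p: "p \<in> frontier R" "R \<in> \<M>" "p \<in> interior R'" "R' \<in> \<M>" for p R R'
  proof (cases "R' = R")
    case True then show ?thesis using p by (simp add: frontier_def)
  next
    case False
    then have "interior R' \<inter> interior R = {}" using assms(3) p by (auto simp: pairwise_def)
    then have "interior R' \<inter> closure (interior R) = {}" by (simp add: open_Int_closure_eq_empty)
    moreover have "p \<in> closure (interior R)"
      using p cl[OF p(2)] assms(2) unfolding frontier_def proper_set_def by auto
    ultimately show ?thesis using p(3) by auto
  qed
  ultimately show ?thesis unfolding partition_boundary_def by blast
qed

lemma toral_endo_locally_injective:
  fixes A :: "int^2^2"
  assumes "expanding A"
  obtains e where "e > 0" "\<And>p q. dist p q < e \<Longrightarrow> toral_endo A p = toral_endo A q \<Longrightarrow> p = q"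
proof -
  let ?M = "real_matrix A"
  define K where "K = onorm ((*v) ?M)"
  have K: "K \<ge> 0" "\<And>x. norm (?M *v x) \<le> K * norm x"
    unfolding K_def by (auto intro!: onorm_pos_le onorm matrix_vector_mul_bounded_linear)
  have "p = q" if d: "dist p q < 1 / (K + 1)" and eq: "toral_endo A p = toral_endo A q" for p q
  proof -
    obtain x where p: "p = torus_proj x" by (cases p)
    obtain y where q: "torus_proj y = q" "dist x y < 1 / (K + 1)"
      using d unfolding p by (rule torus_proj_lift_near)
    have "torus_proj (?M *v x) = torus_proj (?M *v y)"
      using eq by (simp only: p q(1)[symmetric] toral_endo_proj)
    then have "?M *v x - ?M *v y \<in> int_lattice" by (simp only: torus_proj_eq_lattice)
    then have lat: "?M *v (x - y) \<in> int_lattice" by (simp only: matrix_vector_mult_diff_distrib)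
    have "norm (?M *v (x - y)) \<le> K * norm (x - y)" by (rule K(2))
    also have "\<dots> \<le> (K + 1) * norm (x - y)" by (intro mult_right_mono) auto
    also have "\<dots> < 1" using q(2) K(1) by (simp add: dist_norm field_simps)
    finally have "?M *v (x - y) = 0" by (rule int_lattice_norm_less_1[OF lat])
    then have "?M *v x = ?M *v y" by (simp only: matrix_vector_mult_diff_distrib right_minus_eq)
    then have "x = y" by (rule expanding_inj[OF assms])
    then show ?thesis using p q by simp
  qed
  then show ?thesis using K(1) by (intro that[of "1 / (K + 1)"]) auto
qed

text \<open>A boundary point \<open>p\<close> lies in two members \<open>R1\<close> and \<open>R2\<close>. If its image were interior to \<open>R'\<close>, the
  Markov property would provide, for each image point near it, a unique preimage in \<open>R1\<close> and a unique
  preimage in \<open>R2\<close>. Choose points interior to \<open>R1\<close> that converge to \<open>p\<close>. The points of \<open>R2\<close> with the same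
  images accumulate, by compactness and uniqueness, only at \<open>p\<close>, so they are eventually the same points
  by local injectivity; but the interior of \<open>R1\<close> does not meet \<open>R2\<close>.\<close>

lemma partition_boundary_forward_invariant:
  fixes A :: "int^2^2"
  assumes exp: "expanding A" and M: "markov_partition (toral_endo A) \<M>" and p: "p \<in> partition_boundary \<M>"
  shows "toral_endo A p \<in> partition_boundary \<M>"
proof (rule ccontr)
  let ?f = "toral_endo A"
  assume *: "?f p \<notin> partition_boundary \<M>"
  have fin: "finite \<M>" and cov: "\<Union>\<M> = UNIV" and pr: "\<forall>R\<in>\<M>. proper_set R"
    and dis: "pairwise (\<lambda>R R'. interior R \<inter> interior R' = {}) \<M>" and mp: "markov_property ?f \<M>"
    using M by (auto simp: markov_partition_def)
  note bd = partition_boundary_eq[OF cov pr dis]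
  have cl: "closure (interior R) = R" "closed R" if "R \<in> \<M>" for R
  proof -
    show "closure (interior R) = R" using pr that by (simp add: proper_set_def)
    then show "closed R" by (metis closed_closure)
  qed
  obtain R' where R': "R' \<in> \<M>" "?f p \<in> interior R'" using * bd by auto
  have in_part: "\<exists>R\<in>\<M>. q \<in> R" for q
  proof -
    have "q \<in> \<Union>\<M>" unfolding cov by simp
    then show ?thesis by auto
  qed
  then obtain R1 where R1: "R1 \<in> \<M>" "p \<in> R1" by blast
  obtain R2 where R2: "R2 \<in> \<M>" "p \<in> R2" "R2 \<noteq> R1"
  proof -
    define V where "V = - \<Union>{R \<in> \<M>. p \<notin> R}"
    have "open V" unfolding V_def using fin cl by (intro open_Compl closed_Union) auto
    have "p \<in> V" by (auto simp: V_def)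
    have "\<not> V \<subseteq> R1"
      using p R1 \<open>open V\<close> \<open>p \<in> V\<close> bd interior_maximal by blast
    then obtain q where q: "q \<in> V" "q \<notin> R1" by auto
    obtain R where "R \<in> \<M>" "q \<in> R" using in_part by blast
    with q show ?thesis by (intro that[of R]) (auto simp: V_def)
  qed
  have op: "open (?f -` interior R')" by (intro open_vimage continuous_on_toral_endo) simp
  have uni: "\<exists>!x. x \<in> R \<and> ?f x = y" if "R \<in> \<M>" "p \<in> R" "y \<in> interior R'" for R y
  proof -
    have "?f -` interior R' \<inter> closure (interior R) \<noteq> {}" using that R' cl by auto
    then have "?f -` interior R' \<inter> interior R \<noteq> {}" using open_Int_closure_eq_empty[OF op] by blast
    then have "?f ` interior R \<inter> interior R' \<noteq> {}" by auto
    then show ?thesis using mp that R' unfolding markov_property_def by blast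
  qed
  have "p \<in> closure (?f -` interior R' \<inter> interior R1)"
    using open_Int_closure_subset[OF op, of "interior R1"] cl(1)[OF R1(1)] R1 R'(2) by auto
  then obtain x where x: "\<And>n. x n \<in> ?f -` interior R' \<inter> interior R1" "x \<longlonglongrightarrow> p"
    unfolding closure_sequential by auto
  have "\<exists>y. \<forall>n. y n \<in> R2 \<and> ?f (y n) = ?f (x n)"
    using uni[OF R2(1,2)] x(1) by (intro choice) (metis IntD1 vimageE)
  then obtain y where y: "\<And>n. y n \<in> R2" "\<And>n. ?f (y n) = ?f (x n)" by auto
  have "compact R2" using compact_torus cl(2)[OF R2(1)] by (metis compact_Int_closed inf_top_left)
  then obtain l r where l: "l \<in> R2" "strict_mono r" "(y \<circ> r) \<longlonglongrightarrow> l"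
    using y(1) unfolding compact_def by metis
  have cont: "isCont ?f q" for q
    using continuous_on_toral_endo[of UNIV A] by (simp add: continuous_on_eq_continuous_at)
  have xr: "(x \<circ> r) \<longlonglongrightarrow> p" using x(2) l(2) by (rule LIMSEQ_subseq_LIMSEQ)
  have "(\<lambda>n. ?f ((y \<circ> r) n)) \<longlonglongrightarrow> ?f l" by (rule isCont_tendsto_compose[OF cont l(3)])
  moreover have "(\<lambda>n. ?f ((x \<circ> r) n)) \<longlonglongrightarrow> ?f p" by (rule isCont_tendsto_compose[OF cont xr])
  ultimately have "?f l = ?f p" using y(2) by (simp add: LIMSEQ_unique)
  then have "l = p" using uni[OF R2(1,2) R'(2)] l(1) R2(2) by auto
  obtain e where e: "e > 0" "\<And>p q. dist p q < e \<Longrightarrow> ?f p = ?f q \<Longrightarrow> p = q"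
    using toral_endo_locally_injective[OF exp] by metis
  have "(\<lambda>n. dist ((x \<circ> r) n) ((y \<circ> r) n)) \<longlonglongrightarrow> dist p p"
    using l(3) xr unfolding \<open>l = p\<close> by (intro tendsto_dist)
  then have "eventually (\<lambda>n. dist ((x \<circ> r) n) ((y \<circ> r) n) < e) sequentially"
    using e(1) by (intro order_tendstoD(2)) auto
  then obtain n where "dist ((x \<circ> r) n) ((y \<circ> r) n) < e" by (auto dest: eventually_happens)
  then have "x (r n) = y (r n)" using e(2) y(2) by simp
  then have "interior R1 \<inter> closure (interior R2) \<noteq> {}"
    using x(1)[of "r n"] y(1)[of "r n"] cl(1)[OF R2(1)] by auto
  then have "interior R1 \<inter> interior R2 \<noteq> {}"
    using open_Int_closure_eq_empty[of "interior R1"] by auto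
  then show False using dis R1 R2 by (auto simp: pairwise_def)
qed

text \<open>A connected set that avoids the boundary stays inside the interior of a single member, so all
  points of \<open>X\<close> have the same itinerary.\<close>

lemma connected_avoiding_boundary_trivial:
  fixes A :: "int^2^2" and X :: "(real^2) set"
  assumes M: "markov_partition (toral_endo A) \<M>" and X: "connected X" "x \<in> X" "y \<in> X"
    and avoid: "\<And>n x. x \<in> X \<Longrightarrow> torus_proj (((*v) (real_matrix A) ^^ n) x) \<notin> partition_boundary \<M>"
  shows "torus_proj x = torus_proj y"
proof -
  let ?f = "toral_endo A" and ?T = "\<lambda>n. (*v) (real_matrix A) ^^ n"
  have cov: "\<Union>\<M> = UNIV" and pr: "\<forall>R\<in>\<M>. proper_set R"
    and dis: "pairwise (\<lambda>R R'. interior R \<inter> interior R' = {}) \<M>" and gen: "metrically_generating ?f \<M>"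
    using M by (auto simp: markov_partition_def)
  note bd = partition_boundary_eq[OF cov pr dis]
  have av: "\<exists>R\<in>\<M>. torus_proj (?T n u) \<in> interior R" if "u \<in> X" for n u
    using avoid[OF that, of n] unfolding bd by simp
  have "\<exists>R. \<forall>n. R n \<in> \<M> \<and> torus_proj (?T n x) \<in> interior (R n)"
    using av[OF X(2)] by (intro choice) blast
  then obtain R where R: "\<And>n. R n \<in> \<M>" "\<And>n. torus_proj (?T n x) \<in> interior (R n)" by auto
  have inR: "torus_proj (?T n u) \<in> interior (R n)" if "u \<in> X" for n u
  proof -
    let ?S = "(\<lambda>x. torus_proj (?T n x)) ` X" and ?V = "\<Union>R'\<in>\<M> - {R n}. interior R'"
    have "continuous_on X (?T n)"
      by (intro linear_continuous_on linear_conv_bounded_linear[THEN iffD1] linear_funpow matrix_vector_mul_linear)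
    then have "continuous_on X (\<lambda>x. torus_proj (?T n x))"
      using continuous_on_compose2[OF continuous_on_torus_proj] by blast
    then have S: "connected ?S" using X(1) by (rule connected_continuous_image)
    have "?V \<inter> ?S = {} \<or> interior (R n) \<inter> ?S = {}"
    proof (rule connectedD[OF S])
      show "?S \<subseteq> ?V \<union> interior (R n)" using av by fast
      have "interior R' \<inter> interior (R n) = {}" if "R' \<in> \<M> - {R n}" for R'
        using dis R(1) that by (auto simp: pairwise_def)
      then show "?V \<inter> interior (R n) \<inter> ?S = {}" by blast
    qed auto
    moreover have "interior (R n) \<inter> ?S \<noteq> {}" using R(2)[of n] X(2) by blast
    ultimately have V: "?V \<inter> ?S = {}" by blast
    obtain R' where R': "R' \<in> \<M>" "torus_proj (?T n u) \<in> interior R'" using av \<open>u \<in> X\<close> by blast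
    then have "R' = R n" using V \<open>u \<in> X\<close> by fast
    then show ?thesis using R' by simp
  qed
  obtain q where q: "(\<Inter>k. (?f ^^ k) -` interior (R k)) \<subseteq> {q}"
    using gen R(1) unfolding metrically_generating_def by blast
  have "torus_proj u = q" if "u \<in> X" for u
    using q inR[OF that] by (auto simp: toral_endo_funpow_proj[symmetric])
  then show ?thesis using X by simp
qed

definition covering_boundary :: "('n::finite) torus set set \<Rightarrow> (real^'n) set" where
  "covering_boundary \<M> = {x. torus_proj x \<in> partition_boundary \<M>}"

lemma lattice_periodic_covering_boundary: "lattice_periodic (covering_boundary \<M>)"
  by (simp add: lattice_periodic_def covering_boundary_def)

lemma covering_boundary_invariant:
  assumes "expanding A" "markov_partition (toral_endo (A :: int^2^2)) \<M>" "x \<in> covering_boundary \<M>"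
  shows "real_matrix A *v x \<in> covering_boundary \<M>"
  using partition_boundary_forward_invariant[OF assms(1,2), of "torus_proj x"] assms(3)
  by (simp add: covering_boundary_def toral_endo_proj del: map_matrix_def)

lemma closed_covering_boundary:
  assumes "markov_partition f (\<M> :: 'n::finite torus set set)"
  shows "closed (covering_boundary \<M>)"
proof -
  have "partition_boundary \<M> = - (\<Union>R\<in>\<M>. interior R)"
    using assms by (intro partition_boundary_eq) (auto simp: markov_partition_def)
  then have "closed (partition_boundary \<M>)" by (auto intro: closed_Compl)
  then have "closed (torus_proj -` partition_boundary \<M> :: (real^'n) set)"
    by (intro closed_vimage continuous_on_torus_proj)
  then show ?thesis by (simp add: covering_boundary_def vimage_def)
qed

lemma covering_boundary_not_UNIV:
  assumes "markov_partition f (\<M> :: 'n::finite torus set set)"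
  shows "covering_boundary \<M> \<noteq> UNIV"
proof -
  have bd: "partition_boundary \<M> = - (\<Union>R\<in>\<M>. interior R)"
    using assms by (intro partition_boundary_eq) (auto simp: markov_partition_def)
  have "\<Union>\<M> = UNIV" using assms by (simp add: markov_partition_def)
  then have "\<M> \<noteq> {}" by auto
  then obtain R where R: "R \<in> \<M>" by auto
  then have "interior R \<noteq> {}"
    using assms unfolding markov_partition_def proper_set_def by (metis closure_empty)
  then obtain p where p: "p \<in> interior R" by auto
  obtain x where "p = torus_proj x" by (cases p)
  then have "x \<notin> covering_boundary \<M>" using p R bd by (auto simp: covering_boundary_def)
  then show ?thesis by auto
qed

section \<open>Differentiable curves\<close>

definition C1_curve_in :: "(real^'n) set \<Rightarrow> (real \<Rightarrow> real^'n::finite) \<Rightarrow> (real \<Rightarrow> real^'n) \<Rightarrow> real \<Rightarrow> real \<Rightarrow> bool" where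
  "C1_curve_in K h h' a b \<longleftrightarrow> a < b \<and> continuous_on {a<..<b} h' \<and>
     (\<forall>t\<in>{a<..<b}. (h has_vector_derivative h' t) (at t) \<and> h' t \<noteq> 0 \<and> h t \<in> K)"

text \<open>The derivative of a curve in the torus is defined by a lift chosen separately at each parameter.
  The lift chosen at \<open>t\<close> is differentiable at all nearby parameters \<open>s\<close>: it stays within \<open>1/4\<close> of its value
  at \<open>t\<close>, and the lift chosen at \<open>s\<close> stays within \<open>1/4\<close> of its value at \<open>s\<close>. Hence the integer vector
  between the two lifts is constant near \<open>s\<close>, as its change has norm less than \<open>1\<close>.\<close>

lemma torus_curve_local_lift:
  fixes \<gamma> :: "real \<Rightarrow> 'n::finite torus"
  assumes der: "\<And>t. t \<in> {0..1} \<Longrightarrow> has_torus_derivative \<gamma> (\<gamma>' t) t {0..1}" and t: "t \<in> {0<..<1}"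
  obtains a b h where "a < t" "t < b" "{a<..<b} \<subseteq> {0<..<1}"
    "\<And>s. s \<in> {a<..<b} \<Longrightarrow> torus_proj (h s) = \<gamma> s \<and> (h has_vector_derivative \<gamma>' s) (at s)"
proof -
  have lift: "\<exists>g d. torus_proj (g s) = \<gamma> s \<and> (g has_vector_derivative \<gamma>' s) (at s) \<and> d > 0 \<and>
     (\<forall>u. \<bar>u - s\<bar> < d \<longrightarrow> u \<in> {0<..<1} \<and> torus_proj (g u) = \<gamma> u \<and> norm (g u - g s) < 1/4)"
    if s: "s \<in> {0<..<1}" for s
  proof -
    have at: "at s within {0..1} = at s" using s by (intro at_within_interior) simp
    obtain g where g: "torus_proj (g s) = \<gamma> s" "\<forall>\<^sub>F u in at s. torus_proj (g u) = \<gamma> u"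
      "(g has_vector_derivative \<gamma>' s) (at s)"
      using der[of s] s unfolding has_torus_derivative_def at by auto
    have "isCont g s" using g(3) by (rule has_vector_derivative_continuous)
    then have "(g \<longlongrightarrow> g s) (at s)" by (simp add: isCont_def)
    then have "\<forall>\<^sub>F u in at s. dist (g u) (g s) < 1/4" by (rule tendstoD) simp
    moreover have "\<forall>\<^sub>F u in at s. u \<in> {0<..<1}"
      using s by (intro eventually_at_in_open') auto
    ultimately have "\<forall>\<^sub>F u in at s. u \<in> {0<..<1} \<and> torus_proj (g u) = \<gamma> u \<and> norm (g u - g s) < 1/4"
      using g(2) by eventually_elim (simp add: dist_norm)
    then obtain d where d: "d > 0" "\<And>u. u \<noteq> s \<Longrightarrow> dist u s < d \<Longrightarrow>
        u \<in> {0<..<1} \<and> torus_proj (g u) = \<gamma> u \<and> norm (g u - g s) < 1/4"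
      by (auto simp: eventually_at)
    have "u \<in> {0<..<1} \<and> torus_proj (g u) = \<gamma> u \<and> norm (g u - g s) < 1/4" if "\<bar>u - s\<bar> < d" for u
    proof (cases "u = s")
      case False then show ?thesis using d(2)[of u] that by (simp add: dist_real_def)
    qed (use s g(1) in simp)
    then show ?thesis using g d(1) by blast
  qed
  obtain h d where h: "d > 0"
    "\<And>u. \<bar>u - t\<bar> < d \<Longrightarrow> u \<in> {0<..<1} \<and> torus_proj (h u) = \<gamma> u \<and> norm (h u - h t) < 1/4"
    using lift[OF t] by blast
  have "(h has_vector_derivative \<gamma>' s) (at s)" if s: "\<bar>s - t\<bar> < d" for s
  proof -
    obtain g d' where g: "torus_proj (g s) = \<gamma> s" "(g has_vector_derivative \<gamma>' s) (at s)" "d' > 0"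
      "\<And>u. \<bar>u - s\<bar> < d' \<Longrightarrow> torus_proj (g u) = \<gamma> u \<and> norm (g u - g s) < 1/4"
      using lift[of s] h(2)[OF s] by blast
    define z where "z = g s - h s"
    have z: "z \<in> int_lattice" unfolding z_def using g(1) h(2)[OF s] by (simp add: torus_proj_eq_lattice[symmetric])
    define \<epsilon> where "\<epsilon> = min d' (d - \<bar>s - t\<bar>)"
    have eq: "g u - z = h u" if u: "dist u s < \<epsilon>" for u
    proof -
      have u1: "\<bar>u - s\<bar> < d'" and u2: "\<bar>u - t\<bar> < d" using u by (auto simp: \<epsilon>_def dist_real_def)
      have "g u - h u \<in> int_lattice"
        using g(4)[OF u1] h(2)[OF u2] by (simp add: torus_proj_eq_lattice[symmetric])
      then have lat: "g u - h u - z \<in> int_lattice" using z by (rule int_lattice_diff)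
      have "g u - h u - z = (g u - g s) - ((h u - h t) - (h s - h t))" by (simp add: z_def)
      also have "norm \<dots> \<le> norm (g u - g s) + norm ((h u - h t) - (h s - h t))"
        by (rule norm_triangle_ineq4)
      also have "\<dots> \<le> norm (g u - g s) + (norm (h u - h t) + norm (h s - h t))"
        by (intro add_left_mono norm_triangle_ineq4)
      also have "\<dots> < 1" using g(4)[OF u1] h(2)[OF u2] h(2)[OF s] by linarith
      finally have "g u - h u - z = 0" by (rule int_lattice_norm_less_1[OF lat])
      then show ?thesis by (simp add: algebra_simps)
    qed
    have "((\<lambda>u. g u - z) has_vector_derivative \<gamma>' s - 0) (at s)"
      by (intro has_vector_derivative_diff g(2) has_vector_derivative_const)
    then have "((\<lambda>u. g u - z) has_vector_derivative \<gamma>' s) (at s)" by simp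
    then show ?thesis
      by (rule has_vector_derivative_transform_within[where d = \<epsilon>]) (use eq g(3) s in \<open>auto simp: \<epsilon>_def\<close>)
  qed
  note hder = this
  have I: "\<bar>s - t\<bar> < d" if "s \<in> {t - d<..<t + d}" for s using that by auto
  show ?thesis
    by (rule that[of "t - d" "t + d" h]) (use h hder I in \<open>auto 0 3\<close>)
qed

lemma countable_int_lattice: "countable (int_lattice :: (real^2) set)"
proof -
  have "int_lattice \<subseteq> range (\<lambda>(p::int, q::int). vector [of_int p, of_int q] :: real^2)"
  proof
    fix z :: "real^2" assume "z \<in> int_lattice"
    then have "z $ 1 \<in> \<int>" "z $ 2 \<in> \<int>" by (auto simp: int_lattice_def)
    then obtain p q where "z $ 1 = of_int p" "z $ 2 = of_int q" by (auto elim!: Ints_cases)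
    then have "z = (\<lambda>(p::int, q::int). vector [of_int p, of_int q]) (p, q)"
      by (simp add: vec_eq_iff forall_2)
    then show "z \<in> range (\<lambda>(p::int, q::int). vector [of_int p, of_int q])" by blast
  qed
  then show ?thesis by (rule countable_subset) simp
qed

lemma C1_arc_lifts_to_curves:
  fixes K :: "(real^'n::finite) set"
  assumes C: "C1_arc C" and sub: "{x. torus_proj x \<in> C} \<subseteq> K"
  obtains \<gamma> \<gamma>' where "C = \<gamma> ` {0..1}"
    "\<And>t. t \<in> {0<..<1} \<Longrightarrow> \<exists>a b h. a < t \<and> t < b \<and> C1_curve_in K h \<gamma>' a b \<and> (\<forall>s\<in>{a<..<b}. torus_proj (h s) = \<gamma> s)"
proof -
  obtain \<gamma> \<gamma>' where g: "C = \<gamma> ` {0..1}" "continuous_on {0..1} \<gamma>'"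
    "\<And>t. t \<in> {0..1} \<Longrightarrow> has_torus_derivative \<gamma> (\<gamma>' t) t {0..1}" "\<And>t. t \<in> {0..1} \<Longrightarrow> \<gamma>' t \<noteq> 0"
    using C unfolding C1_arc_def by blast
  have "\<exists>a b h. a < t \<and> t < b \<and> C1_curve_in K h \<gamma>' a b \<and> (\<forall>s\<in>{a<..<b}. torus_proj (h s) = \<gamma> s)"
    if t: "t \<in> {0<..<1}" for t
  proof -
    obtain a b h where h: "a < t" "t < b" "{a<..<b} \<subseteq> {0<..<1}"
      "\<And>s. s \<in> {a<..<b} \<Longrightarrow> torus_proj (h s) = \<gamma> s \<and> (h has_vector_derivative \<gamma>' s) (at s)"
      using torus_curve_local_lift[OF g(3) t] by metis
    have ss: "{a<..<b} \<subseteq> {0..1}" using h(3) by fastforce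
    have "C1_curve_in K h \<gamma>' a b"
      unfolding C1_curve_in_def
    proof (intro conjI ballI)
      show "continuous_on {a<..<b} \<gamma>'" using g(2) ss by (rule continuous_on_subset)
      fix s assume s: "s \<in> {a<..<b}"
      then show "(h has_vector_derivative \<gamma>' s) (at s)" "\<gamma>' s \<noteq> 0" using h(4) g(4) ss by blast+
      have "torus_proj (h s) \<in> C" using h(4)[OF s] s ss by (auto simp: g(1))
      then show "h s \<in> K" using sub by auto
    qed (use h in auto)
    then show ?thesis using h(1,2,4) by blast
  qed
  then show ?thesis using that g(1) by blast
qed

text \<open>The function \<open>cross2 e\<close> labels the lines parallel to \<open>e\<close>. It is constant along each local lift of the
  arc, countably many local lifts suffice, and all lifts of an arc differ by the countably many integer
  translations.\<close>

lemma countable_cross2_if_parallel_tangents: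
  fixes e :: "real^2"
  assumes C: "C1_arc C" and sub: "{x. torus_proj x \<in> C} \<subseteq> K"
    and par: "\<And>h h' a b t. C1_curve_in K h h' a b \<Longrightarrow> t \<in> {a<..<b} \<Longrightarrow> cross2 e (h' t) = 0"
  shows "countable (cross2 e ` {x. torus_proj x \<in> C})"
proof -
  obtain \<gamma> \<gamma>' where g: "C = \<gamma> ` {0..1}"
    "\<And>t. t \<in> {0<..<1} \<Longrightarrow> \<exists>a b h. a < t \<and> t < b \<and> C1_curve_in K h \<gamma>' a b \<and> (\<forall>s\<in>{a<..<b}. torus_proj (h s) = \<gamma> s)"
    using C1_arc_lifts_to_curves[OF C sub] by metis
  let ?c = "\<lambda>S. cross2 e ` {x. torus_proj x \<in> \<gamma> ` S}"
  have fibre: "countable (cross2 e ` {x. cross2 e (x - y) \<in> cross2 e ` int_lattice})" for y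
  proof (rule countable_subset)
    show "cross2 e ` {x. cross2 e (x - y) \<in> cross2 e ` int_lattice} \<subseteq> (\<lambda>z. cross2 e y + cross2 e z) ` int_lattice"
      by force
  qed (simp add: countable_int_lattice)
  have pt: "countable (?c {t})" for t
  proof -
    obtain y where y: "\<gamma> t = torus_proj y" by (cases "\<gamma> t")
    have "?c {t} \<subseteq> cross2 e ` {x. cross2 e (x - y) \<in> cross2 e ` int_lattice}"
      by (intro image_mono) (auto simp: y torus_proj_eq_lattice simp del: cross2_linear)
    then show ?thesis by (rule countable_subset[OF _ fibre])
  qed
  have loc: "\<exists>I. open I \<and> t \<in> I \<and> countable (?c I)" if t: "t \<in> {0<..<1}" for t
  proof -
    obtain a b h where h: "a < t" "t < b" "C1_curve_in K h \<gamma>' a b"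
        "\<And>s. s \<in> {a<..<b} \<Longrightarrow> torus_proj (h s) = \<gamma> s"
      using g(2)[OF t] by blast
    have z: "cross2 e (\<gamma>' s) = 0" if "s \<in> {a<..<b}" for s using par[OF h(3) that] .
    have "((\<lambda>s. cross2 e (h s)) has_real_derivative 0) (at s)" if "s \<in> {a<..<b}" for s
    proof -
      have "((\<lambda>s. cross2 e (h s)) has_vector_derivative cross2 e (\<gamma>' s)) (at s)"
        using h(3) that unfolding C1_curve_in_def by (intro bounded_linear.has_vector_derivative[OF bounded_linear_cross2]) blast
      then show ?thesis unfolding z[OF that] by (simp add: has_real_derivative_iff_has_vector_derivative)
    qed
    then have "\<exists>c. \<forall>s\<in>{a<..<b}. cross2 e (h s) = c"
      by (intro has_field_derivative_zero_constant convex_real_interval)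
        (blast intro: has_field_derivative_at_within)
    then obtain c where c: "\<And>s. s \<in> {a<..<b} \<Longrightarrow> cross2 e (h s) = c" by blast
    have "cross2 e (x - h t) \<in> cross2 e ` int_lattice" if x: "torus_proj x = \<gamma> s" "s \<in> {a<..<b}" for x s
    proof -
      have "x - h s \<in> int_lattice" using x h(4)[of s] by (simp add: torus_proj_eq_lattice[symmetric])
      moreover have "cross2 e (x - h t) = cross2 e (x - h s)" using c[OF x(2)] c[of t] h by simp
      ultimately show ?thesis by (simp del: cross2_linear add: imageI)
    qed
    then have "?c {a<..<b} \<subseteq> cross2 e ` {x. cross2 e (x - h t) \<in> cross2 e ` int_lattice}"
      by (intro image_mono) (auto simp del: cross2_linear)
    then have "countable (?c {a<..<b})" by (rule countable_subset[OF _ fibre])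
    then show ?thesis using h by (intro exI[of _ "{a<..<b}"]) auto
  qed
  then have "\<exists>I. \<forall>t\<in>{0<..<1}. open (I t) \<and> t \<in> I t \<and> countable (?c (I t))" by (intro bchoice) blast
  then obtain I where I0: "\<forall>t\<in>{0<..<1}. open (I t) \<and> t \<in> I t \<and> countable (?c (I t))" by (rule exE)
  have I: "open (I t)" "t \<in> I t" "countable (?c (I t))" if "t \<in> {0<..<1}" for t
    by (rule conjunct1[OF bspec[OF I0 that]] conjunct1[OF conjunct2[OF bspec[OF I0 that]]]
          conjunct2[OF conjunct2[OF bspec[OF I0 that]]])+
  have op: "open S" if "S \<in> I ` {0<..<1}" for S using that I(1) by (metis (no_types, lifting) imageE)
  obtain \<F> where F: "\<F> \<subseteq> I ` {0<..<1}" "countable \<F>" "\<Union>\<F> = \<Union>(I ` {0<..<1})"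
    using Lindelof[OF op] by blast
  have "cross2 e ` {x. torus_proj x \<in> C} \<subseteq> ?c {0} \<union> ?c {1} \<union> (\<Union>S\<in>\<F>. ?c S)"
  proof
    fix y assume "y \<in> cross2 e ` {x. torus_proj x \<in> C}"
    then obtain x t where x: "y = cross2 e x" "torus_proj x = \<gamma> t" "t \<in> {0..1}" by (auto simp: g(1))
    consider "t = 0" | "t = 1" | "t \<in> {0<..<1}" using x(3) by fastforce
    then show "y \<in> ?c {0} \<union> ?c {1} \<union> (\<Union>S\<in>\<F>. ?c S)"
    proof cases
      case 3
      then have "t \<in> \<Union>\<F>" using I(2) F(3) by blast
      then show ?thesis using x(1,2) by blast
    qed (use x in auto)
  qed
  moreover have "countable (?c S)" if "S \<in> \<F>" for S
  proof -
    have "S \<in> I ` {0<..<1}" using F(1) that by (rule subsetD)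
    then obtain t where t: "S = I t" "t \<in> {0<..<1}" by (rule imageE)
    show ?thesis unfolding t(1) by (rule I(3)[OF t(2)])
  qed
  then have "countable (?c {0} \<union> ?c {1} \<union> (\<Union>S\<in>\<F>. ?c S))"
    using F(2) pt by (intro countable_Un countable_UN) auto
  ultimately show ?thesis by (rule countable_subset)
qed

section \<open>Blowing up a curve\<close>

text \<open>At distance \<open>s / norm ((T ^^ n i) v)\<close> from \<open>t\<close> the map \<open>T ^^ n i\<close> carries the linear part of \<open>g\<close> to a
  vector of length \<open>\<bar>s\<bar>\<close> close to \<open>s *\<^sub>R u\<close>. The remainder is of smaller order than that distance, and \<open>T ^^ n i\<close>
  enlarges it at most by the factor \<open>C * norm ((T ^^ n i) v)\<close>, so its image tends to \<open>0\<close>. This is where the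
  tangent vector has to be stretched at the maximal rate.\<close>

lemma blow_up:
  fixes K :: "(real^'n::finite) set" and T :: "real^'n \<Rightarrow> real^'n"
  assumes K: "closed K" "lattice_periodic K" "T ` K \<subseteq> K"
    and T: "linear T"
    and g: "(g has_vector_derivative v) (at t)" "\<forall>\<^sub>F s in at t. g s \<in> K" "g t \<in> K"
    and big: "filterlim (\<lambda>i. norm ((T ^^ n i) v)) at_top sequentially"
    and dom: "\<And>i x. norm ((T ^^ n i) x) \<le> C * norm ((T ^^ n i) v) * norm x"
    and z: "\<And>i. z i \<in> int_lattice"
    and q: "(\<lambda>i. (T ^^ n i) (g t) + z i) \<longlonglongrightarrow> q"
    and u: "(\<lambda>i. (T ^^ n i) v /\<^sub>R norm ((T ^^ n i) v)) \<longlonglongrightarrow> u"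
  shows "q + s *\<^sub>R u \<in> K"
proof -
  have TK: "(T ^^ k) x \<in> K" if "x \<in> K" for k x
    by (induction k) (use that K(3) in auto)
  define N where "N i = norm ((T ^^ n i) v)" for i
  show ?thesis
  proof (cases "s = 0")
    case True
    have "q \<in> K"
      by (rule closed_sequentially[OF K(1) _ q]) (intro lattice_periodicD[OF K(2)] TK g z)
    then show ?thesis using True by simp
  next
    case False
    define \<tau> where "\<tau> i = s / N i" for i
    define r where "r h = g (t + h) - g t - h *\<^sub>R v" for h
    have bigN: "filterlim N at_top sequentially" using big by (simp add: N_def[abs_def])
    have N0: "\<forall>\<^sub>F i in sequentially. N i > 0" using bigN unfolding filterlim_at_top_dense by (rule spec)
    have "\<tau> \<longlonglongrightarrow> 0" unfolding \<tau>_def[abs_def]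
      by (rule real_tendsto_divide_at_top[OF tendsto_const bigN])
    moreover have "\<forall>\<^sub>F i in sequentially. \<tau> i \<noteq> 0"
      using N0 by eventually_elim (use False in \<open>simp add: \<tau>_def\<close>)
    ultimately have tau: "filterlim \<tau> (at 0) sequentially" by (simp add: filterlim_at)
    have "((\<lambda>h. norm (r h) / norm h) \<longlongrightarrow> 0) (at 0)"
      using g(1) by (simp add: has_vector_derivative_def has_derivative_at r_def)
    then have rlim: "(\<lambda>i. norm (r (\<tau> i)) / norm (\<tau> i)) \<longlonglongrightarrow> 0"
      by (rule filterlim_compose[OF _ tau])
    have "filterlim (\<lambda>h. t + h) (at t) (at 0)"
    proof -
      have "((\<lambda>h. t + h) \<longlongrightarrow> t + 0) (at 0)" by (intro tendsto_intros)
      then show ?thesis by (auto simp: filterlim_at eventually_at_filter)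
    qed
    then have "filterlim (\<lambda>i. t + \<tau> i) (at t) sequentially" by (rule filterlim_compose[OF _ tau])
    then have gK: "\<forall>\<^sub>F i in sequentially. g (t + \<tau> i) \<in> K"
      using g(2) by (rule eventually_compose_filterlim[rotated])
    define w where "w i = (T ^^ n i) (g (t + \<tau> i)) + z i" for i
    have wK: "\<forall>\<^sub>F i in sequentially. w i \<in> K"
      using gK by eventually_elim (auto simp: w_def intro: lattice_periodicD[OF K(2)] TK z)
    have err: "(\<lambda>i. (T ^^ n i) (r (\<tau> i))) \<longlonglongrightarrow> 0"
    proof (rule tendsto_0_le[where K = 1])
      have "(\<lambda>i. C * \<bar>s\<bar> * (norm (r (\<tau> i)) / norm (\<tau> i))) \<longlonglongrightarrow> C * \<bar>s\<bar> * 0"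
        by (intro tendsto_intros rlim)
      then show "(\<lambda>i. C * \<bar>s\<bar> * (norm (r (\<tau> i)) / norm (\<tau> i))) \<longlonglongrightarrow> 0" by simp
      show "\<forall>\<^sub>F i in sequentially. norm ((T ^^ n i) (r (\<tau> i))) \<le> norm (C * \<bar>s\<bar> * (norm (r (\<tau> i)) / norm (\<tau> i))) * 1"
        using N0
      proof eventually_elim
        case (elim i)
        have "norm ((T ^^ n i) (r (\<tau> i))) \<le> C * N i * norm (r (\<tau> i))"
          unfolding N_def by (rule dom)
        also have "\<dots> = C * \<bar>s\<bar> * (norm (r (\<tau> i)) / norm (\<tau> i))"
          using elim False by (simp add: \<tau>_def)
        finally show ?case by (simp only: real_norm_def mult_1_right)
      qed
    qed
    have "\<forall>\<^sub>F i in sequentially. ((T ^^ n i) (g t) + z i) + s *\<^sub>R ((T ^^ n i) v /\<^sub>R N i) + (T ^^ n i) (r (\<tau> i)) = w i"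
    proof (rule always_eventually, rule allI)
      fix i
      have l: "linear (T ^^ n i)" by (rule linear_funpow) fact
      have "g (t + \<tau> i) = g t + \<tau> i *\<^sub>R v + r (\<tau> i)" by (simp add: r_def)
      then have "(T ^^ n i) (g (t + \<tau> i)) = (T ^^ n i) (g t) + \<tau> i *\<^sub>R (T ^^ n i) v + (T ^^ n i) (r (\<tau> i))"
        by (simp only: linear_add[OF l] linear_scale[OF l])
      then show "((T ^^ n i) (g t) + z i) + s *\<^sub>R ((T ^^ n i) v /\<^sub>R N i) + (T ^^ n i) (r (\<tau> i)) = w i"
        by (simp add: w_def \<tau>_def divide_inverse)
    qed
    moreover have "(\<lambda>i. ((T ^^ n i) (g t) + z i) + s *\<^sub>R ((T ^^ n i) v /\<^sub>R N i) + (T ^^ n i) (r (\<tau> i)))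
       \<longlonglongrightarrow> q + s *\<^sub>R u + 0"
      using q u err unfolding N_def by (intro tendsto_intros)
    ultimately have "w \<longlonglongrightarrow> q + s *\<^sub>R u" by (simp add: tendsto_cong)
    then show ?thesis using Lim_in_closed_set[OF K(1) wK] by simp
  qed
qed

text \<open>Integer translations bring the points \<open>(T ^^ n i) (g t)\<close> into the unit square, so a subsequence of
  these points and of the normalized tangents converges. The base points \<open>q\<close> are part of the conclusion
  because the position of the line matters later.\<close>

lemma exists_limit_line:
  fixes K :: "(real^'n::finite) set" and T :: "real^'n \<Rightarrow> real^'n"
  assumes K: "closed K" "lattice_periodic K" "T ` K \<subseteq> K"
    and T: "linear T"
    and g: "(g has_vector_derivative v) (at t)" "\<forall>\<^sub>F s in at t. g s \<in> K" "g t \<in> K"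
    and big: "filterlim (\<lambda>i. norm ((T ^^ n i) v)) at_top sequentially"
    and dom: "\<And>i x. norm ((T ^^ n i) x) \<le> C * norm ((T ^^ n i) v) * norm x"
  obtains q u r z where "norm u = 1" "\<And>s. q + s *\<^sub>R u \<in> K" "\<And>i. z i \<in> int_lattice"
    "(\<lambda>i. (T ^^ n (r i)) (g t) + z i) \<longlonglongrightarrow> q"
proof -
  have "\<exists>z. z \<in> int_lattice \<and> (T ^^ n i) (g t) + z \<in> cbox 0 1" for i
    using lattice_reduce by blast
  then obtain z where z: "\<And>i. z i \<in> int_lattice" "\<And>i. (T ^^ n i) (g t) + z i \<in> cbox 0 1" by metis
  define U where "U i = (T ^^ n i) v /\<^sub>R norm ((T ^^ n i) v)" for i
  have "U i \<in> cball 0 1" for i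
    by (cases "norm ((T ^^ n i) v) = 0") (simp_all add: U_def)
  then have mem: "\<forall>i. ((T ^^ n i) (g t) + z i, U i) \<in> cbox 0 1 \<times> cball 0 1" using z(2) by simp
  have comp: "compact (cbox 0 1 \<times> cball 0 1 :: ((real^'n) \<times> (real^'n)) set)" by (intro compact_Times) auto
  obtain l r where r: "strict_mono r" "((\<lambda>i. ((T ^^ n i) (g t) + z i, U i)) \<circ> r) \<longlonglongrightarrow> l"
    using mp[OF spec[OF comp[unfolded compact_def]] mem] by (elim bexE exE conjE)
  obtain q u where l: "l = (q, u)" by (cases l)
  have q: "(\<lambda>i. (T ^^ n (r i)) (g t) + z (r i)) \<longlonglongrightarrow> q"
    using tendsto_fst[OF r(2)] by (simp add: l o_def)
  have u: "(\<lambda>i. U (r i)) \<longlonglongrightarrow> u"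
    using tendsto_snd[OF r(2)] by (simp add: l o_def)
  have big': "filterlim (\<lambda>i. norm ((T ^^ n (r i)) v)) at_top sequentially"
    by (rule filterlim_compose[OF big filterlim_subseq[OF r(1)]])
  have u': "(\<lambda>i. (T ^^ n (r i)) v /\<^sub>R norm ((T ^^ n (r i)) v)) \<longlonglongrightarrow> u"
    using u unfolding U_def .
  have "q + s *\<^sub>R u \<in> K" for s
  proof (rule blow_up[where n = "\<lambda>i. n (r i)" and z = "\<lambda>i. z (r i)" and C = C])
    show "norm ((T ^^ n (r i)) x) \<le> C * norm ((T ^^ n (r i)) v) * norm x" for i x by (rule dom)
  qed (fact K T g big' z(1) q u')+
  moreover have "norm u = 1"
  proof -
    have "\<forall>\<^sub>F i in sequentially. norm ((T ^^ n (r i)) v) > 0"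
      using big' unfolding filterlim_at_top_dense by (rule spec)
    then have "\<forall>\<^sub>F i in sequentially. norm (U (r i)) = 1"
      by eventually_elim (simp add: U_def)
    then have "(\<lambda>i. norm (U (r i))) \<longlonglongrightarrow> 1" by (rule tendsto_eventually)
    moreover have "(\<lambda>i. norm (U (r i))) \<longlonglongrightarrow> norm u" using u by (rule tendsto_norm)
    ultimately show ?thesis by (rule LIMSEQ_unique[rotated])
  qed
  ultimately show ?thesis using that[of u q "\<lambda>i. z (r i)" r] q z(1) by simp
qed

section \<open>Lines in a proper closed periodic set\<close>

lemma discrete_real_subgroup_cyclic:
  fixes G :: "real set"
  assumes diff: "\<forall>x\<in>G. \<forall>y\<in>G. x - y \<in> G"
    and mult: "\<forall>x\<in>G. \<forall>k::int. of_int k * x \<in> G"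
    and gap: "\<forall>x\<in>G. 0 < x \<longrightarrow> r \<le> x" and r: "r > 0"
  obtains g where "g \<ge> r" "\<And>x. x \<in> G \<Longrightarrow> \<exists>k::int. x = of_int k * g"
proof (cases "\<exists>x\<in>G. x > 0")
  case False
  have "x = 0" if "x \<in> G" for x
  proof -
    have "- x \<in> G" using bspec[OF mult that, THEN spec, of "-1"] by simp
    then have "\<not> x > 0" "\<not> - x > 0" using False that by blast+
    then show ?thesis by simp
  qed
  then have "\<exists>k::int. x = of_int k * r" if "x \<in> G" for x using that by (intro exI[of _ 0]) simp
  then show ?thesis using that[of r] by simp
next
  case True
  define P where "P = {x \<in> G. x > 0}"
  define g where "g = Inf P"
  have P: "P \<noteq> {}" "bdd_below P" using True by (auto simp: P_def intro: bdd_belowI[of _ 0])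
  have gr: "g \<ge> r" unfolding g_def by (rule cInf_greatest[OF P(1)]) (auto simp: P_def gap)
  have g_le: "g \<le> x" if "x \<in> P" for x unfolding g_def using that P(2) by (rule cInf_lower)
  have "\<exists>y\<in>P. y < g + r" using cInf_lessD[OF P(1), of "g + r"] r by (auto simp: g_def)
  then obtain y where y: "y \<in> P" "y < g + r" by blast
  have "g \<in> P"
  proof (rule ccontr)
    assume "g \<notin> P"
    then have "g < y" using g_le[OF y(1)] y(1) by (cases "g = y") auto
    then obtain y' where y': "y' \<in> P" "y' < y" using cInf_lessD[OF P(1), of y] by (auto simp: g_def)
    have "y - y' \<in> G" using y y' diff by (auto simp: P_def)
    then have "r \<le> y - y'" using gap y'(2) by simp
    then show False using y(2) g_le[OF y'(1)] by simp
  qed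
  have "\<exists>k::int. x = of_int k * g" if x: "x \<in> G" for x
  proof -
    define d where "d = x - of_int \<lfloor>x / g\<rfloor> * g"
    have g0: "g > 0" using gr r by simp
    have dG: "d \<in> G" unfolding d_def using x mult \<open>g \<in> P\<close> by (intro diff[rule_format]) (auto simp: P_def)
    have "of_int \<lfloor>x / g\<rfloor> * g \<le> x" "x < (of_int \<lfloor>x / g\<rfloor> + 1) * g"
      using g0 floor_divide_lower[of g x] floor_divide_upper[of g x] by auto
    then have d: "0 \<le> d" "d < g" by (auto simp: d_def algebra_simps)
    then have "d \<notin> P" using g_le[of d] by auto
    then have "d = 0" using dG d(1) by (auto simp: P_def)
    then show ?thesis by (auto simp: d_def)
  qed
  then show ?thesis using that[of g] gr by simp
qed

text \<open>The integer translates of the line with direction \<open>u\<close> are the lines on which \<open>cross2 u\<close> takes a value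
  in a coset of the group \<open>G\<close> generated by the two coordinates of \<open>u\<close>. They all avoid a disc of radius
  \<open>r\<close>, so \<open>G\<close> has no elements between \<open>0\<close> and \<open>r\<close> and is cyclic. If \<open>g\<close> generates \<open>G\<close>, then \<open>u\<close> is \<open>g\<close> times an
  integer vector whose entries are at most \<open>1 / g \<le> 1 / r\<close>.\<close>

lemma line_direction_bounded_integer:
  fixes K :: "(real^2) set"
  assumes K: "lattice_periodic K"
    and gap: "ball c r \<inter> K = {}" "r > 0" and u: "norm u = 1" and line: "\<And>s. q + s *\<^sub>R u \<in> K"
  shows "\<exists>w\<in>int_lattice. w \<noteq> 0 \<and> cross2 w u = 0 \<and> (\<forall>i. \<bar>w $ i\<bar> \<le> 1 / r)"
proof -
  have u0: "u \<noteq> 0" using u by auto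
  define n where "n = perp u"
  have n: "cross2 u n = 1" "norm n = 1"
    using u by (simp_all add: n_def cross2_perp norm_perp dot_square_norm)
  define G where "G = cross2 u ` int_lattice"
  have inK: "x \<in> K" if x: "cross2 u x - cross2 u q \<in> G" for x
  proof -
    obtain z where z: "z \<in> int_lattice" "cross2 u x - cross2 u q = cross2 u z" using x by (auto simp: G_def)
    then have "cross2 u (x - q - z) = 0" by simp
    then obtain s where "x - q - z = s *\<^sub>R u" using u0 cross2_eq_0_imp by metis
    then have "x = (q + s *\<^sub>R u) + z" by (simp add: algebra_simps)
    then show ?thesis using lattice_periodicD[OF K] line z(1) by simp
  qed
  have mult: "of_int k * x \<in> G" if x: "x \<in> G" for x k
  proof -
    obtain z where z: "z \<in> int_lattice" "x = cross2 u z" using x by (auto simp: G_def)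
    then have "of_int k * x = cross2 u (of_int k *\<^sub>R z)" by simp
    then show ?thesis unfolding G_def using int_lattice_scale[OF z(1)] by (metis Ints_of_int imageI)
  qed
  have gapG: "r \<le> g" if g: "g \<in> G" "0 < g" for g
  proof (rule ccontr)
    assume "\<not> r \<le> g"
    let ?d = "cross2 u c - cross2 u q"
    define k where "k = \<lfloor>?d / g\<rfloor> + 1"
    have k: "?d < of_int k * g" "of_int k * g \<le> ?d + g"
      using floor_divide_lower[OF g(2), of ?d] floor_divide_upper[OF g(2), of ?d]
      by (auto simp: k_def algebra_simps)
    define s where "s = of_int k * g - ?d"
    have "of_int k * g \<in> G"
      using g(1) by (rule mult)
    then have "c + s *\<^sub>R n \<in> K" by (intro inK) (simp add: s_def n)
    moreover have "c + s *\<^sub>R n \<in> ball c r"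
      using k \<open>\<not> r \<le> g\<close> by (simp add: dist_norm n s_def)
    ultimately show False using gap(1) by blast
  qed
  have diff: "x - y \<in> G" if xy: "x \<in> G" "y \<in> G" for x y
  proof -
    obtain a b where ab: "a \<in> int_lattice" "b \<in> int_lattice" "x = cross2 u a" "y = cross2 u b"
      using xy unfolding G_def by blast
    then have "x - y = cross2 u (a - b)" by simp
    then show ?thesis unfolding G_def using int_lattice_diff[OF ab(1,2)] by (rule image_eqI)
  qed
  have dG: "\<forall>x\<in>G. \<forall>y\<in>G. x - y \<in> G" by (intro ballI diff)
  have mG: "\<forall>x\<in>G. \<forall>k::int. of_int k * x \<in> G" by (intro ballI allI mult)
  have gG: "\<forall>x\<in>G. 0 < x \<longrightarrow> r \<le> x" by (intro ballI impI gapG)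
  obtain g where g: "g \<ge> r" "\<And>x. x \<in> G \<Longrightarrow> \<exists>k::int. x = of_int k * g"
    by (rule discrete_real_subgroup_cyclic[OF dG mG gG gap(2)]) blast
  have g0: "g > 0" using g(1) gap(2) by simp
  have "cross2 u (vector [0, 1]) \<in> G" "cross2 u (vector [-1, 0]) \<in> G" unfolding G_def
    by (rule imageI, simp add: int_lattice_def forall_2)+
  then have "u $ 1 \<in> G" "u $ 2 \<in> G" by (simp_all add: cross2_def)
  then obtain k1 k2 where k: "u $ 1 = of_int k1 * g" "u $ 2 = of_int k2 * g" using g(2) by blast
  let ?w = "vector [of_int k1, of_int k2] :: real^2"
  have uw: "u = g *\<^sub>R ?w" using k by (simp add: vec_eq_iff forall_2)
  have wi: "?w $ i = u $ i / g" for i using g0 by (subst uw) simp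
  have "\<bar>?w $ i\<bar> \<le> 1 / r" for i
  proof -
    have "\<bar>?w $ i\<bar> = \<bar>u $ i\<bar> / g" using g0 by (simp add: wi)
    also have "\<dots> \<le> 1 / r" using component_le_norm_cart[of u i] u g(1) gap(2) by (intro frac_le) auto
    finally show ?thesis .
  qed
  moreover have "?w \<in> int_lattice" by (auto simp: int_lattice_def forall_2)
  moreover have "?w \<noteq> 0" using uw u0 by auto
  moreover have "cross2 ?w u = 0" by (subst uw) simp
  ultimately show ?thesis by blast
qed

lemma finite_bounded_int_lattice:
  "finite {w :: real^2. w \<in> int_lattice \<and> (\<forall>i. \<bar>w $ i\<bar> \<le> B)}"
proof (rule finite_subset)
  let ?I = "{- \<lceil>B\<rceil>..\<lceil>B\<rceil>}"
  show "{w :: real^2. w \<in> int_lattice \<and> (\<forall>i. \<bar>w $ i\<bar> \<le> B)} \<subseteq> (\<lambda>(p, q). vector [of_int p, of_int q]) ` (?I \<times> ?I)"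
  proof clarify
    fix w :: "real^2" assume w: "w \<in> int_lattice" "\<forall>i. \<bar>w $ i\<bar> \<le> B"
    then have "w $ 1 \<in> \<int>" "w $ 2 \<in> \<int>" by (auto simp: int_lattice_def)
    then obtain p q where pq: "w $ 1 = of_int p" "w $ 2 = of_int q" by (auto elim!: Ints_cases)
    have "\<bar>real_of_int p\<bar> \<le> B" "\<bar>real_of_int q\<bar> \<le> B" using w(2) by (auto simp: pq[symmetric])
    then have "p \<in> ?I" "q \<in> ?I" by (auto simp: abs_le_iff le_ceiling_iff ceiling_le_iff) linarith+
    moreover have "w = vector [of_int p, of_int q]" using pq by (simp add: vec_eq_iff forall_2)
    ultimately show "w \<in> (\<lambda>(p, q). vector [of_int p, of_int q]) ` (?I \<times> ?I)" by (intro image_eqI[of _ _ "(p, q)"]) auto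
  qed
qed simp

text \<open>All directions \<open>(T ^^ n) u\<close> are directions of lines in \<open>K\<close>, so two of them agree by finiteness.\<close>

lemma line_direction_periodic:
  fixes A :: "int^2^2" and K :: "(real^2) set"
  defines "T \<equiv> (*v) (real_matrix A)"
  assumes exp: "expanding A" and K: "closed K" "K \<noteq> UNIV" "lattice_periodic K" "T ` K \<subseteq> K"
    and u: "u \<noteq> 0" and line: "\<And>s. q + s *\<^sub>R u \<in> K"
  obtains w k where "w \<in> int_lattice" "w \<noteq> 0" "cross2 w u = 0" "k > 0" "cross2 u ((T ^^ k) u) = 0"
proof -
  have lin: "linear (T ^^ n)" for n unfolding T_def by (intro linear_funpow matrix_vector_mul_linear)
  have "open (- K)" "- K \<noteq> {}" using K(1,2) by auto
  then obtain c r where "r > 0" "ball c r \<subseteq> - K" by (metis open_contains_ball ex_in_conv)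
  then have gap: "ball c r \<inter> K = {}" "r > 0" by auto
  have Tn: "(T ^^ n) x \<in> K" if "x \<in> K" for n x
    by (induction n) (use that K(4) in auto)
  have inj: "(T ^^ n) x = 0 \<Longrightarrow> x = 0" for n x
  proof (induction n)
    case (Suc n)
    then have "T ((T ^^ n) x) = T 0" by (simp add: T_def)
    then have "(T ^^ n) x = 0" unfolding T_def by (rule expanding_inj[OF exp])
    then show ?case by (rule Suc.IH)
  qed simp
  have crossn: "cross2 ((T ^^ n) x) ((T ^^ n) y) = det (real_matrix A) ^ n * cross2 x y" for n x y
    by (induction n) (simp_all add: T_def cross2_matrix)
  let ?W = "{w :: real^2. w \<in> int_lattice \<and> (\<forall>i. \<bar>w $ i\<bar> \<le> 1 / r)}"
  have "\<exists>w. w \<in> ?W \<and> w \<noteq> 0 \<and> cross2 w ((T ^^ n) u) = 0" for n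
  proof -
    let ?u = "(T ^^ n) u"
    have u0: "?u \<noteq> 0" using inj u by blast
    have "(T ^^ n) q + s *\<^sub>R (?u /\<^sub>R norm ?u) \<in> K" for s
    proof -
      have "(T ^^ n) (q + (s / norm ?u) *\<^sub>R u) \<in> K" by (intro Tn line)
      then show ?thesis by (simp add: linear_add[OF lin] linear_scale[OF lin] divide_inverse)
    qed
    then have "\<exists>w\<in>int_lattice. w \<noteq> 0 \<and> cross2 w (?u /\<^sub>R norm ?u) = 0 \<and> (\<forall>i. \<bar>w $ i\<bar> \<le> 1 / r)"
      by (intro line_direction_bounded_integer[OF K(3) gap]) (use u0 in simp_all)
    then show ?thesis using u0 by auto
  qed
  then obtain w where w: "\<forall>n. w n \<in> ?W \<and> w n \<noteq> 0 \<and> cross2 (w n) ((T ^^ n) u) = 0"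
    using choice[of "\<lambda>n w. w \<in> ?W \<and> w \<noteq> 0 \<and> cross2 w ((T ^^ n) u) = 0"] by auto
  have w: "w n \<in> ?W" "w n \<noteq> 0" "cross2 (w n) ((T ^^ n) u) = 0" for n
    using spec[OF w, of n] by simp_all
  have "finite (range w)" by (rule finite_subset[OF _ finite_bounded_int_lattice]) (use w(1) in blast)
  then have "\<not> inj w" using finite_imageD infinite_UNIV_nat by blast
  then obtain i j where ij: "i < j" "w i = w j" unfolding inj_def by (metis nat_neq_iff)
  have "cross2 ((T ^^ i) u) ((T ^^ j) u) = 0"
    using cross2_zero_trans[OF w(3)[of i]] w(3)[of j] w(2)[of i] ij(2) by simp
  moreover have "(T ^^ j) u = (T ^^ i) ((T ^^ (j - i)) u)"
    using ij(1) by (simp add: funpow_add[symmetric, THEN fun_cong, unfolded o_def])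
  ultimately have "cross2 u ((T ^^ (j - i)) u) = 0"
    using expanding_det[OF exp] by (simp add: crossn)
  then show ?thesis using that[of "w 0" "j - i"] w[of 0] ij(1) by simp
qed

section \<open>Smooth partitions force integer eigenvalues\<close>

lemma C1_curve_in_matrix_image:
  assumes exp: "expanding (A::int^2^2)" and inv: "(*v) (real_matrix A) ` K \<subseteq> K" and h: "C1_curve_in K h h' a b"
  shows "C1_curve_in K (\<lambda>t. real_matrix A *v h t) (\<lambda>t. real_matrix A *v h' t) a b"
  unfolding C1_curve_in_def
proof (intro conjI ballI)
  have bl: "bounded_linear ((*v) (real_matrix A))" by (rule matrix_vector_mul_bounded_linear)
  show "a < b" using h by (simp add: C1_curve_in_def)
  show "continuous_on {a<..<b} (\<lambda>t. real_matrix A *v h' t)"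
    using h by (intro bounded_linear.continuous_on[OF bl]) (simp add: C1_curve_in_def)
  fix t assume "t \<in> {a<..<b}"
  then have t: "(h has_vector_derivative h' t) (at t)" "h' t \<noteq> 0" "h t \<in> K"
    using h by (simp_all add: C1_curve_in_def)
  show "((\<lambda>t. real_matrix A *v h t) has_vector_derivative real_matrix A *v h' t) (at t)"
    by (rule bounded_linear.has_vector_derivative[OF bl t(1)])
  show "real_matrix A *v h' t \<noteq> 0"
  proof
    assume "real_matrix A *v h' t = 0"
    then have "real_matrix A *v h' t = real_matrix A *v 0" by simp
    then show False using expanding_inj[OF exp] t(2) by blast
  qed
  show "real_matrix A *v h t \<in> K" using inv t(3) by blast
qed

text \<open>Otherwise all tangents are parallel to one vector \<open>e\<close>. The image under \<open>T\<close> of a curve in \<open>K\<close> is again a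
  curve in \<open>K\<close>, so \<open>T e\<close> is parallel to \<open>e\<close> and \<open>T\<close> multiplies \<open>cross2 e\<close> by a number \<open>m \<noteq> 0\<close>. As \<open>cross2 e\<close>
  takes only countably many values on \<open>K\<close>, there is a value \<open>y\<close> such that no \<open>m ^ n * y\<close> is one of them.
  The line \<open>cross2 e x = y\<close> never meets \<open>K\<close> under iteration, although it does not project to a single point.\<close>

lemma two_independent_tangents:
  fixes A :: "int^2^2"
  assumes exp: "expanding A" and M: "markov_partition (toral_endo A) \<M>" and sm: "smooth_partition \<M>"
  shows "\<exists>h h' a b t k k' c d s. C1_curve_in (covering_boundary \<M>) h h' a b \<and> t \<in> {a<..<b} \<and>
    C1_curve_in (covering_boundary \<M>) k k' c d \<and> s \<in> {c<..<d} \<and> cross2 (h' t) (k' s) \<noteq> 0"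
proof (rule ccontr)
  define K where "K = covering_boundary \<M>"
  define T where "T = (*v) (real_matrix A)"
  assume "\<not> ?thesis"
  then have par: "cross2 (h' t) (k' s) = 0"
    if "C1_curve_in K h h' a b" "t \<in> {a<..<b}" "C1_curve_in K k k' c d" "s \<in> {c<..<d}"
    for h h' a b t k k' c d s
    using that unfolding K_def by blast
  have lin: "linear (T ^^ n)" for n unfolding T_def by (intro linear_funpow matrix_vector_mul_linear)
  have triv: "torus_proj x = torus_proj y"
    if X: "connected X" "x \<in> X" "y \<in> X" and av: "\<And>n x. x \<in> X \<Longrightarrow> (T ^^ n) x \<notin> K" for X x y
  proof (rule connected_avoiding_boundary_trivial[OF M X])
    show "torus_proj (((*v) (real_matrix A) ^^ n) x) \<notin> partition_boundary \<M>" if "x \<in> X" for n x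
      using av[OF that, of n] by (simp add: K_def covering_boundary_def T_def)
  qed
  obtain \<C> where C: "finite \<C>" "\<forall>C\<in>\<C>. C1_arc C" "partition_boundary \<M> = \<Union>\<C>"
    using sm unfolding smooth_partition_def by (elim exE conjE)
  have K_eq: "K = (\<Union>C\<in>\<C>. {x. torus_proj x \<in> C})"
    by (auto simp: K_def covering_boundary_def C(3))
  have inv: "T ` K \<subseteq> K"
    using covering_boundary_invariant[OF exp M] by (auto simp: K_def T_def)
  have "K \<noteq> {}"
  proof
    assume "K = {}"
    then have "torus_proj (0::real^2) = torus_proj (\<chi> i. 1/2)"
      by (intro triv[of UNIV]) auto
    then have "(0::real^2) $ 1 - ((\<chi> i. 1/2) :: real^2) $ 1 \<in> \<int>" unfolding torus_proj_eq_iff by (rule spec)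
    then have "- (1/2 :: real) \<in> \<int>" by simp
    then have "\<bar>- (1/2 :: real)\<bar> \<ge> 1" by (intro Ints_nonzero_abs_ge1) auto
    then show False by simp
  qed
  then obtain C where C0: "C \<in> \<C>" by (auto simp: K_eq)
  then have sub: "{x. torus_proj x \<in> C} \<subseteq> K" by (auto simp: K_eq)
  have "C1_arc C" using C(2) C0 by blast
  then obtain \<gamma> \<gamma>' where "\<And>t. t \<in> {0<..<1} \<Longrightarrow>
      \<exists>a b h. a < t \<and> t < b \<and> C1_curve_in K h \<gamma>' a b \<and> (\<forall>s\<in>{a<..<b}. torus_proj (h s) = \<gamma> s)"
    using C1_arc_lifts_to_curves[OF _ sub] by metis
  from this[of "1/2"] obtain a b h where h: "a < 1/2" "1/2 < b" "C1_curve_in K h \<gamma>' a b" by auto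
  define e where "e = \<gamma>' (1/2)"
  have half: "1/2 \<in> {a<..<b}" using h by simp
  then have e0: "e \<noteq> 0" using h(3) by (simp add: C1_curve_in_def e_def)
  have "C1_curve_in K (\<lambda>t. T (h t)) (\<lambda>t. T (\<gamma>' t)) a b"
    unfolding T_def by (rule C1_curve_in_matrix_image[OF exp inv[unfolded T_def] h(3)])
  from par[OF h(3) half this half] have "cross2 e (T e) = 0" by (simp add: e_def)
  then obtain c where c: "T e = c *\<^sub>R e" using e0 cross2_eq_0_imp by metis
  have c0: "c \<noteq> 0"
  proof
    assume "c = 0"
    then have "real_matrix A *v e = real_matrix A *v 0" using c by (simp add: T_def)
    then show False using expanding_inj[OF exp] e0 by blast
  qed
  define m where "m = det (real_matrix A) / c"
  have m0: "m \<noteq> 0" using expanding_det[OF exp] c0 by (simp add: m_def)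
  have mT: "cross2 e (T x) = m * cross2 e x" for x
  proof -
    have "c * cross2 e (T x) = cross2 (T e) (T x)" by (simp add: c)
    also have "\<dots> = det (real_matrix A) * cross2 e x" unfolding T_def by (rule cross2_matrix)
    finally show ?thesis using c0 by (simp add: m_def field_simps)
  qed
  have mTn: "cross2 e ((T ^^ n) x) = m ^ n * cross2 e x" for n x
    by (induction n) (simp_all add: mT)
  define S where "S = cross2 e ` K"
  have "countable S"
  proof -
    have "countable (cross2 e ` {x. torus_proj x \<in> C})" if CC: "C \<in> \<C>" for C
    proof (rule countable_cross2_if_parallel_tangents)
      show "C1_arc C" using C(2) CC by blast
      show "{x. torus_proj x \<in> C} \<subseteq> K" using CC by (auto simp: K_eq)
      show "cross2 e (h'' t) = 0" if "C1_curve_in K k h'' a' b'" "t \<in> {a'<..<b'}" for k h'' a' b' t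
        unfolding e_def by (rule par[OF h(3) half that])
    qed
    then show ?thesis unfolding S_def K_eq image_UN
      by (intro countable_UN countable_finite[OF C(1)])
  qed
  then have "countable (\<Union>n. (\<lambda>y. y / m ^ n) ` S)" by (intro countable_UN countable_image) auto
  then have "(\<Union>n. (\<lambda>y. y / m ^ n) ` S) \<noteq> UNIV" using uncountable_UNIV_real by metis
  then obtain y where y: "y \<notin> (\<Union>n. (\<lambda>y. y / m ^ n) ` S)" by blast
  have yS: "m ^ n * y \<notin> S" for n
  proof
    assume "m ^ n * y \<in> S"
    then have "(m ^ n * y) / m ^ n \<in> (\<lambda>y. y / m ^ n) ` S" by (rule imageI)
    then show False using y m0 by auto
  qed
  define p where "p = perp e"
  have pe: "cross2 e p \<noteq> 0" using e0 by (simp add: p_def cross2_perp)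
  define x where "x = (y / cross2 e p) *\<^sub>R p"
  have x: "cross2 e x = y" using pe by (simp add: x_def)
  let ?X = "range (\<lambda>s. x + s *\<^sub>R e)"
  \<comment> \<open>two points of the line at distance \<open>1/2\<close>, hence with different projections\<close>
  have "torus_proj (x + 0 *\<^sub>R e) = torus_proj (x + (1 / (2 * norm e)) *\<^sub>R e)"
  proof (rule triv[of ?X])
    show "connected ?X" by (intro connected_continuous_image continuous_intros connected_UNIV)
    show "(T ^^ n) v \<notin> K" if "v \<in> ?X" for n v
    proof
      assume "(T ^^ n) v \<in> K"
      then have "cross2 e ((T ^^ n) v) \<in> S" unfolding S_def by (rule imageI)
      moreover have "cross2 e v = y" using that x by auto
      ultimately show False using yS[of n] by (simp add: mTn)
    qed
  qed auto
  then have "- ((1 / (2 * norm e)) *\<^sub>R e) \<in> int_lattice"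
    unfolding torus_proj_eq_lattice by simp
  moreover have "norm (- ((1 / (2 * norm e)) *\<^sub>R e)) < 1" using e0 by simp
  ultimately have "- ((1 / (2 * norm e)) *\<^sub>R e) = 0" by (rule int_lattice_norm_less_1)
  then show False using e0 by simp
qed

text \<open>Maximal stretching of the tangent vector needs to be checked against a single independent vector \<open>w\<close>
  only.\<close>

lemma dominated_limit_line:
  fixes K :: "(real^2) set" and T :: "real^2 \<Rightarrow> real^2"
  assumes K: "closed K" "lattice_periodic K" "T ` K \<subseteq> K" and T: "linear T"
    and h: "C1_curve_in K h h' a b" "t \<in> {a<..<b}"
    and big: "filterlim (\<lambda>i. norm ((T ^^ n i) (h' t))) at_top sequentially"
    and dom: "cross2 (h' t) w \<noteq> 0" "\<And>i. norm ((T ^^ n i) w) \<le> C * norm ((T ^^ n i) (h' t))"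
  obtains q u r z where "norm u = 1" "\<And>s. q + s *\<^sub>R u \<in> K" "\<And>i. z i \<in> int_lattice"
    "(\<lambda>i. (T ^^ n (r i)) (h t) + z i) \<longlonglongrightarrow> q"
proof -
  obtain C' where C': "\<And>f x. linear f \<Longrightarrow> norm (f w) \<le> C * norm (f (h' t)) \<Longrightarrow>
      norm (f x :: real^2) \<le> C' * norm (f (h' t)) * norm x"
    using linear_dominated_by_basis_vector[OF dom(1), of C] by blast
  have dom': "norm ((T ^^ n i) x) \<le> C' * norm ((T ^^ n i) (h' t)) * norm x" for i x
    by (rule C'[OF linear_funpow[OF T] dom(2)])
  have g: "(h has_vector_derivative h' t) (at t)" "h t \<in> K"
    using h by (simp_all add: C1_curve_in_def)
  have "\<forall>\<^sub>F s in at t. s \<in> {a<..<b}" using h(2) by (intro eventually_at_in_open') auto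
  then have ev: "\<forall>\<^sub>F s in at t. h s \<in> K"
    by eventually_elim (use h(1) in \<open>simp add: C1_curve_in_def\<close>)
  show ?thesis
    by (rule exists_limit_line[OF K T g(1) ev g(2) big dom']) (rule that)
qed

text \<open>Of two independent tangent vectors one is stretched by \<open>T ^^ n\<close> at least as much as the other for
  infinitely many \<open>n\<close>; along these \<open>n\<close> it is stretched at the maximal rate, up to a constant.\<close>

lemma rational_periodic_direction:
  fixes A :: "int^2^2"
  defines "T \<equiv> (*v) (real_matrix A)"
  assumes exp: "expanding A" and K: "closed K" "K \<noteq> UNIV" "lattice_periodic K" "T ` K \<subseteq> K"
    and h: "C1_curve_in K h h' a b" "t \<in> {a<..<b}" and k: "C1_curve_in K k k' c d" "s \<in> {c<..<d}"
    and ind: "cross2 (h' t) (k' s) \<noteq> 0"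
  obtains w n where "w \<in> int_lattice" "w \<noteq> 0" "n > 0" "cross2 w ((T ^^ n) w) = 0"
proof -
  have T: "linear T" unfolding T_def by (rule matrix_vector_mul_linear)
  have line: "\<exists>q u. norm u = 1 \<and> (\<forall>s. q + s *\<^sub>R u \<in> K)"
    if h: "C1_curve_in K h h' a b" "t \<in> {a<..<b}" and ind: "cross2 (h' t) w \<noteq> 0"
      and inf: "infinite {n. norm ((T ^^ n) w) \<le> norm ((T ^^ n) (h' t))}" for h h' a b t w
  proof -
    obtain r :: "nat \<Rightarrow> nat" where r: "strict_mono r" "\<And>i. r i \<in> {n. norm ((T ^^ n) w) \<le> norm ((T ^^ n) (h' t))}"
      using infinite_enumerate[OF inf] by blast
    have "h' t \<noteq> 0" using ind by auto
    then have "filterlim (\<lambda>n. norm ((T ^^ n) (h' t))) at_top sequentially"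
      unfolding T_def by (rule orbit_tendsto_at_top[OF exp])
    then have big: "filterlim (\<lambda>i. norm ((T ^^ r i) (h' t))) at_top sequentially"
      by (rule filterlim_compose[OF _ filterlim_subseq[OF r(1)]])
    have "norm ((T ^^ r i) w) \<le> 1 * norm ((T ^^ r i) (h' t))" for i using r(2)[of i] by simp
    then obtain q u where "norm u = 1" "\<And>s. q + s *\<^sub>R u \<in> K"
      by (rule dominated_limit_line[OF K(1,3,4) T h big ind]) (rule that)
    then show ?thesis by blast
  qed
  let ?P = "\<lambda>n. norm ((T ^^ n) (k' s)) \<le> norm ((T ^^ n) (h' t))"
  have "\<exists>q u. norm u = 1 \<and> (\<forall>s. q + s *\<^sub>R u \<in> K)"
  proof (cases "infinite {n. ?P n}")
    case True
    then show ?thesis by (rule line[OF h ind])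
  next
    case False
    then have "infinite (- {n. ?P n})" by (simp add: Compl_eq_Diff_UNIV Diff_infinite_finite)
    then have inf: "infinite {n. norm ((T ^^ n) (h' t)) \<le> norm ((T ^^ n) (k' s))}"
      by (rule infinite_super[rotated]) auto
    have "cross2 (k' s) (h' t) \<noteq> 0" using ind cross2_commute[of "h' t" "k' s"] by simp
    then show ?thesis using inf by (rule line[OF k])
  qed
  then obtain q u where u: "norm u = 1" "\<And>s. q + s *\<^sub>R u \<in> K" by blast
  then have u0: "u \<noteq> 0" by auto
  obtain w n where wn: "w \<in> int_lattice" "w \<noteq> 0" "cross2 w u = 0" "n > 0" "cross2 u ((T ^^ n) u) = 0"
    by (rule line_direction_periodic[OF exp K(1,2,3) K(4)[unfolded T_def] u0 u(2)]) (rule that, simp_all add: T_def)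
  have "cross2 u w = 0" using wn(3) cross2_commute[of u w] by simp
  then obtain c where "w = c *\<^sub>R u" using u0 cross2_eq_0_imp by metis
  then have "cross2 w ((T ^^ n) w) = 0"
    using wn(5) by (simp add: linear_scale[OF linear_funpow[OF T]])
  then show ?thesis using that wn by blast
qed


lemma ex_int_grid_point:
  fixes \<alpha> \<beta> \<theta> x :: real
  assumes "\<theta> \<noteq> 0" "\<bar>\<theta>\<bar> \<le> \<beta> - \<alpha>"
  shows "\<exists>j::int. \<alpha> \<le> x + of_int j * \<theta> \<and> x + of_int j * \<theta> \<le> \<beta>"
proof -
  define j where "j = \<lceil>(\<alpha> - x) / \<bar>\<theta>\<bar>\<rceil>"
  have t: "\<bar>\<theta>\<bar> > 0" using assms(1) by simp
  have "(\<alpha> - x) / \<bar>\<theta>\<bar> \<le> of_int j" "of_int j < (\<alpha> - x) / \<bar>\<theta>\<bar> + 1"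
    unfolding j_def by linarith+
  then have "\<alpha> - x \<le> of_int j * \<bar>\<theta>\<bar>" "of_int j * \<bar>\<theta>\<bar> < \<alpha> - x + \<bar>\<theta>\<bar>"
    using t by (simp_all add: field_simps)
  then have j: "\<alpha> \<le> x + of_int j * \<bar>\<theta>\<bar> \<and> x + of_int j * \<bar>\<theta>\<bar> \<le> \<beta>" using assms(2) by linarith
  show ?thesis
  proof (cases "\<theta> > 0")
    case True then show ?thesis using j by auto
  next
    case False then show ?thesis using j by (intro exI[of _ "- j"]) auto
  qed
qed

text \<open>As \<open>T w\<close> spans a periodic direction too, \<open>T w = a w\<close>. If \<open>T\<close> acted on the quotient by \<open>w\<close> by a factor
  \<open>b \<noteq> a\<close>, there would be an eigenvector for \<open>b\<close> outside the span of \<open>w\<close>.\<close>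

lemma unique_eigendirection_structure:
  fixes A :: "int^2^2"
  defines "T \<equiv> (*v) (real_matrix A)"
  assumes exp: "expanding A" and w: "w \<noteq> 0" "n > 0" "cross2 w ((T ^^ n) w) = 0"
    and unique: "\<And>u k. k > 0 \<Longrightarrow> cross2 u ((T ^^ k) u) = 0 \<Longrightarrow> cross2 w u = 0"
  obtains a where "T w = a *\<^sub>R w" "\<bar>a\<bar> > 1" "\<And>x. cross2 w (T x) = a * cross2 w x"
proof -
  have T: "linear T" unfolding T_def by (rule matrix_vector_mul_linear)
  have "cross2 (T w) ((T ^^ n) (T w)) = cross2 (T w) (T ((T ^^ n) w))" by (simp add: funpow_swap1)
  also have "\<dots> = det (real_matrix A) * cross2 w ((T ^^ n) w)" unfolding T_def by (rule cross2_matrix)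
  finally have "cross2 w (T w) = 0" using w(2,3) by (intro unique[of n]) auto
  then obtain a where a: "T w = a *\<^sub>R w" using w(1) cross2_eq_0_imp by metis
  have Tn: "(T ^^ k) w = a ^ k *\<^sub>R w" for k
    by (induction k) (simp_all add: a linear_scale[OF T] mult.commute)
  have a1: "\<bar>a\<bar> > 1"
  proof (rule ccontr)
    assume "\<not> \<bar>a\<bar> > 1"
    then have "\<bar>a\<bar> ^ k \<le> 1" for k by (intro power_le_one) auto
    then have le: "norm ((T ^^ k) w) \<le> norm w" for k
      unfolding Tn by (simp add: power_abs mult_left_le_one_le)
    have "filterlim (\<lambda>k. norm ((T ^^ k) w)) at_top sequentially"
      unfolding T_def by (rule orbit_tendsto_at_top[OF exp w(1)])
    then have "\<forall>\<^sub>F k in sequentially. norm w < norm ((T ^^ k) w)"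
      unfolding filterlim_at_top_dense by (rule spec)
    then obtain k where "norm w < norm ((T ^^ k) w)" by (auto dest: eventually_happens)
    then show False using le[of k] by simp
  qed
  define b where "b = det (real_matrix A) / a"
  have b: "cross2 w (T x) = b * cross2 w x" for x
  proof -
    have "a * cross2 w (T x) = cross2 (T w) (T x)" by (simp add: a)
    also have "\<dots> = det (real_matrix A) * cross2 w x" unfolding T_def by (rule cross2_matrix)
    finally show ?thesis using a1 by (auto simp: b_def field_simps)
  qed
  have "b = a"
  proof (rule ccontr)
    assume "b \<noteq> a"
    define x where "x = perp w"
    have x: "cross2 w x \<noteq> 0" using w(1) by (simp add: x_def cross2_perp)
    have "cross2 w (T x - b *\<^sub>R x) = 0" by (simp add: b)
    then obtain c where "T x - b *\<^sub>R x = c *\<^sub>R w" using w(1) cross2_eq_0_imp by metis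
    then have c: "T x = b *\<^sub>R x + c *\<^sub>R w" by (simp add: algebra_simps)
    define s where "s = c / (b - a)"
    define y where "y = x + s *\<^sub>R w"
    have "T y = b *\<^sub>R x + (c + s * a) *\<^sub>R w"
      by (simp add: y_def linear_add[OF T] linear_scale[OF T] a c scaleR_add_left add.assoc)
    also have "c + s * a = b * s" using \<open>b \<noteq> a\<close> by (simp add: s_def field_simps)
    finally have "T y = b *\<^sub>R y" by (simp add: y_def scaleR_add_right)
    then have "cross2 w y = 0" by (intro unique[of 1]) auto
    then show False using x by (simp add: y_def)
  qed
  with a a1 b show ?thesis by (intro that[of a]) auto
qed

text \<open>By continuity the curve stays transversal to \<open>w\<close> near \<open>t\<close>, so \<open>cross2 w\<close> is not constant along it
  there, and the intermediate value theorem applies.\<close>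

lemma transversal_curve_covers_offsets:
  assumes h: "C1_curve_in K h h' lo hi" "t \<in> {lo<..<hi}" and trans: "cross2 w (h' t) \<noteq> 0"
  obtains \<alpha> \<beta> where "\<alpha> < \<beta>"
    "\<And>v. \<alpha> \<le> v \<Longrightarrow> v \<le> \<beta> \<Longrightarrow> \<exists>s\<in>{lo<..<hi}. cross2 w (h' s) \<noteq> 0 \<and> cross2 w (h s) = v"
proof -
  have hder: "(h has_vector_derivative h' s) (at s)" "h s \<in> K" if "s \<in> {lo<..<hi}" for s
    using h(1) that by (simp_all add: C1_curve_in_def)
  have "continuous_on {lo<..<hi} (\<lambda>s. cross2 w (h' s))"
    using h(1) by (intro bounded_linear.continuous_on[OF bounded_linear_cross2]) (simp add: C1_curve_in_def)
  then have "open ({lo<..<hi} \<inter> (\<lambda>s. cross2 w (h' s)) -` (- {0}))"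
    by (rule continuous_open_preimage) auto
  moreover have "t \<in> {lo<..<hi} \<inter> (\<lambda>s. cross2 w (h' s)) -` (- {0})" using h(2) trans by simp
  ultimately obtain e where e: "e > 0" "cball t e \<subseteq> {lo<..<hi} \<inter> (\<lambda>s. cross2 w (h' s)) -` (- {0})"
    by (meson open_contains_cball)
  have seg: "s \<in> {lo<..<hi}" "cross2 w (h' s) \<noteq> 0" if "t \<le> s" "s \<le> t + e" for s
  proof -
    have "s \<in> cball t e" using that by (simp add: dist_real_def)
    then have "s \<in> {lo<..<hi} \<inter> (\<lambda>s. cross2 w (h' s)) -` (- {0})" using e(2) by blast
    then show "s \<in> {lo<..<hi}" "cross2 w (h' s) \<noteq> 0" by simp_all
  qed
  define \<phi> where "\<phi> s = cross2 w (h s)" for s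
  have phi: "(\<phi> has_real_derivative cross2 w (h' s)) (at s)" if "t \<le> s" "s \<le> t + e" for s
    unfolding \<phi>_def has_real_derivative_iff_has_vector_derivative
    by (rule bounded_linear.has_vector_derivative[OF bounded_linear_cross2 hder(1)[OF seg(1)[OF that]]])
  have "\<exists>s. t < s \<and> s < t + e \<and> \<phi> (t + e) - \<phi> t = (t + e - t) * cross2 w (h' s)"
    by (rule MVT2) (use e(1) phi in auto)
  then have ne: "\<phi> (t + e) \<noteq> \<phi> t" using seg(2) e(1) by force
  have cont: "continuous_on {t..t + e} \<phi>"
    using phi by (intro continuous_at_imp_continuous_on ballI) (auto intro: DERIV_isCont)
  define \<alpha> \<beta> where "\<alpha> = min (\<phi> t) (\<phi> (t + e))" and "\<beta> = max (\<phi> t) (\<phi> (t + e))"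
  have ab: "\<alpha> < \<beta>" using ne by (auto simp: \<alpha>_def \<beta>_def)
  have ivt: "\<exists>s\<ge>t. s \<le> t + e \<and> \<phi> s = v" if "\<alpha> \<le> v" "v \<le> \<beta>" for v
  proof (cases "\<phi> t \<le> \<phi> (t + e)")
    case True
    then show ?thesis using that cont e(1) by (intro IVT') (auto simp: \<alpha>_def \<beta>_def)
  next
    case False
    then show ?thesis using that cont e(1) by (intro IVT2') (auto simp: \<alpha>_def \<beta>_def)
  qed
  show ?thesis
  proof (rule that[OF ab])
    fix v assume "\<alpha> \<le> v" "v \<le> \<beta>"
    then obtain s where "t \<le> s" "s \<le> t + e" "\<phi> s = v" using ivt by blast
    then show "\<exists>s\<in>{lo<..<hi}. cross2 w (h' s) \<noteq> 0 \<and> cross2 w (h s) = v"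
      using seg[of s] by (auto simp: \<phi>_def)
  qed
qed

text \<open>The offset of a line parallel to \<open>w\<close> is the value of \<open>cross2 w\<close> on it, and integer translations change
  offsets by elements of the group \<open>H\<close>. Multiples of \<open>D / (a ^ m - 1)\<close>, where \<open>D \<in> H\<close>, are fixed by
  multiplication by \<open>a ^ m\<close> modulo \<open>H\<close>, and for large \<open>m\<close> one such \<open>y\<close> is the offset of a point outside
  \<open>K\<close>. Some offset \<open>(y + i * D) / a ^ N\<close> is met by a curve transversal to \<open>w\<close>; the iterates of the
  meeting point with exponents \<open>N + m * j\<close> all have offset \<open>y\<close> modulo \<open>H\<close>. The blow-up there yields a line
  in \<open>K\<close> parallel to \<open>w\<close> whose offset is \<open>y\<close> modulo \<open>H\<close>, since \<open>H\<close> is closed.\<close>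

lemma no_transversal_curve:
  fixes A :: "int^2^2"
  defines "T \<equiv> (*v) (real_matrix A)"
  assumes exp: "expanding A" and K: "closed K" "K \<noteq> UNIV" "lattice_periodic K" "T ` K \<subseteq> K"
    and w: "w \<in> int_lattice" "w \<noteq> 0" "T w = a *\<^sub>R w" and a: "\<bar>a\<bar> > 1" and wT: "\<And>x. cross2 w (T x) = a * cross2 w x"
    and lines: "\<And>q u. u \<noteq> 0 \<Longrightarrow> (\<And>s. q + s *\<^sub>R u \<in> K) \<Longrightarrow> cross2 w u = 0"
    and h: "C1_curve_in K h h' lo hi" "t \<in> {lo<..<hi}"
  shows "cross2 w (h' t) = 0"
proof (rule ccontr)
  assume trans: "cross2 w (h' t) \<noteq> 0"
  have T: "linear T" unfolding T_def by (rule matrix_vector_mul_linear)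
  have wTn: "cross2 w ((T ^^ n) x) = a ^ n * cross2 w x" for n x
    by (induction n) (simp_all add: wT)
  have Tnw: "(T ^^ n) w = a ^ n *\<^sub>R w" for n
    by (induction n) (simp_all add: w(3) linear_scale[OF T] mult.commute)
  define p where "p = perp w"
  define D where "D = cross2 w p"
  have D: "D > 0" using w(2) by (simp add: D_def p_def cross2_perp)
  have p: "p \<in> int_lattice" unfolding p_def using w(1) by (rule perp_int_lattice)
  define H where "H = cross2 w ` int_lattice"
  have H_add: "x + y \<in> H" if xy: "x \<in> H" "y \<in> H" for x y
  proof -
    obtain u v where uv: "u \<in> int_lattice" "v \<in> int_lattice" "x = cross2 w u" "y = cross2 w v"
      using xy unfolding H_def by blast
    then have "x + y = cross2 w (u + v)" by simp
    then show ?thesis unfolding H_def using int_lattice_add[OF uv(1,2)] by (rule image_eqI)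
  qed
  have H_mult: "a ^ n * x \<in> H" if x: "x \<in> H" for n x
  proof -
    obtain u where u: "u \<in> int_lattice" "x = cross2 w u" using x unfolding H_def by blast
    have "(T ^^ n) u \<in> int_lattice"
      by (induction n) (use u(1) in \<open>simp_all add: T_def int_matrix_lattice\<close>)
    moreover have "a ^ n * x = cross2 w ((T ^^ n) u)" by (simp add: wTn u(2))
    ultimately show ?thesis unfolding H_def by (rule image_eqI[rotated])
  qed
  have H_D: "of_int j * D \<in> H" for j :: int
  proof -
    have "of_int j *\<^sub>R p \<in> int_lattice" using p by (rule int_lattice_scale) simp
    moreover have "of_int j * D = cross2 w (of_int j *\<^sub>R p)" by (simp add: D_def)
    ultimately show ?thesis unfolding H_def by (rule image_eqI[rotated])
  qed
  have "closed H"
    unfolding H_def by (rule closed_subset_Ints) (use cross2_int[OF w(1)] in blast)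
  obtain x1 \<epsilon> where x1: "\<epsilon> > 0" "ball x1 \<epsilon> \<subseteq> - K"
  proof -
    have "open (- K)" "- K \<noteq> {}" using K(1,2) by auto
    then show ?thesis using that by (metis open_contains_ball ex_in_conv)
  qed
  define \<delta> where "\<delta> = \<epsilon> * D / (2 * norm p)"
  have p0: "norm p > 0" using D by (auto simp: D_def)
  have \<delta>: "\<delta> > 0" using x1(1) D p0 by (simp add: \<delta>_def)
  have off: "\<exists>x. cross2 w x = y \<and> x \<notin> K" if y: "cross2 w x1 - \<delta> \<le> y" "y \<le> cross2 w x1 + \<delta>" for y
  proof -
    define s where "s = (y - cross2 w x1) / D"
    have "\<bar>s\<bar> \<le> \<delta> / D" unfolding s_def abs_divide using y D by (intro divide_mono) auto
    then have "\<bar>s\<bar> * norm p \<le> \<delta> / D * norm p" by (intro mult_right_mono) auto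
    also have "\<delta> / D * norm p = \<epsilon> / 2" using D p0 by (simp add: \<delta>_def)
    also have "\<dots> < \<epsilon>" using x1(1) by simp
    finally have "x1 + s *\<^sub>R p \<in> ball x1 \<epsilon>" by (simp add: dist_norm)
    then have "x1 + s *\<^sub>R p \<notin> K" using x1(2) by blast
    moreover have "cross2 w (x1 + s *\<^sub>R p) = y" using D by (simp add: s_def flip: D_def)
    ultimately show ?thesis by blast
  qed
  obtain m where m: "\<bar>a\<bar> ^ m > 1 + D / \<delta>" using real_arch_pow[OF a] by blast
  have am: "\<bar>a ^ m - 1\<bar> \<ge> D / \<delta>" "a ^ m - 1 \<noteq> 0"
  proof -
    have "\<bar>a ^ m - 1\<bar> \<ge> \<bar>a\<bar> ^ m - 1" by (simp add: power_abs[symmetric])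
    moreover have "D / \<delta> > 0" using D \<delta> by simp
    ultimately show "\<bar>a ^ m - 1\<bar> \<ge> D / \<delta>" "a ^ m - 1 \<noteq> 0" using m by auto
  qed
  have "\<exists>j::int. cross2 w x1 - \<delta> \<le> 0 + of_int j * (D / (a ^ m - 1)) \<and> 0 + of_int j * (D / (a ^ m - 1)) \<le> cross2 w x1 + \<delta>"
  proof (rule ex_int_grid_point)
    show "D / (a ^ m - 1) \<noteq> 0" using D am by simp
    have "\<bar>D / (a ^ m - 1)\<bar> \<le> \<delta>"
      using am D \<delta> by (simp add: abs_divide field_simps)
    then show "\<bar>D / (a ^ m - 1)\<bar> \<le> cross2 w x1 + \<delta> - (cross2 w x1 - \<delta>)" using \<delta> by simp
  qed
  then obtain j :: int where j: "cross2 w x1 - \<delta> \<le> of_int j * (D / (a ^ m - 1))"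
    "of_int j * (D / (a ^ m - 1)) \<le> cross2 w x1 + \<delta>" by auto
  define y where "y = of_int j * (D / (a ^ m - 1))"
  obtain x2 where x2: "cross2 w x2 = y" "x2 \<notin> K" using off[OF j] unfolding y_def by blast
  have "a ^ m * y - y = of_int j * D"
  proof -
    have "a ^ m * y - y = (a ^ m - 1) * y" by (simp add: algebra_simps)
    then show ?thesis using am(2) by (simp add: y_def)
  qed
  then have y1: "a ^ m * y - y \<in> H" using H_D by simp
  have yper: "a ^ (m * i) * y - y \<in> H" for i
  proof (induction i)
    case 0 then show ?case using H_D[of 0] by simp
  next
    case (Suc i)
    have "a ^ (m * Suc i) * y - y = a ^ (m * i) * (a ^ m * y - y) + (a ^ (m * i) * y - y)"
      by (simp add: power_add algebra_simps)
    then show ?case using H_add[OF H_mult[OF y1] Suc, of "m * i"] by (simp only:)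
  qed
  obtain \<alpha> \<beta> where ab: "\<alpha> < \<beta>" and cover:
    "\<And>v. \<alpha> \<le> v \<Longrightarrow> v \<le> \<beta> \<Longrightarrow> \<exists>s\<in>{lo<..<hi}. cross2 w (h' s) \<noteq> 0 \<and> cross2 w (h s) = v"
    by (rule transversal_curve_covers_offsets[OF h trans]) (rule that)
  obtain N where N: "\<bar>a\<bar> ^ N > D / (\<beta> - \<alpha>)" using real_arch_pow[OF a] by blast
  have a0: "a \<noteq> 0" using a by auto
  have "\<exists>i::int. \<alpha> \<le> y / a ^ N + of_int i * (D / a ^ N) \<and> y / a ^ N + of_int i * (D / a ^ N) \<le> \<beta>"
  proof (rule ex_int_grid_point)
    show "D / a ^ N \<noteq> 0" using D a0 by simp
    show "\<bar>D / a ^ N\<bar> \<le> \<beta> - \<alpha>" using N D ab a0 by (simp add: abs_divide power_abs field_simps)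
  qed
  then obtain i :: int where "\<alpha> \<le> y / a ^ N + of_int i * (D / a ^ N)" "y / a ^ N + of_int i * (D / a ^ N) \<le> \<beta>" by blast
  then obtain s where s: "s \<in> {lo<..<hi}" "cross2 w (h' s) \<noteq> 0"
    "cross2 w (h s) = y / a ^ N + of_int i * (D / a ^ N)" using cover by blast
  have sy: "a ^ N * cross2 w (h s) = y + of_int i * D"
    using s(3) a0 by (simp add: field_simps)
  let ?n = "\<lambda>i. N + m * i"
  have m0: "m > 0"
  proof (rule ccontr)
    assume "\<not> m > 0"
    then have "m = 0" by simp
    then show False using am(2) by simp
  qed
  have "h' s \<noteq> 0" using s(2) by auto
  then have "filterlim (\<lambda>n. norm ((T ^^ n) (h' s))) at_top sequentially"
    unfolding T_def by (rule orbit_tendsto_at_top[OF exp])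
  moreover have "strict_mono ?n" using m0 by (intro strict_monoI) simp
  ultimately have big: "filterlim (\<lambda>i. norm ((T ^^ ?n i) (h' s))) at_top sequentially"
    by (rule filterlim_compose[OF _ filterlim_subseq])
  have nz: "cross2 (h' s) w \<noteq> 0" using s(2) cross2_commute[of "h' s" w] by simp
  have dom: "norm ((T ^^ ?n i) w) \<le> (2 * norm w * norm w / \<bar>cross2 w (h' s)\<bar>) * norm ((T ^^ ?n i) (h' s))" for i
  proof -
    let ?k = "?n i"
    have "\<bar>a\<bar> ^ ?k * \<bar>cross2 w (h' s)\<bar> = \<bar>cross2 w ((T ^^ ?k) (h' s))\<bar>"
      unfolding wTn by (simp add: abs_mult power_abs)
    also have "\<dots> \<le> 2 * norm w * norm ((T ^^ ?k) (h' s))" by (rule abs_cross2_le)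
    finally have "\<bar>a\<bar> ^ ?k \<le> 2 * norm w * norm ((T ^^ ?k) (h' s)) / \<bar>cross2 w (h' s)\<bar>"
      using s(2) by (simp add: field_simps)
    then have "\<bar>a\<bar> ^ ?k * norm w \<le> 2 * norm w * norm ((T ^^ ?k) (h' s)) / \<bar>cross2 w (h' s)\<bar> * norm w"
      by (intro mult_right_mono) auto
    then show ?thesis unfolding Tnw by (simp add: power_abs mult.commute mult.left_commute)
  qed
  obtain q u r z where q: "norm u = 1" "\<And>s. q + s *\<^sub>R u \<in> K" "\<And>i. z i \<in> (int_lattice :: (real^2) set)"
    "(\<lambda>i. (T ^^ ?n (r i)) (h s) + z i) \<longlonglongrightarrow> q"
    by (rule dominated_limit_line[OF K(1,3,4) T h(1) s(1) big nz dom]) (rule that)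
  have u0: "u \<noteq> 0" using q(1) by auto
  have "cross2 w u = 0" using u0 q(2) by (rule lines)
  have "(\<lambda>i. cross2 w ((T ^^ ?n (r i)) (h s) + z i) - y) \<longlonglongrightarrow> cross2 w q - y"
    by (intro tendsto_diff tendsto_const bounded_linear.tendsto[OF bounded_linear_cross2] q(4))
  moreover have "cross2 w ((T ^^ ?n (r k)) (h s) + z k) - y \<in> H" for k
  proof -
    have "cross2 w ((T ^^ ?n (r k)) (h s)) = a ^ (m * r k) * (a ^ N * cross2 w (h s))"
      unfolding wTn by (simp add: power_add)
    also have "\<dots> = a ^ (m * r k) * y + a ^ (m * r k) * (of_int i * D)"
      unfolding sy by (simp add: algebra_simps)
    finally have E: "cross2 w ((T ^^ ?n (r k)) (h s) + z k) - y =
        (a ^ (m * r k) * y - y) + a ^ (m * r k) * (of_int i * D) + cross2 w (z k)" by simp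
    have "cross2 w (z k) \<in> H" unfolding H_def using q(3) by (rule imageI)
    then show ?thesis unfolding E by (intro H_add yper H_mult H_D)
  qed
  ultimately have "cross2 w q - y \<in> H"
    by (rule closed_sequentially[OF \<open>closed H\<close>, rotated])
  then obtain z' where z': "z' \<in> int_lattice" "cross2 w q - y = cross2 w z'" unfolding H_def by blast
  have z0: "cross2 w (x2 + z' - q) = 0" using z'(2) x2(1) by simp
  obtain c where c: "u = c *\<^sub>R w" using \<open>cross2 w u = 0\<close> w(2) cross2_eq_0_imp by metis
  have "cross2 u (x2 + z' - q) = c * cross2 w (x2 + z' - q)" unfolding c by (rule cross2_linear(6))
  then have "cross2 u (x2 + z' - q) = 0" unfolding z0 by simp
  then obtain c' where "x2 + z' - q = c' *\<^sub>R u" using u0 cross2_eq_0_imp by metis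
  then have "x2 = (q + c' *\<^sub>R u) + (- z')" by (simp add: algebra_simps)
  then have "x2 \<in> K" using lattice_periodicD[OF K(3) q(2) int_lattice_minus[OF z'(1)]] by simp
  with x2(2) show False by simp
qed

text \<open>Two independent periodic directions, one of them spanned by an integer vector, would be
  eigendirections of a common power of \<open>A\<close> and diagonalize it. So the integer direction \<open>w\<close> is the only periodic
  one, all curves in the boundary are parallel to \<open>w\<close>, and independent tangents cannot exist.\<close>

lemma smooth_markov_imp_power_diagonalizable:
  fixes A :: "int^2^2"
  assumes exp: "expanding A" and M: "markov_partition (toral_endo A) \<M>" and sm: "smooth_partition \<M>"
  shows "\<exists>k>0. diagonalizable_integer_eigenvalues (mat_power A k)"
proof (rule ccontr)
  assume no: "\<not> ?thesis"
  define T where "T = (*v) (real_matrix A)"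
  have T: "linear T" unfolding T_def by (rule matrix_vector_mul_linear)
  let ?K = "covering_boundary \<M>"
  have K: "closed ?K" "?K \<noteq> UNIV" "lattice_periodic ?K" "T ` ?K \<subseteq> ?K"
    using closed_covering_boundary[OF M] covering_boundary_not_UNIV[OF M] lattice_periodic_covering_boundary
      covering_boundary_invariant[OF exp M] by (auto simp: T_def)
  obtain h h' a b t k k' c d s where h: "C1_curve_in ?K h h' a b" "t \<in> {a<..<b}"
    and k: "C1_curve_in ?K k k' c d" "s \<in> {c<..<d}" and ind: "cross2 (h' t) (k' s) \<noteq> 0"
    using two_independent_tangents[OF exp M sm] by (elim exE conjE)
  obtain w n where w: "w \<in> int_lattice" "w \<noteq> 0" "n > 0" "cross2 w ((T ^^ n) w) = 0"
    by (rule rational_periodic_direction[OF exp K(1,2,3) K(4)[unfolded T_def] h k ind])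
      (rule that, simp_all add: T_def)
  have unique: "cross2 w u = 0" if k: "k > 0" "cross2 u ((T ^^ k) u) = 0" for u k
  proof (rule ccontr)
    assume wu: "cross2 w u \<noteq> 0"
    have eig: "\<exists>c. (T ^^ (n * k)) x = c *\<^sub>R x" if x: "cross2 x ((T ^^ l) x) = 0" "x \<noteq> 0" "l dvd n * k" for x l
    proof -
      obtain c where c: "(T ^^ l) x = c *\<^sub>R x" using x cross2_eq_0_imp by metis
      obtain j where j: "n * k = l * j" using x(3) by (rule dvdE)
      have "((T ^^ l) ^^ j) x = c ^ j *\<^sub>R x"
        by (induction j) (simp_all add: c linear_scale[OF linear_funpow[OF T]] mult.commute)
      then show ?thesis unfolding j by (auto simp: funpow_mult mult.commute)
    qed
    have "u \<noteq> 0" using wu by auto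
    obtain c where c: "(T ^^ (n * k)) w = c *\<^sub>R w" using eig[OF w(4,2)] by auto
    obtain c' where c': "(T ^^ (n * k)) u = c' *\<^sub>R u" using eig[OF k(2) \<open>u \<noteq> 0\<close>] by auto
    have "diagonalizable_integer_eigenvalues (mat_power A (n * k))"
      using w(1) c c' wu unfolding T_def real_matrix_power[symmetric] by (rule diagonalizable_if_eigenbasis)
    moreover have "n * k > 0" using w(3) k(1) by simp
    ultimately show False using no by blast
  qed
  obtain \<mu> where l: "real_matrix A *v w = \<mu> *\<^sub>R w" "\<bar>\<mu>\<bar> > 1"
    "\<And>x. cross2 w (real_matrix A *v x) = \<mu> * cross2 w x"
  proof (rule unique_eigendirection_structure[OF exp w(2,3) w(4)[unfolded T_def]])
    show "cross2 w u = 0" if "k > 0" "cross2 u (((*v) (real_matrix A) ^^ k) u) = 0" for u k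
      using unique that unfolding T_def .
  qed (rule that)
  have lines: "cross2 w u = 0" if u: "u \<noteq> 0" "\<And>s. q + s *\<^sub>R u \<in> ?K" for q u
  proof -
    obtain k where "k > 0" "cross2 u ((T ^^ k) u) = 0"
      by (rule line_direction_periodic[OF exp K(1,2,3) K(4)[unfolded T_def] u]) (rule that, simp_all add: T_def)
    then show ?thesis by (rule unique)
  qed
  have trans: "cross2 w (f' x) = 0" if "C1_curve_in ?K f f' \<alpha> \<beta>" "x \<in> {\<alpha><..<\<beta>}" for f f' \<alpha> \<beta> x
  proof (rule no_transversal_curve[OF exp K(1,2,3) K(4)[unfolded T_def] w(1,2) l(1,2)])
    show "cross2 w (real_matrix A *v x) = \<mu> * cross2 w x" for x by (rule l(3))
    show "cross2 w u = 0" if "u \<noteq> 0" "\<And>s. q + s *\<^sub>R u \<in> ?K" for q u using that by (rule lines)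
  qed (fact that)+
  have "cross2 (h' t) (k' s) = 0"
    by (rule cross2_zero_trans[OF trans[OF h] trans[OF k] w(2)])
  with ind show False by simp
qed

section \<open>Partitions cut out by integer line arrangements\<close>

text \<open>A cell is given by one of its points, which encodes the integer parts of all covectors on the cell.
  For \<open>x\<close> on a line of the arrangement \<open>open_cell L x\<close> does not contain \<open>x\<close>; partitions are built from
  generic points only.\<close>

definition cell :: "(real^2) set \<Rightarrow> real^2 \<Rightarrow> (real^2) set" where
  "cell L x = {y. \<forall>l\<in>L. of_int \<lfloor>l \<bullet> x\<rfloor> \<le> l \<bullet> y \<and> l \<bullet> y \<le> of_int \<lfloor>l \<bullet> x\<rfloor> + 1}"

definition open_cell :: "(real^2) set \<Rightarrow> real^2 \<Rightarrow> (real^2) set" where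
  "open_cell L x = {y. \<forall>l\<in>L. of_int \<lfloor>l \<bullet> x\<rfloor> < l \<bullet> y \<and> l \<bullet> y < of_int \<lfloor>l \<bullet> x\<rfloor> + 1}"

definition generic :: "(real^2) set \<Rightarrow> (real^2) set" where
  "generic L = {x. \<forall>l\<in>L. l \<bullet> x \<notin> \<int>}"

definition cell_partition :: "(real^2) set \<Rightarrow> 2 torus set set" where
  "cell_partition L = (\<lambda>x. torus_proj ` cell L x) ` generic L"

text \<open>The bound \<open>1/2\<close> keeps distinct integer translates of a cell apart, so that \<open>torus_proj\<close> is injective on
  each cell.\<close>

locale integer_arrangement =
  fixes L :: "(real^2) set"
  assumes finite_L: "finite L" and L_int: "L \<subseteq> int_lattice" and L_nz: "0 \<notin> L"
    and small: "\<And>x. (\<forall>l\<in>L. \<bar>l \<bullet> x\<bar> \<le> 1) \<Longrightarrow> norm x < 1/2"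
begin

lemma inner_int: "l \<in> L \<Longrightarrow> z \<in> int_lattice \<Longrightarrow> l \<bullet> z \<in> \<int>"
  using L_int by (auto simp: inner_vec_def sum_2 int_lattice_def)

lemma floor_shift:
  assumes "l \<in> L" "z \<in> int_lattice"
  shows "real_of_int \<lfloor>l \<bullet> (x + z)\<rfloor> = of_int \<lfloor>l \<bullet> x\<rfloor> + l \<bullet> z"
proof -
  obtain k where "l \<bullet> z = of_int k" using inner_int[OF assms] by (auto elim: Ints_cases)
  then show ?thesis by (simp add: inner_add_right)
qed

lemma cell_shift: "z \<in> int_lattice \<Longrightarrow> y + z \<in> cell L (x + z) \<longleftrightarrow> y \<in> cell L x"
  unfolding cell_def by (simp add: floor_shift) (simp add: inner_add_right)

lemma open_cell_shift: "z \<in> int_lattice \<Longrightarrow> y + z \<in> open_cell L (x + z) \<longleftrightarrow> y \<in> open_cell L x"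
  unfolding open_cell_def by (simp add: floor_shift) (simp add: inner_add_right)

lemma proj_cell_shift:
  assumes z: "z \<in> int_lattice" shows "torus_proj ` cell L (x + z) = torus_proj ` cell L x"
proof -
  have sub: "torus_proj ` cell L (x + z) \<subseteq> torus_proj ` cell L x" if z: "z \<in> int_lattice" for x z
  proof
    fix p assume "p \<in> torus_proj ` cell L (x + z)"
    then obtain y where y: "y \<in> cell L (x + z)" "p = torus_proj y" by auto
    have "y + (- z) \<in> cell L (x + z + (- z))" using y(1) by (simp only: cell_shift[OF int_lattice_minus[OF z]])
    then have "y + (- z) \<in> cell L x" by simp
    moreover have "p = torus_proj (y + (- z))"
      unfolding y(2) by (rule torus_proj_add_lattice[OF int_lattice_minus[OF z], symmetric])
    ultimately show "p \<in> torus_proj ` cell L x" by blast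
  qed
  show ?thesis using sub[OF z, of x] sub[OF int_lattice_minus[OF z], of "x + z"] by simp
qed

lemma generic_mem_open_cell:
  assumes "x \<in> generic L" shows "x \<in> open_cell L x"
proof -
  have "of_int \<lfloor>l \<bullet> x\<rfloor> < l \<bullet> x" if "l \<in> L" for l
  proof -
    have "l \<bullet> x \<notin> \<int>" using assms that by (simp add: generic_def)
    then have "0 < frac (l \<bullet> x)" by (simp only: frac_gt_0_iff not_False_eq_True)
    then show ?thesis by (simp add: frac_def)
  qed
  then show ?thesis by (simp add: open_cell_def)
qed

lemma open_cell_floor:
  assumes "y \<in> open_cell L x" "l \<in> L" shows "\<lfloor>l \<bullet> y\<rfloor> = \<lfloor>l \<bullet> x\<rfloor>"
  using assms unfolding open_cell_def by (intro floor_unique) auto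

lemma open_cell_generic: "y \<in> open_cell L x \<Longrightarrow> y \<in> generic L"
proof -
  assume y: "y \<in> open_cell L x"
  have "l \<bullet> y \<notin> \<int>" if "l \<in> L" for l
  proof
    assume "l \<bullet> y \<in> \<int>"
    then obtain k where "l \<bullet> y = of_int k" by (auto elim: Ints_cases)
    then show False using y that unfolding open_cell_def by auto
  qed
  then show ?thesis by (simp add: generic_def)
qed

lemma open_cell_eq:
  assumes "y \<in> open_cell L x" shows "cell L y = cell L x" "open_cell L y = open_cell L x"
  using open_cell_floor[OF assms] by (auto simp: cell_def open_cell_def)

lemma open_cell_subset: "open_cell L x \<subseteq> cell L x"
  by (auto simp: cell_def open_cell_def intro: less_imp_le)

lemma open_slabs: "open {y. \<forall>l\<in>L. a l < l \<bullet> y \<and> l \<bullet> y < b l}"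
proof -
  have "{y. \<forall>l\<in>L. a l < l \<bullet> y \<and> l \<bullet> y < b l} = (\<Inter>l\<in>L. {y. a l < l \<bullet> y} \<inter> {y. l \<bullet> y < b l})" by auto
  also have "open \<dots>"
    by (intro open_INT finite_L ballI open_Int open_Collect_less continuous_intros)
  finally show ?thesis .
qed

lemma open_open_cell: "open (open_cell L x)"
  unfolding open_cell_def by (rule open_slabs)

lemma closed_cell: "closed (cell L x)"
proof -
  have "cell L x = (\<Inter>l\<in>L. {y. of_int \<lfloor>l \<bullet> x\<rfloor> \<le> l \<bullet> y} \<inter> {y. l \<bullet> y \<le> of_int \<lfloor>l \<bullet> x\<rfloor> + 1})"
    by (auto simp: cell_def)
  also have "closed \<dots>"
    by (intro closed_INT ballI closed_Int closed_Collect_le continuous_intros)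
  finally show ?thesis .
qed

lemma cell_diff_small:
  assumes "y \<in> cell L x" "y' \<in> cell L x" "l \<in> L" shows "\<bar>l \<bullet> (y - y')\<bar> \<le> 1"
proof -
  have "of_int \<lfloor>l \<bullet> x\<rfloor> \<le> l \<bullet> y" "l \<bullet> y \<le> of_int \<lfloor>l \<bullet> x\<rfloor> + 1"
    "of_int \<lfloor>l \<bullet> x\<rfloor> \<le> l \<bullet> y'" "l \<bullet> y' \<le> of_int \<lfloor>l \<bullet> x\<rfloor> + 1"
    using assms by (auto simp: cell_def)
  then show ?thesis by (simp add: inner_diff_right)
qed

lemma cell_norm_diff: "y \<in> cell L x \<Longrightarrow> y' \<in> cell L x \<Longrightarrow> norm (y - y') < 1/2"
  by (rule small) (blast intro: cell_diff_small)

lemma compact_cell: "compact (cell L x)"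
proof (cases "cell L x = {}")
  case False
  then obtain y where y: "y \<in> cell L x" by auto
  have "cell L x \<subseteq> cball y (1/2)"
  proof
    fix v assume "v \<in> cell L x"
    then show "v \<in> cball y (1/2)" using cell_norm_diff[OF y, of v] by (simp add: dist_norm)
  qed
  then show ?thesis using closed_cell bounded_cball bounded_subset compact_eq_bounded_closed by blast
qed simp

text \<open>Move from \<open>y\<close> towards the point \<open>x\<close> of the open cell.\<close>

lemma cell_subset_closure_open_cell:
  assumes "x \<in> generic L" shows "cell L x \<subseteq> closure (open_cell L x)"
proof
  fix y assume y: "y \<in> cell L x"
  have x: "x \<in> open_cell L x" by (rule generic_mem_open_cell) fact
  define f where "f n = y + inverse (real (Suc n)) *\<^sub>R (x - y)" for n
  have "f n \<in> open_cell L x" for n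
  proof -
    define s where "s = inverse (real (Suc n))"
    have s: "0 < s" "s \<le> 1" by (simp_all add: s_def inverse_le_1_iff)
    have "of_int \<lfloor>l \<bullet> x\<rfloor> < l \<bullet> f n \<and> l \<bullet> f n < of_int \<lfloor>l \<bullet> x\<rfloor> + 1" if l: "l \<in> L" for l
    proof -
      let ?k = "real_of_int \<lfloor>l \<bullet> x\<rfloor>"
      have yy: "?k \<le> l \<bullet> y" "l \<bullet> y \<le> ?k + 1" using y l by (auto simp: cell_def)
      have xx: "?k < l \<bullet> x" "l \<bullet> x < ?k + 1" using x l by (auto simp: open_cell_def)
      have f: "f n = y + s *\<^sub>R (x - y)" unfolding f_def s_def ..
      have e: "l \<bullet> f n = (1 - s) * (l \<bullet> y) + s * (l \<bullet> x)"
        unfolding f by (simp add: inner_add_right inner_diff_right algebra_simps)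
      have "(1 - s) * ?k \<le> (1 - s) * (l \<bullet> y)" "(1 - s) * (l \<bullet> y) \<le> (1 - s) * (?k + 1)"
        using s yy by (intro mult_left_mono; simp)+
      moreover have "s * ?k < s * (l \<bullet> x)" "s * (l \<bullet> x) < s * (?k + 1)"
        using s xx by (intro mult_strict_left_mono; simp)+
      ultimately show ?thesis unfolding e by (simp add: algebra_simps)
    qed
    then show ?thesis by (simp add: open_cell_def)
  qed
  then have fc: "f n \<in> closure (open_cell L x)" for n using closure_subset by blast
  have "f \<longlonglongrightarrow> y + 0 *\<^sub>R (x - y)"
    unfolding f_def by (intro tendsto_intros LIMSEQ_inverse_real_of_nat)
  then have "f \<longlonglongrightarrow> y" by simp
  then show "y \<in> closure (open_cell L x)" by (rule closed_sequentially[OF closed_closure fc])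
qed

text \<open>The complement of \<open>generic L\<close> is a countable union of lines.\<close>

lemma generic_dense:
  assumes "open U" "U \<noteq> {}" shows "\<exists>x\<in>U. x \<in> generic L"
proof (rule ccontr)
  assume "\<not> ?thesis"
  then have "U \<subseteq> (\<Union>(l, n)\<in>L \<times> (UNIV :: int set). {x. l \<bullet> x = of_int n})"
    by (fastforce simp: generic_def elim!: Ints_cases)
  moreover have "negligible (\<Union>(l, n)\<in>L \<times> (UNIV :: int set). {x. l \<bullet> x = of_int n})"
  proof (rule negligible_countable_Union)
    show "countable ((\<lambda>(l, n). {x. l \<bullet> x = of_int n}) ` (L \<times> (UNIV :: int set)))"
      by (intro countable_image countable_SIGMA countable_finite[OF finite_L]) auto
    fix S assume "S \<in> (\<lambda>(l, n). {x. l \<bullet> x = of_int n}) ` (L \<times> (UNIV :: int set))"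
    then obtain l n where "l \<in> L" "S = {x. l \<bullet> x = of_int (n::int)}" by auto
    then show "negligible S" using L_nz by (auto intro!: negligible_hyperplane)
  qed
  ultimately have "negligible U" using negligible_subset by blast
  then show False using open_not_negligible assms by blast
qed

lemma ex_generic_cell: "\<exists>y\<in>generic L. x \<in> cell L y"
proof -
  \<comment> \<open>On \<open>U\<close> the integer part of \<open>l \<bullet> y\<close> is that of \<open>l \<bullet> x\<close>, or it is one less and \<open>l \<bullet> x\<close> is an integer.\<close>
  define U where "U = {y. \<forall>l\<in>L. of_int \<lceil>l \<bullet> x\<rceil> - 1 < l \<bullet> y \<and> l \<bullet> y < of_int \<lfloor>l \<bullet> x\<rfloor> + 1}"
  have "x \<in> U" unfolding U_def by (auto intro: ceiling_correct[THEN conjunct1])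
  then have "U \<noteq> {}" by blast
  moreover have "open U" unfolding U_def by (rule open_slabs)
  ultimately obtain y where y: "y \<in> U" "y \<in> generic L" using generic_dense by blast
  have "of_int \<lfloor>l \<bullet> y\<rfloor> \<le> l \<bullet> x \<and> l \<bullet> x \<le> of_int \<lfloor>l \<bullet> y\<rfloor> + 1" if "l \<in> L" for l
  proof -
    have a: "of_int \<lceil>l \<bullet> x\<rceil> - 1 < l \<bullet> y" "l \<bullet> y < of_int \<lfloor>l \<bullet> x\<rfloor> + 1"
      using y(1) that unfolding U_def by blast+
    have "\<lfloor>l \<bullet> y\<rfloor> \<le> \<lfloor>l \<bullet> x\<rfloor>" using a(2) by linarith
    moreover have "\<lceil>l \<bullet> x\<rceil> - 1 \<le> \<lfloor>l \<bullet> y\<rfloor>" using a(1) by (simp add: le_floor_iff)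
    ultimately show ?thesis by linarith
  qed
  then show ?thesis using y(2) by (auto simp: cell_def)
qed

text \<open>Near a point \<open>y\<close> of the cell whose projection is interior, every point projects into the projected cell and
  therefore, translates of the cell being far away, lies in the cell itself. On the boundary of
  the cell a small step along or against a covector \<open>l\<close> would leave the cell.\<close>

lemma interior_proj_cell: "interior (torus_proj ` cell L x) = torus_proj ` open_cell L x"
proof
  show "torus_proj ` open_cell L x \<subseteq> interior (torus_proj ` cell L x)"
    by (intro interior_maximal image_mono open_cell_subset open_torus_proj_image open_open_cell)
  show "interior (torus_proj ` cell L x) \<subseteq> torus_proj ` open_cell L x"
  proof
    fix p assume p: "p \<in> interior (torus_proj ` cell L x)"
    then have "p \<in> torus_proj ` cell L x" using interior_subset by blast
    then obtain y where y: "y \<in> cell L x" "p = torus_proj y" by auto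
    have "open (torus_proj -` interior (torus_proj ` cell L x))"
      by (intro open_vimage continuous_on_torus_proj open_interior)
    then have "open (torus_proj -` interior (torus_proj ` cell L x) \<inter> ball y (1/2))" by (intro open_Int) auto
    moreover have "y \<in> torus_proj -` interior (torus_proj ` cell L x) \<inter> ball y (1/2)" using p y by simp
    ultimately obtain d where d: "d > 0" "ball y d \<subseteq> torus_proj -` interior (torus_proj ` cell L x) \<inter> ball y (1/2)"
      by (rule openE)
    have inc: "v \<in> cell L x" if v: "v \<in> ball y d" for v
    proof -
      have "torus_proj v \<in> torus_proj ` cell L x" using v d(2) interior_subset by blast
      then obtain c where c: "c \<in> cell L x" "torus_proj v = torus_proj c" by auto
      have lat: "v - c \<in> int_lattice" using c(2) by (simp add: torus_proj_eq_lattice)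
      have "norm (v - c) \<le> norm (v - y) + norm (y - c)" by (metis add_diff_eq diff_add_cancel norm_triangle_ineq)
      moreover have "v \<in> ball y (1/2)" using v d(2) by blast
      then have "norm (v - y) < 1/2" by (simp add: dist_norm norm_minus_commute)
      ultimately have "norm (v - c) < 1" using cell_norm_diff[OF y(1) c(1)] by linarith
      then have "v - c = 0" by (rule int_lattice_norm_less_1[OF lat])
      then show ?thesis using c(1) by simp
    qed
    have "y \<in> open_cell L x"
    proof (rule ccontr)
      assume "y \<notin> open_cell L x"
      then obtain l where l: "l \<in> L" "\<not> (of_int \<lfloor>l \<bullet> x\<rfloor> < l \<bullet> y \<and> l \<bullet> y < of_int \<lfloor>l \<bullet> x\<rfloor> + 1)"
        by (auto simp: open_cell_def)
      define s where "s = (if of_int \<lfloor>l \<bullet> x\<rfloor> < l \<bullet> y then 1 else - 1) * (d / (2 * norm l))"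
      have l0: "l \<noteq> 0" using l(1) L_nz by auto
      have "y + s *\<^sub>R l \<in> ball y d" using d(1) l0 by (simp add: dist_norm s_def abs_mult)
      then have c: "y + s *\<^sub>R l \<in> cell L x" by (rule inc)
      have "l \<bullet> (y + s *\<^sub>R l) = l \<bullet> y + s * (l \<bullet> l)" by (simp add: inner_add_right)
      moreover have "l \<bullet> l > 0" using l0 by simp
      moreover have "of_int \<lfloor>l \<bullet> x\<rfloor> \<le> l \<bullet> y" "l \<bullet> y \<le> of_int \<lfloor>l \<bullet> x\<rfloor> + 1" using y(1) l(1) by (auto simp: cell_def)
      moreover have "of_int \<lfloor>l \<bullet> x\<rfloor> \<le> l \<bullet> (y + s *\<^sub>R l)" "l \<bullet> (y + s *\<^sub>R l) \<le> of_int \<lfloor>l \<bullet> x\<rfloor> + 1"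
        using c l(1) by (auto simp: cell_def)
      moreover have "d / (2 * norm l) > 0" using d(1) l0 by simp
      then have "d / (2 * norm l) * (l \<bullet> l) > 0" using \<open>l \<bullet> l > 0\<close> by (rule mult_pos_pos)
      ultimately show False using l(2) by (auto simp: s_def split: if_splits)
    qed
    then show "p \<in> torus_proj ` open_cell L x" using y by blast
  qed
qed

lemma proper_proj_cell:
  assumes x: "x \<in> generic L" shows "proper_set (torus_proj ` cell L x)"
  unfolding proper_set_def interior_proj_cell
proof (intro conjI equalityI)
  have "compact (torus_proj ` cell L x)"
    by (rule compact_continuous_image[OF continuous_on_torus_proj compact_cell])
  then show "closure (torus_proj ` open_cell L x) \<subseteq> torus_proj ` cell L x"
    by (intro closure_minimal image_mono open_cell_subset compact_imp_closed)
  have "torus_proj ` closure (open_cell L x) \<subseteq> closure (torus_proj ` open_cell L x)"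
    by (rule image_closure_subset[OF continuous_on_torus_proj closed_closure closure_subset])
  then show "torus_proj ` cell L x \<subseteq> closure (torus_proj ` open_cell L x)"
    using cell_subset_closure_open_cell[OF x] by blast
  show "torus_proj ` cell L x \<noteq> {}"
    using generic_mem_open_cell[OF x] open_cell_subset by blast
qed

lemma norm_unit_square_le: "x \<in> cbox 0 1 \<Longrightarrow> norm (x :: real^2) \<le> 2"
  using norm_le_l1_cart[of x] by (auto simp: mem_box_cart sum_2 forall_2)

lemma inner_unit_square_le: "x \<in> cbox 0 1 \<Longrightarrow> \<bar>l \<bullet> x\<bar> \<le> 2 * norm (l :: real^2)"
proof -
  assume "x \<in> cbox 0 1"
  then have "norm l * norm x \<le> norm l * 2" by (intro mult_left_mono norm_unit_square_le) auto
  then show ?thesis using Cauchy_Schwarz_ineq2[of l x] by linarith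
qed

text \<open>Up to integer translation a cell has its defining point in the unit square, where the integer parts of the
  covectors take finitely many values.\<close>

lemma finite_cell_partition: "finite (cell_partition L)"
proof -
  define B where "B = (\<Sum>l\<in>L. 2 * norm l)"
  let ?I = "{- \<lceil>B\<rceil> - 1..\<lceil>B\<rceil> + 1}"
  let ?F = "{f. \<forall>l. (l \<in> L \<longrightarrow> f l \<in> ?I) \<and> (l \<notin> L \<longrightarrow> f l = 0)}"
  let ?G = "\<lambda>f. torus_proj ` {y. \<forall>l\<in>L. real_of_int (f l) \<le> l \<bullet> y \<and> l \<bullet> y \<le> of_int (f l) + 1}"
  have "cell_partition L \<subseteq> ?G ` ?F"
  proof
    fix R assume "R \<in> cell_partition L"
    then obtain x where x: "R = torus_proj ` cell L x" by (auto simp: cell_partition_def)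
    obtain z where z: "z \<in> int_lattice" "x + z \<in> cbox 0 1" by (rule lattice_reduce)
    define f where "f l = (if l \<in> L then \<lfloor>l \<bullet> (x + z)\<rfloor> else 0)" for l
    have "f l \<in> ?I" if l: "l \<in> L" for l
    proof -
      have "2 * norm l \<le> B" unfolding B_def using finite_L l by (intro member_le_sum) auto
      then have "\<bar>l \<bullet> (x + z)\<bar> \<le> B" using inner_unit_square_le[OF z(2), of l] by linarith
      then show ?thesis using l by (simp add: f_def) linarith
    qed
    then have "f \<in> ?F" by (auto simp: f_def)
    moreover have "R = ?G f"
    proof -
      have "R = torus_proj ` cell L (x + z)" unfolding x by (rule proj_cell_shift[OF z(1), symmetric])
      also have "cell L (x + z) = {y. \<forall>l\<in>L. real_of_int (f l) \<le> l \<bullet> y \<and> l \<bullet> y \<le> of_int (f l) + 1}"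
        by (auto simp: cell_def f_def)
      finally show ?thesis .
    qed
    ultimately show "R \<in> ?G ` ?F" by blast
  qed
  moreover have "finite ?F" by (intro finite_set_of_finite_funs finite_L) auto
  ultimately show ?thesis by (meson finite_surj)
qed

lemma Union_cell_partition: "\<Union> (cell_partition L) = UNIV"
proof -
  have "p \<in> \<Union> (cell_partition L)" for p
  proof (cases p)
    case (1 x)
    obtain y where "y \<in> generic L" "x \<in> cell L y" using ex_generic_cell by blast
    then show ?thesis unfolding 1 cell_partition_def by blast
  qed
  then show ?thesis by (intro equalityI subsetI UNIV_I)
qed

lemma proj_open_cells_meet:
  assumes "u \<in> open_cell L x" "u' \<in> open_cell L x'" "torus_proj u = torus_proj u'"
  shows "torus_proj ` cell L x = torus_proj ` cell L x'"
proof -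
  have z: "u' - u \<in> int_lattice" using assms(3) by (metis torus_proj_eq_lattice)
  have "torus_proj ` cell L x' = torus_proj ` cell L (u + (u' - u))" using open_cell_eq[OF assms(2)] by simp
  also have "\<dots> = torus_proj ` cell L u" by (rule proj_cell_shift[OF z])
  finally show ?thesis using open_cell_eq[OF assms(1)] by simp
qed

lemma pairwise_cell_partition: "pairwise (\<lambda>R R'. interior R \<inter> interior R' = {}) (cell_partition L)"
proof (rule pairwiseI, rule ccontr)
  fix R R' assume R: "R \<in> cell_partition L" "R' \<in> cell_partition L" "R \<noteq> R'" "interior R \<inter> interior R' \<noteq> {}"
  obtain x x' where x: "R = torus_proj ` cell L x" "R' = torus_proj ` cell L x'"
    using R(1,2) by (auto simp: cell_partition_def)
  obtain p where "p \<in> torus_proj ` open_cell L x" "p \<in> torus_proj ` open_cell L x'"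
    using R(4) unfolding x interior_proj_cell by blast
  then obtain u u' where "u \<in> open_cell L x" "u' \<in> open_cell L x'" "torus_proj u = torus_proj u'" by auto
  then have "R = R'" unfolding x by (rule proj_open_cells_meet)
  with R(3) show False by simp
qed

lemma interior_cells_eq_generic: "(\<Union>R\<in>cell_partition L. interior R) = torus_proj ` generic L"
proof
  show "(\<Union>R\<in>cell_partition L. interior R) \<subseteq> torus_proj ` generic L"
    using open_cell_generic by (auto simp: cell_partition_def interior_proj_cell)
  show "torus_proj ` generic L \<subseteq> (\<Union>R\<in>cell_partition L. interior R)"
    using generic_mem_open_cell unfolding cell_partition_def by (force simp: interior_proj_cell)
qed

lemma generic_shift: "z \<in> int_lattice \<Longrightarrow> x \<in> generic L \<Longrightarrow> x + z \<in> generic L"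
  using generic_mem_open_cell open_cell_generic open_cell_shift by blast

lemma partition_boundary_cell_partition:
  "partition_boundary (cell_partition L) = torus_proj ` {x. \<exists>l\<in>L. l \<bullet> x \<in> \<int>}"
proof -
  have "partition_boundary (cell_partition L) = - torus_proj ` generic L"
    unfolding interior_cells_eq_generic[symmetric]
    by (rule partition_boundary_eq[OF Union_cell_partition _ pairwise_cell_partition])
      (auto simp: cell_partition_def proper_proj_cell)
  also have "\<dots> = torus_proj ` (- generic L)"
  proof (intro equalityI subsetI)
    fix p assume "p \<in> - torus_proj ` generic L"
    then show "p \<in> torus_proj ` (- generic L)" by (cases p) auto
  next
    fix p assume "p \<in> torus_proj ` (- generic L)"
    then obtain x where x: "x \<notin> generic L" "p = torus_proj x" by auto
    show "p \<in> - torus_proj ` generic L"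
    proof
      assume "p \<in> torus_proj ` generic L"
      then obtain y where y: "y \<in> generic L" "torus_proj x = torus_proj y" unfolding x(2) by (rule imageE) simp
      have "x - y \<in> int_lattice" using y(2) by (simp add: torus_proj_eq_lattice)
      then have "y + (x - y) \<in> generic L" using y(1) by (rule generic_shift)
      with x(1) show False by simp
    qed
  qed
  also have "- generic L = {x. \<exists>l\<in>L. l \<bullet> x \<in> \<int>}" by (auto simp: generic_def)
  finally show ?thesis .
qed

text \<open>Up to integer translation a point of the boundary lies in the unit square and on a line
  \<open>l \<bullet> x = n\<close> with \<open>\<bar>n\<bar> \<le> 2 * norm l\<close>. The part of this line in the unit square is contained in the
  segment of half-length \<open>4 * norm l\<close> around the point of the line nearest to the origin.\<close>

lemma linear_cell_partition: "linear_partition (cell_partition L)"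
proof -
  define c where "c l n = (real_of_int n / (l \<bullet> l)) *\<^sub>R l" for l :: "real^2" and n
  define S where "S = (\<Union>l\<in>L. (\<lambda>n. (c l n - 4 *\<^sub>R perp l, c l n + 4 *\<^sub>R perp l)) ` {- \<lceil>2 * norm l\<rceil>..\<lceil>2 * norm l\<rceil>})"
  have l0: "l \<noteq> 0" "l \<bullet> l > 0" "norm l \<ge> 1" if "l \<in> L" for l
  proof -
    show "l \<noteq> 0" using that L_nz by auto
    then show "l \<bullet> l > 0" by simp
    show "norm l \<ge> 1" using \<open>l \<noteq> 0\<close> int_lattice_norm_less_1 that L_int by (meson not_le subsetD)
  qed
  have perp0: "perp l \<noteq> 0" if "l \<in> L" for l
    using l0(1)[OF that] by (auto simp: perp_def vec_eq_iff forall_2)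
  have lc: "l \<bullet> c l n = of_int n" if "l \<in> L" for l n
    using l0(2)[OF that] by (simp add: c_def)
  have "finite S" unfolding S_def using finite_L by auto
  moreover have "\<forall>(a, b)\<in>S. a \<noteq> b"
  proof -
    have "c l n - 4 *\<^sub>R perp l \<noteq> c l n + 4 *\<^sub>R perp l" if "l \<in> L" for l n
    proof
      assume "c l n - 4 *\<^sub>R perp l = c l n + 4 *\<^sub>R perp l"
      then have "8 *\<^sub>R perp l = 0" by (simp add: algebra_simps scaleR_add_left[symmetric])
      then show False using perp0[OF that] by simp
    qed
    then show ?thesis by (auto simp: S_def)
  qed
  moreover have "torus_proj ` {x. \<exists>l\<in>L. l \<bullet> x \<in> \<int>} = (\<Union>(a, b)\<in>S. torus_proj ` closed_segment a b)"
  proof (intro equalityI subsetI)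
    fix p assume "p \<in> torus_proj ` {x. \<exists>l\<in>L. l \<bullet> x \<in> \<int>}"
    then obtain y l where y: "p = torus_proj y" "l \<in> L" "l \<bullet> y \<in> \<int>" by auto
    obtain z where z: "z \<in> int_lattice" "y + z \<in> cbox 0 1" by (rule lattice_reduce)
    define x where "x = y + z"
    have "l \<bullet> x \<in> \<int>" unfolding x_def inner_add_right using y(3) inner_int[OF y(2) z(1)] by (rule Ints_add)
    then obtain n where n: "l \<bullet> x = of_int n" by (auto elim: Ints_cases)
    have "\<bar>l \<bullet> x\<bar> \<le> 2 * norm l" using z(2) unfolding x_def by (rule inner_unit_square_le)
    then have nI: "n \<in> {- \<lceil>2 * norm l\<rceil>..\<lceil>2 * norm l\<rceil>}" unfolding n by simp linarith
    define s where "s = cross2 l x / (l \<bullet> l)"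
    have "(l \<bullet> l) *\<^sub>R x = (l \<bullet> x) *\<^sub>R l + cross2 l x *\<^sub>R perp l"
      by (simp add: vec_eq_iff forall_2 perp_def cross2_def inner_vec_def sum_2 algebra_simps)
    then have "(1 / (l \<bullet> l)) *\<^sub>R ((l \<bullet> l) *\<^sub>R x) = c l n + s *\<^sub>R perp l"
      by (simp add: c_def s_def n scaleR_add_right)
    then have xs: "x = c l n + s *\<^sub>R perp l" using l0(2)[OF y(2)] by simp
    have "\<bar>cross2 l x\<bar> \<le> 2 * norm l * norm x" by (rule abs_cross2_le)
    also have "\<dots> \<le> 2 * norm l * 2"
      using z(2) unfolding x_def by (intro mult_left_mono norm_unit_square_le) auto
    also have "\<dots> \<le> 4 * (l \<bullet> l)"
      using mult_left_mono[OF l0(3)[OF y(2)], of "norm l"] by (simp add: dot_square_norm power2_eq_square)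
    finally have "\<bar>s\<bar> \<le> 4" using l0(2)[OF y(2)] by (simp add: s_def abs_divide field_simps)
    then have "x \<in> closed_segment (c l n - 4 *\<^sub>R perp l) (c l n + 4 *\<^sub>R perp l)"
      unfolding in_segment
    proof (intro exI[of _ "(s + 4) / 8"] conjI)
      show "x = (1 - (s + 4) / 8) *\<^sub>R (c l n - 4 *\<^sub>R perp l) + ((s + 4) / 8) *\<^sub>R (c l n + 4 *\<^sub>R perp l)"
        unfolding xs by (simp add: vec_eq_iff field_simps)
    qed auto
    moreover have "p = torus_proj x" using y(1) z(1) by (simp add: x_def)
    ultimately show "p \<in> (\<Union>(a, b)\<in>S. torus_proj ` closed_segment a b)"
      using y(2) nI unfolding S_def by blast
  next
    fix p assume "p \<in> (\<Union>(a, b)\<in>S. torus_proj ` closed_segment a b)"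
    then obtain l n x where x: "l \<in> L" "p = torus_proj x"
      "x \<in> closed_segment (c l n - 4 *\<^sub>R perp l) (c l n + 4 *\<^sub>R perp l)"
      unfolding S_def by auto
    obtain u where u: "x = (1 - u) *\<^sub>R (c l n - 4 *\<^sub>R perp l) + u *\<^sub>R (c l n + 4 *\<^sub>R perp l)"
      using x(3) by (auto simp: in_segment)
    have "x = c l n + (8 * u - 4) *\<^sub>R perp l" unfolding u by (simp add: vec_eq_iff algebra_simps)
    then have "l \<bullet> x = of_int n" by (simp add: inner_add_right lc[OF x(1)])
    then have "l \<bullet> x \<in> \<int>" by simp
    then show "p \<in> torus_proj ` {x. \<exists>l\<in>L. l \<bullet> x \<in> \<int>}" using x(1,2) by blast
  qed
  ultimately show ?thesis
    unfolding linear_partition_def partition_boundary_cell_partition by blast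
qed

end

section \<open>Cell partitions that are Markov\<close>

text \<open>The last assumption says that \<open>T\<close> maps the lines of the arrangement into lines of the arrangement:
  if \<open>l \<bullet> x\<close> is an integer, so is \<open>l' \<bullet> T x\<close>.\<close>

locale invariant_arrangement = integer_arrangement L for L :: "(real^2) set" +
  fixes A :: "int^2^2"
  assumes exp: "expanding A"
    and small_image: "\<And>x. (\<forall>l\<in>L. \<bar>l \<bullet> x\<bar> \<le> 1) \<Longrightarrow> norm (real_matrix A *v x) < 1/2"
    and forward: "\<And>l. l \<in> L \<Longrightarrow> \<exists>l'\<in>L. \<exists>m::int. \<forall>x. l' \<bullet> (real_matrix A *v x) = of_int m * (l \<bullet> x)"
begin

text \<open>The images of \<open>u\<close> and \<open>c\<close> lie in the same open cell. No line of the arrangement separates \<open>u\<close> from \<open>c\<close>,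
  since its image would be contained in a line that separates their images.\<close>

lemma preimage_in_open_cell:
  assumes u: "u \<in> generic L" "real_matrix A *v u \<in> generic L"
    and c: "real_matrix A *v c \<in> open_cell L (real_matrix A *v u)"
  shows "c \<in> open_cell L u"
proof -
  have "of_int \<lfloor>l \<bullet> u\<rfloor> < l \<bullet> c \<and> l \<bullet> c < of_int \<lfloor>l \<bullet> u\<rfloor> + 1" if l: "l \<in> L" for l
  proof (rule ccontr)
    assume not: "\<not> ?thesis"
    obtain l' m where l': "l' \<in> L" and m: "\<And>x. l' \<bullet> (real_matrix A *v x) = of_int m * (l \<bullet> x)"
      using forward[OF l] by blast
    define n where "n = \<lfloor>l' \<bullet> (real_matrix A *v u)\<rfloor>"
    have uo: "u \<in> open_cell L u" "real_matrix A *v u \<in> open_cell L (real_matrix A *v u)"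
      using u by (auto intro: generic_mem_open_cell)
    have n1: "of_int n < of_int m * (l \<bullet> u)" "of_int m * (l \<bullet> u) < of_int n + 1"
      using uo(2) l' unfolding m[symmetric] n_def open_cell_def by auto
    have n2: "of_int n < of_int m * (l \<bullet> c)" "of_int m * (l \<bullet> c) < of_int n + 1"
      using c l' unfolding m[symmetric] n_def open_cell_def by auto
    have k: "of_int \<lfloor>l \<bullet> u\<rfloor> < l \<bullet> u" "l \<bullet> u < of_int \<lfloor>l \<bullet> u\<rfloor> + 1"
      using uo(1) l by (auto simp: open_cell_def)
    \<comment> \<open>An integer separating \<open>l \<bullet> u\<close> from \<open>l \<bullet> c\<close> would give, multiplied by \<open>m\<close>, an integer
      strictly between \<open>n\<close> and \<open>n + 1\<close>.\<close>
    obtain j :: int where j: "(l \<bullet> c \<le> of_int j \<and> of_int j \<le> l \<bullet> u) \<or> (l \<bullet> u \<le> of_int j \<and> of_int j \<le> l \<bullet> c)"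
    proof (cases "l \<bullet> c \<le> of_int \<lfloor>l \<bullet> u\<rfloor>")
      case True
      then show ?thesis using k by (intro that[of "\<lfloor>l \<bullet> u\<rfloor>"]) auto
    next
      case False
      then have "of_int (\<lfloor>l \<bullet> u\<rfloor> + 1) \<le> l \<bullet> c" using not by auto
      then show ?thesis using k by (intro that[of "\<lfloor>l \<bullet> u\<rfloor> + 1"]) auto
    qed
    have "real_of_int n < of_int (m * j) \<and> real_of_int (m * j) < of_int n + 1"
    proof (cases "m \<ge> 0")
      case True
      then have m0: "real_of_int m \<ge> 0" by simp
      from j show ?thesis
      proof
        assume "l \<bullet> c \<le> of_int j \<and> of_int j \<le> l \<bullet> u"
        then have "real_of_int m * (l \<bullet> c) \<le> of_int m * of_int j" "real_of_int m * of_int j \<le> of_int m * (l \<bullet> u)"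
          using m0 by (auto intro: mult_left_mono)
        then show ?thesis using n1 n2 by simp
      next
        assume "l \<bullet> u \<le> of_int j \<and> of_int j \<le> l \<bullet> c"
        then have "real_of_int m * (l \<bullet> u) \<le> of_int m * of_int j" "real_of_int m * of_int j \<le> of_int m * (l \<bullet> c)"
          using m0 by (auto intro: mult_left_mono)
        then show ?thesis using n1 n2 by simp
      qed
    next
      case False
      then have m0: "real_of_int m \<le> 0" by simp
      from j show ?thesis
      proof
        assume "l \<bullet> c \<le> of_int j \<and> of_int j \<le> l \<bullet> u"
        then have "real_of_int m * (l \<bullet> u) \<le> of_int m * of_int j" "real_of_int m * of_int j \<le> of_int m * (l \<bullet> c)"
          using m0 by (auto intro: mult_left_mono_neg)
        then show ?thesis using n1 n2 by simp
      next
        assume "l \<bullet> u \<le> of_int j \<and> of_int j \<le> l \<bullet> c"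
        then have "real_of_int m * (l \<bullet> c) \<le> of_int m * of_int j" "real_of_int m * of_int j \<le> of_int m * (l \<bullet> u)"
          using m0 by (auto intro: mult_left_mono_neg)
        then show ?thesis using n1 n2 by simp
      qed
    qed
    then have "n < m * j" "m * j < n + 1" by linarith+
    then show False by linarith
  qed
  then show ?thesis by (simp add: open_cell_def)
qed

text \<open>Existence of the preimage is \<open>preimage_in_open_cell\<close>, after a translation that turns the target
  cell into the one around the image of \<open>u\<close>. Uniqueness holds because images of cells have diameter less
  than \<open>1\<close>.\<close>

lemma markov_property_cell_partition: "markov_property (toral_endo A) (cell_partition L)"
  unfolding markov_property_def
proof (intro ballI impI)
  fix R R' y assume R: "R \<in> cell_partition L" "R' \<in> cell_partition L"
    and meet: "toral_endo A ` interior R \<inter> interior R' \<noteq> {}" and y: "y \<in> interior R'"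
  let ?M = "real_matrix A"
  obtain x x' where x: "R = torus_proj ` cell L x" "R' = torus_proj ` cell L x'"
    using R by (auto simp: cell_partition_def)
  obtain p where p: "p \<in> interior R" "toral_endo A p \<in> interior R'" using meet by blast
  obtain u where u: "u \<in> open_cell L x" "p = torus_proj u" using p(1) unfolding x interior_proj_cell by auto
  obtain v where v: "v \<in> open_cell L x'" "torus_proj (?M *v u) = torus_proj v"
    using p(2) unfolding x interior_proj_cell u(2) toral_endo_proj by auto
  define z where "z = ?M *v u - v"
  have z: "z \<in> int_lattice" using v(2) by (simp only: z_def torus_proj_eq_lattice)
  have Mu: "?M *v u = v + z" by (simp add: z_def)
  have Mug: "?M *v u \<in> generic L" unfolding Mu using z open_cell_generic[OF v(1)] by (rule generic_shift)
  have ug: "u \<in> generic L" using open_cell_generic[OF u(1)] .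
  obtain b where b: "b \<in> open_cell L x'" "y = torus_proj b" using y unfolding x interior_proj_cell by auto
  have "b + z \<in> open_cell L (?M *v u)"
    unfolding Mu open_cell_shift[OF z] using b(1) open_cell_eq(2)[OF v(1)] by simp
  moreover obtain c where c: "?M *v c = b + z" using expanding_surj[OF exp] by blast
  ultimately have "c \<in> open_cell L u" using preimage_in_open_cell[OF ug Mug, of c] by simp
  then have cR: "torus_proj c \<in> R"
    unfolding x using open_cell_subset open_cell_eq[OF u(1)] by blast
  have fc: "toral_endo A (torus_proj c) = y" unfolding toral_endo_proj c b(2) using z by simp
  have uniq: "q = torus_proj c" if q: "q \<in> R" "toral_endo A q = y" for q
  proof -
    obtain a where a: "a \<in> cell L x" "q = torus_proj a" using q(1) unfolding x by auto
    obtain c' where c': "c' \<in> cell L x" "torus_proj c = torus_proj c'" using cR unfolding x by auto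
    have "torus_proj (?M *v a) = torus_proj (?M *v c')"
      using q(2) fc unfolding a(2) c'(2) toral_endo_proj by simp
    then have "?M *v a - ?M *v c' \<in> int_lattice" by (simp only: torus_proj_eq_lattice)
    then have lat: "?M *v (a - c') \<in> int_lattice" by (simp only: matrix_vector_mult_diff_distrib)
    have "norm (?M *v (a - c')) < 1/2"
      by (rule small_image) (use cell_diff_small[OF a(1) c'(1)] in blast)
    then have "?M *v (a - c') = 0" by (intro int_lattice_norm_less_1[OF lat]) simp
    then have "?M *v a = ?M *v c'" by (simp only: matrix_vector_mult_diff_distrib right_minus_eq)
    then have "a = c'" by (rule expanding_inj[OF exp])
    then show ?thesis using a c' by simp
  qed
  show "\<exists>!x. x \<in> R \<and> toral_endo A x = y"
  proof (rule ex1I)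
    show "torus_proj c \<in> R \<and> toral_endo A (torus_proj c) = y" by (intro conjI cR fc)
    show "q = torus_proj c" if "q \<in> R \<and> toral_endo A q = y" for q
      using that by (elim conjE) (rule uniq)
  qed
qed

text \<open>Let \<open>a\<close> and \<open>a'\<close> be lifts, in one cell, of two points with the same itinerary. By induction
  the iterates of \<open>a\<close> and \<open>a'\<close> stay in a common translate of a cell: their difference is an
  integer vector plus a short vector, and it is short itself as the image of a short vector, so the integer
  vector is \<open>0\<close>. A bounded orbit of \<open>a - a'\<close> forces \<open>a = a'\<close>.\<close>

lemma metrically_generating_cell_partition: "metrically_generating (toral_endo A) (cell_partition L)"
  unfolding metrically_generating_def
proof (intro allI impI)
  fix X :: "nat \<Rightarrow> 2 torus set" assume X: "\<forall>k. X k \<in> cell_partition L"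
  let ?M = "real_matrix A" and ?f = "toral_endo A"
  let ?T = "\<lambda>n. (*v) ?M ^^ n"
  let ?I = "\<Inter>k. (?f ^^ k) -` interior (X k)"
  have "p = p'" if p: "p \<in> ?I" "p' \<in> ?I" for p p'
  proof -
    have "\<exists>y. X k = torus_proj ` cell L y" for k
      using spec[OF X, of k] unfolding cell_partition_def by (elim imageE) (rule exI)
    then have "\<exists>x. \<forall>k. X k = torus_proj ` cell L (x k)" by (intro choice allI)
    then obtain x where "\<forall>k. X k = torus_proj ` cell L (x k)" by (rule exE)
    then have x: "X k = torus_proj ` cell L (x k)" for k by (rule spec)
    have in_cell: "\<exists>b b'. b \<in> cell L (x k) \<and> b' \<in> cell L (x k) \<and> (?f ^^ k) p = torus_proj b \<and> (?f ^^ k) p' = torus_proj b'" for k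
    proof -
      have "(?f ^^ k) p \<in> X k" "(?f ^^ k) p' \<in> X k" using p interior_subset by blast+
      then show ?thesis unfolding x by blast
    qed
    obtain a a' where a: "a \<in> cell L (x 0)" "a' \<in> cell L (x 0)" "p = torus_proj a" "p' = torus_proj a'"
      using in_cell[of 0] by auto
    have diff: "?T k a - ?T k a' = ?T k (a - a')" for k
      by (rule linear_diff[OF linear_funpow[OF matrix_vector_mul_linear], symmetric])
    have bounded: "\<forall>l\<in>L. \<bar>l \<bullet> ?T k (a - a')\<bar> \<le> 1" for k
    proof (induction k)
      case 0
      then show ?case using cell_diff_small[OF a(1,2)] by simp
    next
      case (Suc k)
      let ?v = "?T (Suc k) (a - a')"
      obtain b b' where b: "b \<in> cell L (x (Suc k))" "b' \<in> cell L (x (Suc k))"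
        "(?f ^^ Suc k) p = torus_proj b" "(?f ^^ Suc k) p' = torus_proj b'" using in_cell by blast
      have "torus_proj (?T (Suc k) a) = torus_proj b" "torus_proj (?T (Suc k) a') = torus_proj b'"
        using b(3,4) unfolding a(3,4) toral_endo_funpow_proj .
      then have "?T (Suc k) a - b \<in> int_lattice" "?T (Suc k) a' - b' \<in> int_lattice"
        unfolding torus_proj_eq_lattice .
      then have "(?T (Suc k) a - b) - (?T (Suc k) a' - b') \<in> int_lattice" by (rule int_lattice_diff)
      also have "(?T (Suc k) a - b) - (?T (Suc k) a' - b') = ?v - (b - b')"
        unfolding diff[symmetric] by (simp only: algebra_simps)
      finally have lat: "?v - (b - b') \<in> int_lattice" .
      have "norm ?v < 1/2" using small_image[OF Suc] by simp
      moreover have "norm (b - b') < 1/2" using b by (intro cell_norm_diff)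
      moreover have "norm (?v - (b - b')) \<le> norm ?v + norm (b - b')" by (rule norm_triangle_ineq4)
      ultimately have "norm (?v - (b - b')) < 1" by linarith
      then have "?v - (b - b') = 0" by (rule int_lattice_norm_less_1[OF lat])
      then have v: "?v = b - b'" by simp
      show ?case unfolding v by (intro ballI cell_diff_small[OF b(1,2)])
    qed
    have "a - a' = 0"
    proof (rule ccontr)
      assume "a - a' \<noteq> 0"
      then have "filterlim (\<lambda>k. norm (?T k (a - a'))) at_top sequentially" by (rule orbit_tendsto_at_top[OF exp])
      then have "\<forall>\<^sub>F k in sequentially. 1/2 < norm (?T k (a - a'))" unfolding filterlim_at_top_dense by (rule spec)
      then obtain k where "1/2 < norm (?T k (a - a'))" by (auto dest: eventually_happens)
      then show False using small[OF bounded, of k] by simp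
    qed
    then show ?thesis using a by simp
  qed
  then show "\<exists>p. ?I \<subseteq> {p}" by (cases "?I = {}") blast+
qed

lemma markov_partition_cell_partition: "markov_partition (toral_endo A) (cell_partition L)"
  unfolding markov_partition_def
proof (intro conjI ballI)
  fix R assume "R \<in> cell_partition L"
  then show "proper_set R" unfolding cell_partition_def by (elim imageE) (simp add: proper_proj_cell)
qed (rule finite_cell_partition Union_cell_partition pairwise_cell_partition
    markov_property_cell_partition metrically_generating_cell_partition)+

end

text \<open>Let \<open>S\<close> be the transposed map and \<open>r\<close>, \<open>r'\<close> independent integer eigenvectors of \<open>S ^^ k\<close>. In the set \<open>E\<close> of
  the vectors \<open>(S ^^ i) \<rho>\<close> with \<open>\<rho> \<in> {r, r'}\<close> and \<open>i < k\<close>, each element is of the form \<open>S l'\<close> with \<open>l' \<in> E\<close>, or it is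
  \<open>r\<close> or \<open>r'\<close> and an integer multiple of it has this form. Multiplying \<open>E\<close> by a large integer \<open>N\<close>
  makes the cells small.\<close>

lemma ex_invariant_arrangement:
  fixes A :: "int^2^2"
  assumes exp: "expanding A" and k: "k > 0" and diag: "diagonalizable_integer_eigenvalues (mat_power A k)"
  obtains L where "invariant_arrangement L A"
proof -
  let ?M = "real_matrix A" and ?B = "real_matrix (mat_power A k)"
  define S where "S = (*v) (transpose ?M)"
  have S: "linear S" unfolding S_def by (rule matrix_vector_mul_linear)
  have S_inner: "S l \<bullet> x = l \<bullet> (?M *v x)" for l x
    by (simp add: S_def inner_vec_def matrix_vector_mult_def sum_2 transpose_def algebra_simps)
  have Sn_inner: "(S ^^ n) l \<bullet> x = l \<bullet> (((*v) ?M ^^ n) x)" for n l x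
    by (induction n arbitrary: x) (simp_all add: S_inner funpow_swap1[where f = "(*v) ?M"])
  obtain r r' m m' where r: "r \<in> int_lattice" "r' \<in> int_lattice" "cross2 r r' \<noteq> 0" "m \<in> \<int>" "m' \<in> \<int>"
    "transpose ?B *v r = m *\<^sub>R r" "transpose ?B *v r' = m' *\<^sub>R r'"
    by (rule integer_left_eigenbasis[OF diag])
  have Sk: "(S ^^ k) \<rho> = \<mu> *\<^sub>R \<rho>" if "transpose ?B *v \<rho> = \<mu> *\<^sub>R \<rho>" for \<rho> \<mu>
  proof -
    have "(S ^^ k) \<rho> \<bullet> x = (\<mu> *\<^sub>R \<rho>) \<bullet> x" for x
    proof -
      have "(S ^^ k) \<rho> \<bullet> x = \<rho> \<bullet> (?B *v x)" by (simp only: Sn_inner real_matrix_power)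
      also have "\<dots> = (transpose ?B *v \<rho>) \<bullet> x"
        by (simp add: inner_vec_def matrix_vector_mult_def sum_2 transpose_def algebra_simps del: map_matrix_def)
      finally show ?thesis by (simp only: that)
    qed
    then show ?thesis by (rule vector_eq_rdot[THEN iffD1, OF allI])
  qed
  have S_int: "(S ^^ n) l \<in> int_lattice" if "l \<in> int_lattice" for n l
  proof (induction n)
    case (Suc n)
    have "transpose ?M = real_matrix (transpose A)" by (simp add: vec_eq_iff transpose_def)
    then show ?case using int_matrix_lattice[OF Suc, of "transpose A"] by (simp add: S_def)
  qed (use that in simp)
  have S_nz: "(S ^^ n) l \<noteq> 0" if "l \<noteq> 0" for n l
  proof (induction n)
    case (Suc n)
    show ?case
    proof
      assume "(S ^^ Suc n) l = 0"
      then have z: "(S ^^ n) l \<bullet> (?M *v x) = 0" for x by (simp add: S_inner[symmetric])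
      obtain x where "?M *v x = (S ^^ n) l" by (rule expanding_surj[OF exp])
      then show False using z[of x] Suc by simp
    qed
  qed (use that in simp)
  define E where "E = (\<lambda>(\<rho>, i). (S ^^ i) \<rho>) ` ({r, r'} \<times> {..<k})"
  have rr: "r \<in> E" "r' \<in> E" unfolding E_def using k by force+
  have r0: "r \<noteq> 0" "r' \<noteq> 0" using r(3) by auto
  have E: "finite E" "E \<subseteq> int_lattice" "0 \<notin> E"
    using r(1,2) r0 S_int S_nz by (auto simp: E_def)
  have E_forward: "\<exists>l'\<in>E. \<exists>n::int. \<forall>x. l' \<bullet> (?M *v x) = of_int n * (l \<bullet> x)" if l: "l \<in> E" for l
  proof -
    obtain \<rho> i where \<rho>: "\<rho> \<in> {r, r'}" "i < k" "l = (S ^^ i) \<rho>" using l by (auto simp: E_def)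
    have mem: "(S ^^ j) \<rho> \<in> E" if "j < k" for j unfolding E_def using \<rho>(1) that by force
    show ?thesis
    proof (cases i)
      case (Suc j)
      have "(S ^^ j) \<rho> \<bullet> (?M *v x) = of_int 1 * (l \<bullet> x)" for x by (simp add: \<rho>(3) Suc S_inner)
      then show ?thesis using mem[of j] \<rho>(2) Suc by (meson Suc_lessD)
    next
      case 0
      obtain \<mu> where \<mu>: "\<mu> \<in> \<int>" "(S ^^ k) \<rho> = \<mu> *\<^sub>R \<rho>" using \<rho>(1) r(4,5) Sk[OF r(6)] Sk[OF r(7)] by blast
      obtain n where n: "\<mu> = of_int n" using \<mu>(1) by (rule Ints_cases)
      obtain j where j: "k = Suc j" using k by (cases k) auto
      have "(S ^^ j) \<rho> \<bullet> (?M *v x) = of_int n * (l \<bullet> x)" for x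
        using \<mu>(2) by (simp add: \<rho>(3) 0 S_inner[symmetric] j n)
      then show ?thesis using mem[of j] j by (meson lessI)
    qed
  qed
  define K where "K = onorm ((*v) ?M)"
  have K: "K \<ge> 0" "\<And>x. norm (?M *v x) \<le> K * norm x"
    unfolding K_def by (auto intro!: onorm_pos_le onorm matrix_vector_mul_bounded_linear)
  define C where "C = 2 * (norm r + norm r') / \<bar>cross2 r r'\<bar>"
  have C0: "C \<ge> 0" by (simp add: C_def)
  have E_small: "norm x \<le> C * \<delta>" if x: "\<And>l. l \<in> E \<Longrightarrow> \<bar>l \<bullet> x\<bar> \<le> \<delta>" for x \<delta>
  proof -
    have comp: "\<bar>x $ i\<bar> \<le> (norm r + norm r') * \<delta> / \<bar>cross2 r r'\<bar>" for i
    proof -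
      have "\<exists>a b. cross2 r r' * x $ i = a * (r \<bullet> x) + b * (r' \<bullet> x) \<and> \<bar>a\<bar> \<le> norm r' \<and> \<bar>b\<bar> \<le> norm r"
      proof (cases "i = 1")
        case True
        have "cross2 r r' * x $ i = r' $ 2 * (r \<bullet> x) + (- r $ 2) * (r' \<bullet> x)"
          by (simp add: True cross2_def inner_vec_def sum_2 algebra_simps)
        then show ?thesis using component_le_norm_cart by (intro exI[of _ "r' $ 2"] exI[of _ "- r $ 2"]) auto
      next
        case False
        then have i: "i = 2" using exhaust_2 by blast
        have "cross2 r r' * x $ i = (- r' $ 1) * (r \<bullet> x) + r $ 1 * (r' \<bullet> x)"
          by (simp add: i cross2_def inner_vec_def sum_2 algebra_simps)
        then show ?thesis using component_le_norm_cart by (intro exI[of _ "- r' $ 1"] exI[of _ "r $ 1"]) auto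
      qed
      then obtain a b where ab: "cross2 r r' * x $ i = a * (r \<bullet> x) + b * (r' \<bullet> x)" "\<bar>a\<bar> \<le> norm r'" "\<bar>b\<bar> \<le> norm r"
        by blast
      have "\<bar>cross2 r r'\<bar> * \<bar>x $ i\<bar> = \<bar>a * (r \<bullet> x) + b * (r' \<bullet> x)\<bar>" using ab(1) by (metis abs_mult)
      also have "\<dots> \<le> \<bar>a\<bar> * \<bar>r \<bullet> x\<bar> + \<bar>b\<bar> * \<bar>r' \<bullet> x\<bar>" by (metis abs_mult abs_triangle_ineq)
      also have "\<dots> \<le> norm r' * \<delta> + norm r * \<delta>"
        using ab(2,3) x[OF rr(1)] x[OF rr(2)] by (intro add_mono mult_mono) auto
      finally show ?thesis using r(3) by (simp add: field_simps)
    qed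
    have "norm x \<le> \<bar>x $ 1\<bar> + \<bar>x $ 2\<bar>" using norm_le_l1_cart[of x] by (simp add: sum_2)
    also have "\<dots> \<le> 2 * ((norm r + norm r') * \<delta> / \<bar>cross2 r r'\<bar>)" using comp[of 1] comp[of 2] by linarith
    also have "\<dots> = C * \<delta>" by (simp add: C_def)
    finally show ?thesis .
  qed
  define N where "N = \<lceil>2 * (1 + K) * (C + 1)\<rceil>"
  have N: "real_of_int N \<ge> 2 * (1 + K) * (C + 1)" unfolding N_def by (rule le_of_int_ceiling)
  have "2 * (1 + K) * (C + 1) > 0" using K(1) C0 by (intro mult_pos_pos) auto
  then have N0: "real_of_int N > 0" using N by linarith
  define L where "L = (\<lambda>l. real_of_int N *\<^sub>R l) ` E"
  have L_small: "(1 + K) * norm x < 1/2" if x: "\<forall>l\<in>L. \<bar>l \<bullet> x\<bar> \<le> 1" for x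
  proof -
    have "\<bar>l \<bullet> x\<bar> \<le> 1 / real_of_int N" if "l \<in> E" for l
    proof -
      have "\<bar>(real_of_int N *\<^sub>R l) \<bullet> x\<bar> \<le> 1" using x that by (auto simp: L_def)
      then show ?thesis using N0 by (simp add: abs_mult field_simps)
    qed
    then have "norm x \<le> C * (1 / real_of_int N)" by (rule E_small)
    then have "real_of_int N * norm x \<le> C" using N0 by (simp add: field_simps)
    moreover have "2 * (1 + K) * (C + 1) * norm x \<le> real_of_int N * norm x"
      using N by (intro mult_right_mono) auto
    ultimately have "(2 * (1 + K) * norm x) * (C + 1) < 1 * (C + 1)" by (simp add: algebra_simps)
    then have "2 * (1 + K) * norm x < 1" using C0 by (simp add: mult_less_cancel_right)
    then show ?thesis by linarith
  qed
  have "invariant_arrangement L A"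
  proof unfold_locales
    show "finite L" "0 \<notin> L" using E N0 by (auto simp: L_def)
    show "L \<subseteq> int_lattice"
      unfolding L_def using E(2) by (auto intro!: int_lattice_scale)
    show "norm x < 1/2" if x: "\<forall>l\<in>L. \<bar>l \<bullet> x\<bar> \<le> 1" for x
    proof -
      have "1 * norm x \<le> (1 + K) * norm x" using K(1) by (intro mult_right_mono) auto
      then show ?thesis using L_small[OF x] by linarith
    qed
    show "norm (?M *v x) < 1/2" if x: "\<forall>l\<in>L. \<bar>l \<bullet> x\<bar> \<le> 1" for x
    proof -
      have "norm (?M *v x) \<le> K * norm x" by (rule K(2))
      also have "\<dots> \<le> (1 + K) * norm x" by (intro mult_right_mono) auto
      finally show ?thesis using L_small[OF x] by linarith
    qed
    show "expanding A" by (rule exp)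
    show "\<exists>l'\<in>L. \<exists>m::int. \<forall>x. l' \<bullet> (?M *v x) = of_int m * (l \<bullet> x)" if l: "l \<in> L" for l
    proof -
      obtain e where e: "e \<in> E" "l = real_of_int N *\<^sub>R e" using l by (auto simp: L_def)
      obtain e' n where e': "e' \<in> E" "\<And>x. e' \<bullet> (?M *v x) = of_int (n::int) * (e \<bullet> x)" using E_forward[OF e(1)] by blast
      have "(real_of_int N *\<^sub>R e') \<bullet> (?M *v x) = of_int n * (l \<bullet> x)" for x
        unfolding e(2) inner_scaleR_left e'(2) by simp
      moreover have "real_of_int N *\<^sub>R e' \<in> L" unfolding L_def using e'(1) by (rule imageI)
      ultimately show ?thesis by blast
    qed
  qed
  then show ?thesis by (rule that)
qed

section \<open>Linear partitions are smooth\<close>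

text \<open>Two parameters with the same image in the torus differ by an integer vector of norm less than \<open>1\<close>.\<close>

lemma C1_arc_short_segment:
  fixes c d :: "real^'n::finite"
  assumes "d \<noteq> 0" "norm d < 1"
  shows "C1_arc (torus_proj ` (\<lambda>t. c + t *\<^sub>R d) ` {0..1})"
  unfolding C1_arc_def
proof (intro exI conjI ballI)
  let ?\<gamma> = "\<lambda>t. torus_proj (c + t *\<^sub>R d)"
  show "torus_proj ` (\<lambda>t. c + t *\<^sub>R d) ` {0..1} = ?\<gamma> ` {0..1}" by (simp add: image_image)
  show "inj_on ?\<gamma> {0..1}"
  proof (rule inj_onI)
    fix s t :: real assume st: "s \<in> {0..1}" "t \<in> {0..1}" "?\<gamma> s = ?\<gamma> t"
    have "(c + s *\<^sub>R d) - (c + t *\<^sub>R d) \<in> int_lattice" using st(3) by (simp only: torus_proj_eq_lattice)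
    then have lat: "(s - t) *\<^sub>R d \<in> int_lattice" by (simp add: algebra_simps)
    have "norm ((s - t) *\<^sub>R d) \<le> 1 * norm d" unfolding norm_scaleR using st by (intro mult_right_mono) auto
    then have "(s - t) *\<^sub>R d = 0" using assms(2) by (intro int_lattice_norm_less_1[OF lat]) simp
    then show "s = t" using assms(1) by simp
  qed
  show "continuous_on {0..1} (\<lambda>t::real. d)" by simp
  show "d \<noteq> 0" by fact
  show "has_torus_derivative ?\<gamma> d t {0..1}" for t
    unfolding has_torus_derivative_def
    by (rule exI[of _ "\<lambda>t. c + t *\<^sub>R d"]) (auto intro!: derivative_eq_intros simp: has_vector_derivative_def)
qed

lemma segment_eq_Union_short_segments:
  fixes a b :: "real^'n::finite"
  assumes "N > 0"
  shows "closed_segment a b =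
    (\<Union>i<N. (\<lambda>t. (a + (real i / real N) *\<^sub>R (b - a)) + t *\<^sub>R ((b - a) /\<^sub>R real N)) ` {0..1})"
proof -
  have seg: "closed_segment a b = (\<lambda>u. a + u *\<^sub>R (b - a)) ` {0..1}"
  proof -
    have "(1 - u) *\<^sub>R a + u *\<^sub>R b = a + u *\<^sub>R (b - a)" for u by (simp add: algebra_simps)
    then show ?thesis by (auto simp: closed_segment_def)
  qed
  have par: "(a + (real i / real N) *\<^sub>R (b - a)) + t *\<^sub>R ((b - a) /\<^sub>R real N) = a + ((real i + t) / real N) *\<^sub>R (b - a)" for i t
    by (simp only: divide_inverse distrib_right scaleR_add_left scaleR_scaleR add.assoc)
  show ?thesis unfolding seg par
  proof (intro equalityI subsetI)
    fix x assume "x \<in> (\<lambda>u. a + u *\<^sub>R (b - a)) ` {0..1}"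
    then obtain u where u: "0 \<le> u" "u \<le> 1" "x = a + u *\<^sub>R (b - a)" by auto
    show "x \<in> (\<Union>i<N. (\<lambda>t. a + ((real i + t) / real N) *\<^sub>R (b - a)) ` {0..1})"
    proof (cases "u = 1")
      case True
      then have "x = a + ((real (N - 1) + 1) / real N) *\<^sub>R (b - a)" using assms u(3) by (simp add: of_nat_diff)
      then show ?thesis using assms by (intro UN_I[of "N - 1"] image_eqI[of _ _ 1]) auto
    next
      case False
      define i where "i = nat \<lfloor>u * N\<rfloor>"
      have uN: "0 \<le> u * N" "u * N < N" using u False assms by auto
      have ri: "real i = of_int \<lfloor>u * N\<rfloor>" using uN(1) by (simp add: i_def)
      have "real i \<le> u * N" "u * N < real i + 1" unfolding ri by linarith+
      moreover from this have "i < N" using uN(2) by linarith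
      moreover have "x = a + ((real i + (u * N - real i)) / real N) *\<^sub>R (b - a)" using u(3) assms by simp
      ultimately show ?thesis by (intro UN_I[of i] image_eqI[of _ _ "u * N - real i"]) auto
    qed
  next
    fix x assume "x \<in> (\<Union>i<N. (\<lambda>t. a + ((real i + t) / real N) *\<^sub>R (b - a)) ` {0..1})"
    then obtain i t where it: "i < N" "0 \<le> t" "t \<le> 1" "x = a + ((real i + t) / real N) *\<^sub>R (b - a)" by auto
    have "real i + t \<le> real N" using it(1,3) by linarith
    then have "(real i + t) / real N \<in> {0..1}" using it(2) assms by simp
    then show "x \<in> (\<lambda>u. a + u *\<^sub>R (b - a)) ` {0..1}" using it(4) by blast
  qed
qed

lemma segment_finite_Union_C1_arcs:
  fixes a b :: "real^'n::finite"
  assumes "a \<noteq> b"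
  shows "\<exists>\<C>. finite \<C> \<and> (\<forall>C\<in>\<C>. C1_arc C) \<and> torus_proj ` closed_segment a b = \<Union>\<C>"
proof -
  obtain N :: nat where N: "norm (b - a) < real N" using reals_Archimedean2 by blast
  have N0: "N > 0" using N norm_ge_zero[of "b - a"] by (cases N) auto
  let ?S = "\<lambda>i. torus_proj ` (\<lambda>t. (a + (real i / real N) *\<^sub>R (b - a)) + t *\<^sub>R ((b - a) /\<^sub>R real N)) ` {0..1}"
  have "norm ((b - a) /\<^sub>R real N) = norm (b - a) / real N" by (simp add: divide_inverse mult.commute)
  then have "norm ((b - a) /\<^sub>R real N) < 1" using N N0 by simp
  then have "C1_arc (?S i)" for i
    using assms N0 by (intro C1_arc_short_segment) simp_all
  moreover have "torus_proj ` closed_segment a b = \<Union>(?S ` {..<N})"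
    by (subst segment_eq_Union_short_segments[OF N0]) (simp only: image_UN)
  ultimately show ?thesis by (intro exI[of _ "?S ` {..<N}"]) blast
qed

lemma linear_imp_smooth_partition:
  assumes "linear_partition \<M>" shows "smooth_partition \<M>"
proof -
  obtain S where S: "finite S" "\<forall>(a, b)\<in>S. a \<noteq> b"
    "partition_boundary \<M> = (\<Union>(a, b)\<in>S. torus_proj ` closed_segment a b)"
    using assms unfolding linear_partition_def by (elim exE conjE)
  have "\<forall>s\<in>S. \<exists>\<C>. finite \<C> \<and> (\<forall>C\<in>\<C>. C1_arc C) \<and> torus_proj ` closed_segment (fst s) (snd s) = \<Union>\<C>"
    using S(2) by (intro ballI segment_finite_Union_C1_arcs) auto
  from bchoice[OF this] obtain F where F: "\<forall>s\<in>S. finite (F s) \<and> (\<forall>C\<in>F s. C1_arc C) \<and>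
      torus_proj ` closed_segment (fst s) (snd s) = \<Union>(F s)" by (rule exE)
  have "partition_boundary \<M> = (\<Union>s\<in>S. torus_proj ` closed_segment (fst s) (snd s))"
    unfolding S(3) by (simp add: case_prod_unfold)
  also have "\<dots> = (\<Union>s\<in>S. \<Union>(F s))" using F by simp
  also have "\<dots> = \<Union>(\<Union>s\<in>S. F s)" by blast
  finally have "partition_boundary \<M> = \<Union>(\<Union>s\<in>S. F s)" .
  moreover have "finite (\<Union>s\<in>S. F s)" using S(1) F by simp
  moreover have "\<forall>C\<in>(\<Union>s\<in>S. F s). C1_arc C" using F by simp
  ultimately show ?thesis unfolding smooth_partition_def by blast
qed

theorem corollary1p4:
  fixes A :: "int^2^2"
  assumes "expanding A"
  shows "((\<exists>\<M>. markov_partition (toral_endo A) \<M> \<and> smooth_partition \<M>) \<longleftrightarrow>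
          (\<exists>k>0. diagonalizable_integer_eigenvalues (mat_power A k)))
       \<and> ((\<exists>\<M>. markov_partition (toral_endo A) \<M> \<and> linear_partition \<M>) \<longleftrightarrow>
          (\<exists>k>0. diagonalizable_integer_eigenvalues (mat_power A k)))"
proof -
  let ?diag = "\<exists>k>0. diagonalizable_integer_eigenvalues (mat_power A k)"
  have diag_if_smooth: ?diag if "\<exists>\<M>. markov_partition (toral_endo A) \<M> \<and> smooth_partition \<M>"
    using that smooth_markov_imp_power_diagonalizable[OF assms] by blast
  have linear_if_diag: "\<exists>\<M>. markov_partition (toral_endo A) \<M> \<and> linear_partition \<M>" if ?diag
  proof -
    obtain k where "k > 0" "diagonalizable_integer_eigenvalues (mat_power A k)" using \<open>?diag\<close> by blast
    then obtain L where "invariant_arrangement L A" by (rule ex_invariant_arrangement[OF assms])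
    then interpret invariant_arrangement L A .
    show ?thesis using markov_partition_cell_partition linear_cell_partition by blast
  qed
  have smooth_if_linear: "\<exists>\<M>. markov_partition (toral_endo A) \<M> \<and> smooth_partition \<M>"
    if "\<exists>\<M>. markov_partition (toral_endo A) \<M> \<and> linear_partition \<M>"
    using that linear_imp_smooth_partition by blast
  show ?thesis using diag_if_smooth linear_if_diag smooth_if_linear by blast
qed

end
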